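(* In the setting described in the context, suppose that $\hat\phi_T$ is the minimizer of the empirical error functional $\mathcal{E}_T$ over the hypothesis space $\mathcal{H}=\mathcal{K}_{R,S}$ and that $\phi\in\mathcal{K}_{R,S}$. Then there exists $\gamma\ge0$, a function of $R,S,K$, such that $$\mathbb{E}_\pi\big[\|\hat\phi_T-\phi\|_{L^{2,*}_\rho}\big]\le\gamma\,\sqrt[4]{\frac{128\,c_{\mathcal{M}}K^2+\tau c_{\mathcal{H}}\log(T)}{T\,c_{\mathcal{H}}^2}},$$ where $\tau,c_{\mathcal{M}}$ are positive constants depending on the ergodicity rate of the network.
   Context: Network. Fix $n,d\ge1$, $h>0$, coefficients $k_{ij}\ge0$, $K=\max_{i,j}k_{ij}$, and the true coupling function $\phi:\mathbb{R}\to\mathbb{R}$, which is positive, continuous on $[0,\infty)$, differentiable at zero and bounded above by $S_0>0$. The graph $\mathcal{G}_0$ ($i\sim j$ iff $k_{ij}>0$) is undirected, simple and connected; $N_e$ is its number of edges and $\mathcal{N}_i$ the set of neighbours of $i$. For $x=[x^1;\dots;x^n]\in\mathbb{R}^{dn}$ the Laplacian $L_x$ has $d\times d$ blocks $(L_x)_{ij}=-k_{ij}\phi(\|x^j-x^i\|)I_d$ ($j\neq i$), $(L_x)_{ii}=\sum_k k_{ik}\phi(\|x^k-x^i\|)I_d$. With $\Delta=\{[u;\dots;u]:u\in\mathbb{R}^d\}$, the network on $\Delta^\perp$ is $$x_{t+1}=(I-hL_{x_t})x_t+hw_t=x_t+hF_\phi(x_t)+hw_t,\qquad x_t,w_t\in\Delta^\perp,$$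 where for a function $\psi$, $(F_\psi(x))_i=\sum_{j=1}^n k_{ij}\psi(\|x^j-x^i\|)(x^j-x^i)$. The initial condition and noise are the orthogonal projections onto $\Delta^\perp$ of an initial vector with bounded i.i.d. entries and norm at most $R_0$ a.s., and of i.i.d. (in $t$) noise vectors with bounded i.i.d. entries, independent of the current state, having mean $0$, covariance $I\otimes\Sigma$, norm at most $\omega$ a.s. and a lower semicontinuous density. The system is uniformly contractive: $\lambda_{\max}(L_{x_t})<2/h$ along all trajectories, so that $\zeta:=\sup_{t\ge0}\max\{|1-h\lambda_2(L_{x_t})|,|1-h\lambda_{\max}(L_{x_t})|\}<1$ ($\lambda_2,\lambda_{\max}$: smallest non-zero and largest eigenvalue). Put $R:=2\big(R_0+\frac{h\omega}{1-\zeta}\big)$; all distances $r_t^{ij}=\|x_t^j-x_t^i\|$ lie in $[0,R]$ a.s. Under these assumptions the chain is geometrically ergodic (exponential convergence in total variation to an invariant probability measure); $\pi$ denotes its invariant probability measure and $\mathbb{E}_\pi$ expectation with respect to the stationary distribution (for a functional of the trajectory: expectation over the trajectory in the stationary regime). Measure and norm. $\rho$ is the measure on $[0,R]$ given by $\rho(B)=\frac1{N_e}\sum_{i=1}^n\sum_{j\in\mathcal{N}_i}\mathbb{P}_\pi(\|x^j-x^i\|\in B)$. Define $\|\psi\|_{L^{2,*}_\rho}=\big(\int_0^R|\psi(r)r|^2\rho(dr)\big)^{1/2}$. Error functional. $\mathcal{E}_T(\psi)=\frac1{TN_e}\sum_{t=1}^T\big\|\frac{x_{t+1}-x_t}{h}-F_\psi(x_t)\big\|^2$,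 where $T\ge1$ is the length of the single sample trajectory. Hypothesis space. $\mathcal{K}_{R,S}=\{\psi\in\mathrm{Lip}_c([0,R]):\|\psi\|_\infty+\mathrm{Lip}(\psi)\le S\}\subset L^\infty([0,R])$, where $\mathrm{Lip}_c([0,R])$ is the class of Lipschitz functions with compact support over $[0,R]$ and $\mathrm{Lip}(\psi)$ is the Lipschitz constant of $\psi$ on $[0,R]$. The hypothesis space $\mathcal{H}=\mathcal{K}_{R,S}$ is assumed coercive, i.e. $$c_{\mathcal{H}}:=\frac1{N_e}\inf_{\psi\in\mathcal{H}\setminus\{0\}}\frac{\mathbb{E}_\pi[\|F_\psi(x)\|^2]}{\|\psi\|^2_{L^{2,*}_\rho}}>0 .$$ *)

theory Defs
  imports
    "Jordan_Normal_Form.Spectral_Radius"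
    "HOL-Analysis.Lipschitz"
    "HOL-Probability.Probability"
begin

text \<open>
  A vector of \<open>\<real>\<^sup>d\<^sup>n\<close> with \<open>n\<close> blocks of length \<open>d\<close> is a function \<open>x\<close>, extensional on
  \<open>{..<n}\<close> and \<open>{..<d}\<close>, where \<open>x i a\<close> is the coordinate \<open>a\<close> of the block \<open>i\<close>. The sizes
  \<open>n\<close>, \<open>d\<close> are numbers and not types, so that constants can be chosen before them.
\<close>

type_synonym state = "nat \<Rightarrow> nat \<Rightarrow> real"

text \<open>
  The fields \<open>init_law\<close> and \<open>noise_law\<close> are the laws on \<open>\<real>\<^sup>d\<close> of a single block of the initial
  vector and of the noise vectors, before projection. The blocks, not the scalar coordinates,
  are i.i.d.; this is what the covariance \<open>I \<otimes> \<Sigma>\<close> with a general \<open>\<Sigma>\<close> means, and it includes the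
  case of i.i.d. scalar coordinates.
\<close>

record network =
  nodes :: nat
  block_dim :: nat
  step_size :: real
  weight :: "nat \<Rightarrow> nat \<Rightarrow> real"
  coupling :: "real \<Rightarrow> real"
  init_law :: "(nat \<Rightarrow> real) measure"
  noise_law :: "(nat \<Rightarrow> real) measure"

definition block_space :: "network \<Rightarrow> (nat \<Rightarrow> real) measure" where
  "block_space N = PiM {..<block_dim N} (\<lambda>_. borel)"

definition state_space :: "network \<Rightarrow> state measure" where
  "state_space N = PiM {..<nodes N} (\<lambda>_. block_space N)"

definition state_norm :: "network \<Rightarrow> state \<Rightarrow> real" where
  "state_norm N x = L2_set (\<lambda>i. L2_set (x i) {..<block_dim N}) {..<nodes N}"

definition node_dist :: "network \<Rightarrow> state \<Rightarrow> nat \<Rightarrow> nat \<Rightarrow> real" where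
  "node_dist N x i j = L2_set (\<lambda>a. x j a - x i a) {..<block_dim N}"

definition neighbours :: "network \<Rightarrow> nat \<Rightarrow> nat set" where
  "neighbours N i = {j. j < nodes N \<and> 0 < weight N i j}"

definition num_edges :: "network \<Rightarrow> nat" where
  "num_edges N = card {{i, j} |i j. i < nodes N \<and> j \<in> neighbours N i}"

definition max_weight :: "network \<Rightarrow> real" where
  "max_weight N = Max {weight N i j |i j. i < nodes N \<and> j < nodes N}"

definition force :: "network \<Rightarrow> (real \<Rightarrow> real) \<Rightarrow> state \<Rightarrow> state" where
  "force N \<psi> x = (\<lambda>i\<in>{..<nodes N}. \<lambda>a\<in>{..<block_dim N}.
     \<Sum>j<nodes N. weight N i j * \<psi> (node_dist N x i j) * (x j a - x i a))"

text \<open>Row and column \<open>p\<close> of the \<open>dn \<times> dn\<close> matrix stand for the coordinate \<open>p mod d\<close> of the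
  block \<open>p div d\<close>.\<close>

definition laplacian :: "network \<Rightarrow> state \<Rightarrow> real mat" where
  "laplacian N x = Matrix.mat (nodes N * block_dim N) (nodes N * block_dim N) (\<lambda>(p, q).
     let i = p div block_dim N; j = q div block_dim N in
     if p mod block_dim N \<noteq> q mod block_dim N then 0
     else if i = j then \<Sum>l<nodes N. weight N i l * coupling N (node_dist N x i l)
     else - (weight N i j * coupling N (node_dist N x i j)))"

definition lambda_max :: "network \<Rightarrow> state \<Rightarrow> real" where
  "lambda_max N x = Max (spectrum (laplacian N x))"

definition lambda_2 :: "network \<Rightarrow> state \<Rightarrow> real" where
  "lambda_2 N x = Min (spectrum (laplacian N x) - {0})"

definition contraction :: "network \<Rightarrow> state \<Rightarrow> real" where
  "contraction N x =
     max \<bar>1 - step_size N * lambda_2 N x\<bar> \<bar>1 - step_size N * lambda_max N x\<bar>"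

text \<open>The orthogonal projection onto \<open>\<Delta>\<^sup>\<bottom>\<close>, which subtracts the average of the blocks.\<close>

definition proj :: "network \<Rightarrow> state \<Rightarrow> state" where
  "proj N x = (\<lambda>i\<in>{..<nodes N}. \<lambda>a\<in>{..<block_dim N}.
     x i a - (\<Sum>j<nodes N. x j a) / real (nodes N))"

definition init_vector_law :: "network \<Rightarrow> state measure" where
  "init_vector_law N = PiM {..<nodes N} (\<lambda>_. init_law N)"

definition noise_vector_law :: "network \<Rightarrow> state measure" where
  "noise_vector_law N = PiM {..<nodes N} (\<lambda>_. noise_law N)"

definition init_measure :: "network \<Rightarrow> state measure" where
  "init_measure N = distr (init_vector_law N) (state_space N) (proj N)"

definition noise_measure :: "network \<Rightarrow> state measure" where
  "noise_measure N = distr (noise_vector_law N) (state_space N) (proj N)"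

text \<open>By the definition of the Laplacian, \<open>x + h F\<^sub>\<phi>(x) = (I - h L\<^sub>x) x\<close>.\<close>

definition step :: "network \<Rightarrow> state \<Rightarrow> state \<Rightarrow> state" where
  "step N x w = (\<lambda>i\<in>{..<nodes N}. \<lambda>a\<in>{..<block_dim N}.
     x i a + step_size N * force N (coupling N) x i a + step_size N * w i a)"

text \<open>Everything random is a function of the starting point and the noise sequence. They live on
  the product space below, which makes the noise i.i.d. and \<open>w\<^sub>t\<close> independent of
  \<open>x\<^sub>0, \<dots>, x\<^sub>t\<close>.\<close>

type_synonym sample = "state \<times> (nat \<Rightarrow> state)"

primrec trajectory :: "network \<Rightarrow> sample \<Rightarrow> nat \<Rightarrow> state" where
  "trajectory N s 0 = fst s"
| "trajectory N s (Suc t) = step N (trajectory N s t) (snd s t)"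

definition noise_seq_measure :: "network \<Rightarrow> (nat \<Rightarrow> state) measure" where
  "noise_seq_measure N = PiM UNIV (\<lambda>_. noise_measure N)"

definition sample_measure :: "network \<Rightarrow> state measure \<Rightarrow> sample measure" where
  "sample_measure N \<mu> = \<mu> \<Otimes>\<^sub>M noise_seq_measure N"

text \<open>The supremum over all trajectories is an essential supremum: null sets of trajectories are
  disregarded.\<close>

definition zeta :: "network \<Rightarrow> ereal" where
  "zeta N = (SUP t. esssup (sample_measure N (init_measure N))
     (\<lambda>s. ereal (contraction N (trajectory N s t))))"

definition radius :: "network \<Rightarrow> real \<Rightarrow> real \<Rightarrow> real" where
  "radius N R0 \<omega> = 2 * (R0 + step_size N * \<omega> / (1 - real_of_ereal (zeta N)))"

definition lsc_on_states :: "network \<Rightarrow> (state \<Rightarrow> real) \<Rightarrow> bool" where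
  "lsc_on_states N f \<longleftrightarrow> (\<forall>c. openin
     (product_topology (\<lambda>_. product_topology (\<lambda>_. euclideanreal) {..<block_dim N}) {..<nodes N})
     {x \<in> space (state_space N). c < f x})"

locale contractive_network =
  fixes N :: network and S0 R0 \<omega> :: real and \<Sigma> :: "nat \<Rightarrow> nat \<Rightarrow> real"
  assumes nodes: "1 \<le> nodes N"
    and block_dim: "1 \<le> block_dim N"
    and step_size: "0 < step_size N"
    and weight_nonneg: "\<And>i j. i < nodes N \<Longrightarrow> j < nodes N \<Longrightarrow> 0 \<le> weight N i j"
    and undirected: "\<And>i j. i < nodes N \<Longrightarrow> j < nodes N \<Longrightarrow> weight N i j = weight N j i"
    and no_loops: "\<And>i. i < nodes N \<Longrightarrow> weight N i i = 0"
    and connected: "\<And>i j. i < nodes N \<Longrightarrow> j < nodes N \<Longrightarrow>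
          (i, j) \<in> {(i, j). i < nodes N \<and> j \<in> neighbours N i}\<^sup>*"
    and coupling_pos: "\<And>r. 0 < coupling N r"
    and coupling_continuous: "continuous_on {0..} (coupling N)"
    and coupling_differentiable: "coupling N differentiable at 0"
    and coupling_bounded: "0 < S0" "\<And>r. coupling N r \<le> S0"
    and init_law: "prob_space (init_law N)" "sets (init_law N) = sets (block_space N)"
    and init_bounded: "AE x in init_vector_law N. state_norm N x \<le> R0"
    and noise_law: "prob_space (noise_law N)" "sets (noise_law N) = sets (block_space N)"
    and noise_bounded: "AE w in noise_vector_law N. state_norm N w \<le> \<omega>"
    and noise_mean: "\<And>i a. i < nodes N \<Longrightarrow> a < block_dim N \<Longrightarrow>
          (\<integral>w. w i a \<partial>noise_vector_law N) = 0"
    and noise_covariance: "\<And>i j a b. i < nodes N \<Longrightarrow> j < nodes N \<Longrightarrow>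
          a < block_dim N \<Longrightarrow> b < block_dim N \<Longrightarrow>
          (\<integral>w. w i a * w j b \<partial>noise_vector_law N) = (if i = j then \<Sigma> a b else 0)"
    and noise_density: "\<exists>f. lsc_on_states N f \<and> (\<forall>w. 0 \<le> f w) \<and>
          noise_vector_law N =
            density (PiM {..<nodes N} (\<lambda>_. PiM {..<block_dim N} (\<lambda>_. lborel))) (\<lambda>w. ennreal (f w))"
    and contractive: "AE s in sample_measure N (init_measure N).
          \<forall>t. lambda_max N (trajectory N s t) < 2 / step_size N"
    and uniformly_contractive: "zeta N < 1"

definition transition :: "network \<Rightarrow> nat \<Rightarrow> state \<Rightarrow> state measure" where
  "transition N t x =
     distr (noise_seq_measure N) (state_space N) (\<lambda>w. trajectory N (x, w) t)"

definition invariant_law :: "network \<Rightarrow> state measure \<Rightarrow> bool" where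
  "invariant_law N \<pi> \<longleftrightarrow> prob_space \<pi> \<and> sets \<pi> = sets (state_space N) \<and>
     (\<forall>B\<in>sets \<pi>. emeasure \<pi> B = (\<integral>\<^sup>+x. emeasure (transition N 1 x) B \<partial>\<pi>))"

definition tv_dist :: "'a measure \<Rightarrow> 'a measure \<Rightarrow> real" where
  "tv_dist \<mu> \<nu> = (SUP B\<in>sets \<mu>. \<bar>measure \<mu> B - measure \<nu> B\<bar>)"

text \<open>Contraction holds only along the trajectories of the network, so convergence is not to be
  expected from every point of \<open>\<Delta>\<^sup>\<bottom>\<close>. The state space of the chain is a set \<open>X\<close> that carries the
  initial law and that the chain does not leave. The rate of convergence is described by \<open>\<eta>\<close> and
  the \<open>\<pi>\<close>-integral of the prefactor \<open>V\<close>; a constant \<open>V\<close> is uniform ergodicity.\<close>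

definition geometrically_ergodic ::
  "network \<Rightarrow> state measure \<Rightarrow> (state \<Rightarrow> real) \<Rightarrow> real \<Rightarrow> bool" where
  "geometrically_ergodic N \<pi> V \<eta> \<longleftrightarrow> invariant_law N \<pi> \<and> integrable \<pi> V \<and> 0 \<le> \<eta> \<and> \<eta> < 1 \<and>
     (\<exists>X\<in>sets (state_space N).
        (AE x in init_measure N. x \<in> X) \<and>
        (\<forall>x\<in>X. AE w in noise_measure N. step N x w \<in> X) \<and>
        (\<forall>x\<in>X. \<forall>t. tv_dist (transition N t x) \<pi> \<le> V x * \<eta> ^ t))"

definition rho :: "network \<Rightarrow> state measure \<Rightarrow> real \<Rightarrow> real measure" where
  "rho N \<pi> R = measure_of {0..R} (sets (restrict_space borel {0..R}))
     (\<lambda>B. ennreal (1 / real (num_edges N)) *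
        (\<Sum>i<nodes N. \<Sum>j\<in>neighbours N i. emeasure \<pi> {x \<in> space \<pi>. node_dist N x i j \<in> B}))"

definition L2_norm :: "network \<Rightarrow> state measure \<Rightarrow> real \<Rightarrow> (real \<Rightarrow> real) \<Rightarrow> real" where
  "L2_norm N \<pi> R \<psi> = sqrt (\<integral>r. \<bar>\<psi> r * r\<bar>\<^sup>2 \<partial>rho N \<pi> R)"

definition error_functional ::
  "network \<Rightarrow> nat \<Rightarrow> (nat \<Rightarrow> state) \<Rightarrow> (real \<Rightarrow> real) \<Rightarrow> real" where
  "error_functional N T x \<psi> = 1 / (real T * real (num_edges N)) *
     (\<Sum>t=1..T. (state_norm N (\<lambda>i a.
        (x (Suc t) i a - x t i a) / step_size N - force N \<psi> (x t) i a))\<^sup>2)"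

text \<open>A function on \<open>[0,R]\<close> is represented by its extension to \<open>\<real>\<close> by zero. The support condition
  of \<open>Lip\<^sub>c([0,R])\<close> is automatic because \<open>[0,R]\<close> is compact.\<close>

definition extend_zero :: "real \<Rightarrow> (real \<Rightarrow> real) \<Rightarrow> real \<Rightarrow> real" where
  "extend_zero R \<psi> r = (if r \<in> {0..R} then \<psi> r else 0)"

definition lip_const :: "real \<Rightarrow> (real \<Rightarrow> real) \<Rightarrow> real" where
  "lip_const R \<psi> = Inf {C. C-lipschitz_on {0..R} \<psi>}"

definition hyp_space :: "real \<Rightarrow> real \<Rightarrow> (real \<Rightarrow> real) set" where
  "hyp_space R S = {\<psi>. (\<forall>r. r \<notin> {0..R} \<longrightarrow> \<psi> r = 0) \<and> (\<exists>C. C-lipschitz_on {0..R} \<psi>) \<and>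
     (SUP r\<in>{0..R}. \<bar>\<psi> r\<bar>) + lip_const R \<psi> \<le> S}"

text \<open>Here \<open>\<psi> \<noteq> 0\<close> is meant in \<open>L\<^sup>2\<^sup>,\<^sup>*\<^sub>\<rho>\<close>: a function that vanishes almost everywhere gives the
  quotient \<open>0/0\<close>, and such functions other than \<open>0\<close> exist whenever \<open>\<rho>\<close> does not have full
  support in \<open>[0,R]\<close>.\<close>

definition coercivity_const :: "network \<Rightarrow> state measure \<Rightarrow> real \<Rightarrow> real \<Rightarrow> real" where
  "coercivity_const N \<pi> R S = 1 / real (num_edges N) *
     (INF \<psi>\<in>{\<psi> \<in> hyp_space R S. L2_norm N \<pi> R \<psi> \<noteq> 0}.
        (\<integral>x. (state_norm N (force N \<psi> x))\<^sup>2 \<partial>\<pi>) / (L2_norm N \<pi> R \<psi>)\<^sup>2)"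

end

theory Submission
  imports Defs
begin

text \<open>
  Let \<open>\<delta>\<close> be the difference of the estimator and the coupling function. Since the estimator does at
  least as well as the coupling function,
  \<open>\<Sum>\<^sub>t |F\<^sub>\<delta>(x\<^sub>t)|\<^sup>2 \<le> 2 \<Sum>\<^sub>t \<langle>w\<^sub>t, F\<^sub>\<delta>(x\<^sub>t)\<rangle>\<close>, and coercivity bounds the error by the stationary mean
  of \<open>|F\<^sub>\<delta>|\<^sup>2\<close>. It remains to control, uniformly in \<open>\<delta>\<close>, the linear noise term and the deviation of the
  empirical energy from its stationary mean. Both are a linear and a quadratic form in \<open>\<delta>\<close>, and a
  bounded Lipschitz function on \<open>[0,R]\<close> is up to \<open>O(1/T)\<close> a combination of steps \<open>1\<^bsub>r \<ge> kR/T\<^esub>\<close> whose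
  absolute coefficients add up to at most \<open>2S(1 + R)\<close>. So the suprema are dominated by weighted sums of
  the forms at fixed steps, whose second moments are of order \<open>1/T\<close>: by orthogonality of martingale
  differences for the noise, and by the decay of correlations for the energy. This gives
  \<open>E|\<delta>|\<^sup>2 = O(1/(c\<^sub>H \<surd>T))\<close>, and the logarithmic term of the theorem is not needed.

  That the distances stay in \<open>[0,R]\<close> under the invariant law, and that \<open>\<omega>\<close> is bounded in terms of \<open>n\<close>,
  \<open>K\<close>, \<open>S\<close> and \<open>R\<close> alone, follows from the contraction of the linear part on \<open>\<Delta>\<^sup>\<bottom>\<close>.
\<close>

section \<open>Weighted graph Laplacians\<close>

text \<open>The estimator depends on the whole path, so neither the martingale property nor
  ergodicity can be applied to its force directly; this is why all bounds have to be uniform in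
  \<delta>. The grid has as many cells as there are observations: the approximation by steps then
  costs O(1/T) at each time and O(1) after summation over time, which is below the fluctuations of
  order \<surd>T. The order of the quantifiers shapes the rest. The factor \<gamma> may depend on R,
  S, K only, the other constants only on the number of nodes, the rate \<eta> and the integral of V.
  The step size and the noise level therefore have to be eliminated, which is the purpose of the
  bound on \<omega>. The powers of S and R and half of the powers of K are absorbed by \<gamma>; the
  number of nodes and the ergodicity go into the other constants. Contraction is known only along
  the trajectories started from the initial law, and nothing relates \<pi> to them except
  convergence in total variation. So the support of \<pi> is located by following one well chosen
  starting point.\<close>

definition graph_lap :: "nat \<Rightarrow> (nat \<Rightarrow> nat \<Rightarrow> real) \<Rightarrow> (nat \<Rightarrow> real) \<Rightarrow> nat \<Rightarrow> real" where
  "graph_lap n c v i = (\<Sum>j<n. c i j * (v i - v j))"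

text \<open>Exchanging the names of i and j changes the sign of \<open>v i - v j\<close>, so the
  part with \<open>u j\<close> is minus the part with \<open>u i\<close>, and the double sum counts
  the left side twice. Symmetry, conservation of the mean and the kernel on a connected graph are
  all read off from this form.\<close>

lemma graph_lap_form:
  assumes sym: "\<And>i j. i < n \<Longrightarrow> j < n \<Longrightarrow> c i j = c j i"
  shows "(\<Sum>i<n. graph_lap n c v i * u i) = (\<Sum>i<n. \<Sum>j<n. c i j * (v i - v j) * (u i - u j)) / 2"
proof -
  have "(\<Sum>i<n. \<Sum>j<n. c i j * (v i - v j) * u j) = (\<Sum>j<n. \<Sum>i<n. c i j * (v i - v j) * u j)"
    by (rule sum.swap)
  also have "\<dots> = (\<Sum>j<n. \<Sum>i<n. - (c j i * (v j - v i) * u j))"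
    by (intro sum.cong refl) (use sym in \<open>auto simp: algebra_simps\<close>)
  also have "\<dots> = - (\<Sum>i<n. graph_lap n c v i * u i)"
    by (simp add: graph_lap_def sum_distrib_right sum_negf)
  finally have *: "(\<Sum>i<n. \<Sum>j<n. c i j * (v i - v j) * u j) = - (\<Sum>i<n. graph_lap n c v i * u i)" .
  have "(\<Sum>i<n. \<Sum>j<n. c i j * (v i - v j) * (u i - u j)) =
    (\<Sum>i<n. graph_lap n c v i * u i) - (\<Sum>i<n. \<Sum>j<n. c i j * (v i - v j) * u j)"
    unfolding graph_lap_def sum_distrib_right sum_subtractf[symmetric]
    by (intro sum.cong refl right_diff_distrib)
  with * show ?thesis by simp
qed

lemma graph_lap_symmetric:
  assumes sym: "\<And>i j. i < n \<Longrightarrow> j < n \<Longrightarrow> c i j = c j i"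
  shows "(\<Sum>i<n. graph_lap n c v i * u i) = (\<Sum>i<n. v i * graph_lap n c u i)"
  using graph_lap_form[of n c, OF sym, where u = u and v = v] graph_lap_form[of n c, OF sym, where u = v and v = u]
  by (simp add: mult_ac)

lemma graph_lap_sum_zero:
  assumes sym: "\<And>i j. i < n \<Longrightarrow> j < n \<Longrightarrow> c i j = c j i"
  shows "(\<Sum>i<n. graph_lap n c v i) = 0"
  using graph_lap_form[of n c, OF sym, where v = v and u = "\<lambda>_. 1"] by simp

text \<open>The form with \<open>u = v\<close> is a vanishing sum of non-negative terms, so v agrees
  at the two ends of every edge and hence along every path.\<close>

lemma graph_lap_eq_0_imp_const:
  assumes sym: "\<And>i j. i < n \<Longrightarrow> j < n \<Longrightarrow> c i j = c j i"
    and nonneg: "\<And>i j. i < n \<Longrightarrow> j < n \<Longrightarrow> 0 \<le> c i j"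
    and E: "\<And>i j. (i, j) \<in> E \<Longrightarrow> i < n \<and> j < n \<and> 0 < c i j"
    and conn: "(i, j) \<in> E\<^sup>*"
    and zero: "\<And>i. i < n \<Longrightarrow> graph_lap n c v i = 0"
  shows "v i = v j"
proof -
  have "(\<Sum>i<n. \<Sum>j<n. c i j * (v i - v j) * (v i - v j)) = 0"
    using graph_lap_form[of n c, OF sym, where v = v and u = v] zero by simp
  moreover have pos: "0 \<le> c i j * (v i - v j) * (v i - v j)" if "i < n" "j < n" for i j
    using nonneg[OF that] by (simp add: mult.assoc)
  ultimately have "\<forall>i\<in>{..<n}. (\<Sum>j<n. c i j * (v i - v j) * (v i - v j)) = 0"
    by (subst (asm) sum_nonneg_eq_0_iff) (auto intro!: sum_nonneg)
  then have "c i j * (v i - v j) * (v i - v j) = 0" if "i < n" "j < n" for i j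
    using that pos sum_nonneg_eq_0_iff[of "{..<n}" "\<lambda>j. c i j * (v i - v j) * (v i - v j)"] by blast
  then have edge: "v i = v j" if "(i, j) \<in> E" for i j
    using E[OF that] by fastforce
  show ?thesis using conn by (induction rule: rtrancl_induct) (auto dest: edge)
qed

text \<open>Vectors are functions on all natural numbers with the product topology. Pinning the
  coordinates from n on to 0 and confining the others to [-1,1] gives a compact product, in which
  the two conditions on sums are closed.\<close>

lemma sphere_compact:
  "compact {v :: nat \<Rightarrow> real. (\<forall>i\<ge>n. v i = 0) \<and> (\<Sum>i<n. v i) = 0 \<and> (\<Sum>i<n. (v i)\<^sup>2) = 1}"
    (is "compact ?K")
proof -
  let ?C = "PiE UNIV (\<lambda>i. if i < n then {-1..1} else {0}) :: (nat \<Rightarrow> real) set"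
  have "compactin (product_topology (\<lambda>_. euclidean) UNIV) ?C"
    unfolding compactin_PiE by auto
  then have C: "compact ?C" by (simp add: euclidean_product_topology)
  have cont: "continuous_on UNIV (\<lambda>v::nat \<Rightarrow> real. v i)" for i
    by (rule continuous_on_product_coordinates)
  have "closed ({v::nat \<Rightarrow> real. (\<Sum>i<n. v i) = 0} \<inter> {v. (\<Sum>i<n. (v i)\<^sup>2) = 1})"
    by (intro closed_Int closed_Collect_eq continuous_intros cont)
  with C have "compact (?C \<inter> ({v::nat \<Rightarrow> real. (\<Sum>i<n. v i) = 0} \<inter> {v. (\<Sum>i<n. (v i)\<^sup>2) = 1}))"
    by (rule compact_Int_closed)
  also have "\<dots> = ?K"
  proof (intro equalityI subsetI)
    fix v assume v: "v \<in> ?K"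
    have "v i \<in> {-1..1}" if "i < n" for i
    proof -
      have "(v i)\<^sup>2 \<le> (\<Sum>i<n. (v i)\<^sup>2)" using that by (intro member_le_sum) auto
      then have "(v i)\<^sup>2 \<le> 1" using v by simp
      then show ?thesis by (auto simp: abs_square_le_1 abs_le_iff)
    qed
    then show "v \<in> ?C \<inter> ({v. (\<Sum>i<n. v i) = 0} \<inter> {v. (\<Sum>i<n. (v i)\<^sup>2) = 1})"
      using v by (auto simp: PiE_iff)
  next
    fix v :: "nat \<Rightarrow> real" assume v: "v \<in> ?C \<inter> ({v. (\<Sum>i<n. v i) = 0} \<inter> {v. (\<Sum>i<n. (v i)\<^sup>2) = 1})"
    then have "v i = 0" if "i \<ge> n" for i
      using that by (auto simp: PiE_iff dest!: spec[of _ i])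
    then show "v \<in> ?K" using v by auto
  qed
  finally show ?thesis .
qed

text \<open>The maximum of \<open>|(I - hL)v|\<^sup>2\<close> over the unit sphere of the mean zero vectors is attained at an
  eigenvector of \<open>(I - hL)\<^sup>2\<close>, out of which an eigenvector of \<open>L\<close> is made.\<close>

lemma graph_lap_contraction:
  fixes c :: "nat \<Rightarrow> nat \<Rightarrow> real"
  assumes sym: "\<And>i j. i < n \<Longrightarrow> j < n \<Longrightarrow> c i j = c j i"
    and h: "h > 0" and z: "0 \<le> z"
    and ev: "\<And>v l. (\<Sum>i<n. v i) = 0 \<Longrightarrow> (\<exists>i<n. v i \<noteq> 0) \<Longrightarrow>
        (\<And>i. i < n \<Longrightarrow> graph_lap n c v i = l * v i) \<Longrightarrow> \<bar>1 - h * l\<bar> \<le> z"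
    and v: "(\<Sum>i<n. v i) = 0"
  shows "(\<Sum>i<n. (v i - h * graph_lap n c v i)\<^sup>2) \<le> z\<^sup>2 * (\<Sum>i<n. (v i)\<^sup>2)"
proof (cases "\<exists>i<n. v i \<noteq> 0")
  case False
  then have *: "\<And>i. i < n \<Longrightarrow> v i = 0" by auto
  then have "graph_lap n c v i = 0" if "i < n" for i using that by (simp add: graph_lap_def)
  with * show ?thesis by simp
next
  case True
  define K where "K = {v :: nat \<Rightarrow> real. (\<forall>i\<ge>n. v i = 0) \<and> (\<Sum>i<n. v i) = 0 \<and> (\<Sum>i<n. (v i)\<^sup>2) = 1}"
  define M where "M v i = v i - h * graph_lap n c v i" for v i
  define ip where "ip u v = (\<Sum>i<n. u i * v i)" for u v :: "nat \<Rightarrow> real"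
  have ip_add: "ip (\<lambda>i. s * u i + t * w i) v = s * ip u v + t * ip w v" for s t u w v
    by (simp add: ip_def sum.distrib sum_distrib_left algebra_simps)
  have ip_comm: "ip u v = ip v u" for u v by (simp add: ip_def mult.commute)
  have ip_add': "ip v (\<lambda>i. s * u i + t * w i) = s * ip v u + t * ip v w" for s t u w v
    by (simp add: ip_comm[of v] ip_add)
  have ip_cong: "ip u v = ip u' v'" if "\<And>i. i < n \<Longrightarrow> u i = u' i" "\<And>i. i < n \<Longrightarrow> v i = v' i" for u v u' v'
    using that by (simp add: ip_def)
  have ip_sq: "ip u u = (\<Sum>i<n. (u i)\<^sup>2)" for u by (simp add: ip_def power2_eq_square)
  have ip_nonneg: "0 \<le> ip u u" for u by (simp add: ip_sq sum_nonneg)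
  have M_lin: "M (\<lambda>i. s * u i + t * w i) j = s * M u j + t * M w j" for s t u w j
    by (simp add: M_def graph_lap_def sum_distrib_left algebra_simps sum.distrib sum_subtractf)
  have M_scale: "M (\<lambda>i. s * u i) j = s * M u j" for s u j
    using M_lin[of s u 0 u j] by simp
  have M_cong: "M u i = M u' i" if "\<And>i. i < n \<Longrightarrow> u i = u' i" "i < n" for u u' i
    using that by (simp add: M_def graph_lap_def)
  have M_sym: "ip (M u) w = ip u (M w)" for u w
  proof -
    have "ip (M u) w = ip u w - h * (\<Sum>i<n. graph_lap n c u i * w i)"
      by (simp add: ip_def M_def left_diff_distrib sum_subtractf sum_distrib_left mult.assoc)
    also have "(\<Sum>i<n. graph_lap n c u i * w i) = (\<Sum>i<n. u i * graph_lap n c w i)"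
      by (rule graph_lap_symmetric) (rule sym)
    also have "ip u w - h * \<dots> = ip u (M w)"
      by (simp add: ip_def M_def right_diff_distrib sum_subtractf sum_distrib_left mult_ac)
    finally show ?thesis .
  qed
  have M_mean: "(\<Sum>i<n. M u i) = 0" if "(\<Sum>i<n. u i) = 0" for u
    using that graph_lap_sum_zero[of n c u, OF sym] by (simp add: M_def sum_subtractf flip: sum_distrib_left)
  \<comment> \<open>Normalising and cutting off beyond n gives a member of K. Below n, the values of
    M depend only on coordinates below n.\<close>
  have cut: "(\<lambda>i. if i < n then u i / sqrt (ip u u) else 0) \<in> K"
    if "(\<Sum>i<n. u i) = 0" "ip u u \<noteq> 0" for u
    using that ip_nonneg[of u] by (auto simp: K_def power_divide ip_sq simp flip: sum_divide_distrib)
  have vpos: "ip v v \<noteq> 0" using True by (auto simp: ip_sq sum_nonneg_eq_0_iff)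
  have cont: "continuous_on UNIV (\<lambda>v::nat \<Rightarrow> real. v i)" for i
    by (rule continuous_on_product_coordinates)
  have "continuous_on K (\<lambda>v. ip (M v) (M v))"
    unfolding ip_def M_def graph_lap_def
    by (intro continuous_intros continuous_on_subset[OF cont]) auto
  then have "\<exists>y\<in>K. \<forall>u\<in>K. ip (M u) (M u) \<le> ip (M y) (M y)"
  proof (rule continuous_attains_sup[OF sphere_compact[of n, folded K_def], rotated])
    show "K \<noteq> {}" using cut[OF v vpos] by blast
  qed
  then obtain y where y: "y \<in> K" and max: "\<And>u. u \<in> K \<Longrightarrow> ip (M u) (M u) \<le> ip (M y) (M y)"
    by blast
  define \<mu> where "\<mu> = ip (M y) (M y)"
  have y1: "ip y y = 1" and y0: "(\<Sum>i<n. y i) = 0" using y by (auto simp: ip_sq K_def)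
  have bound: "ip (M u) (M u) \<le> \<mu> * ip u u" if u: "(\<Sum>i<n. u i) = 0" for u
  proof (cases "ip u u = 0")
    case True
    then have *: "\<And>i. i < n \<Longrightarrow> u i = 0" by (auto simp: ip_sq sum_nonneg_eq_0_iff)
    have "M u i = 0" if "i < n" for i using M_cong[of u "\<lambda>_. 0" i] * that by (simp add: M_def graph_lap_def)
    then show ?thesis using True by (simp add: ip_def)
  next
    case False
    let ?u = "\<lambda>i. if i < n then u i / sqrt (ip u u) else 0"
    have "M ?u i = (1 / sqrt (ip u u)) * M u i" if "i < n" for i
      using M_cong[of ?u "\<lambda>i. (1 / sqrt (ip u u)) * u i" i] that unfolding M_scale by simp
    then have "ip (M ?u) (M ?u) = ip (\<lambda>i. (1 / sqrt (ip u u)) * M u i) (\<lambda>i. (1 / sqrt (ip u u)) * M u i)"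
      by (intro ip_cong) auto
    also have "\<dots> = ip (M u) (M u) / ip u u"
      using ip_nonneg[of u] by (simp add: ip_def sum_divide_distrib)
    finally have "ip (M u) (M u) / ip u u \<le> \<mu>" using max[OF cut[OF u False]] by (simp add: \<mu>_def)
    then show ?thesis using False ip_nonneg[of u] by (simp add: divide_le_eq)
  qed
  \<comment> \<open>First-order condition at the maximum: by \<open>bound\<close>, \<mu> |u|^2 - |M
    u|^2 is non-negative at u = y + t w and zero for t = 0, so its linear term in t
    vanishes.\<close>
  have stat: "\<mu> * ip y w = ip (M y) (M w)" if w: "(\<Sum>i<n. w i) = 0" for w
  proof -
    define \<alpha> where "\<alpha> = \<mu> * ip y w - ip (M y) (M w)"
    define \<beta> where "\<beta> = \<mu> * ip w w - ip (M w) (M w)"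
    have \<beta>: "\<beta> \<ge> 0" using bound[OF w] by (simp add: \<beta>_def)
    have *: "0 \<le> 2 * t * \<alpha> + t\<^sup>2 * \<beta>" for t
    proof -
      let ?u = "\<lambda>i. 1 * y i + t * w i"
      have "(\<Sum>i<n. ?u i) = 0" using y0 w by (simp add: sum.distrib flip: sum_distrib_left)
      from bound[OF this]
      have "ip (\<lambda>i. 1 * M y i + t * M w i) (\<lambda>i. 1 * M y i + t * M w i) \<le> \<mu> * ip ?u ?u"
        using ip_cong[of "M ?u" "\<lambda>i. 1 * M y i + t * M w i" "M ?u" "\<lambda>i. 1 * M y i + t * M w i"]
        unfolding M_lin by simp
      then show ?thesis unfolding ip_add ip_add' ip_comm[of w y] ip_comm[of "M w" "M y"]
        by (simp add: \<alpha>_def \<beta>_def y1 \<mu>_def power2_eq_square algebra_simps)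
    qed
    have "\<alpha> = 0"
    proof (rule ccontr)
      assume a: "\<alpha> \<noteq> 0"
      \<comment> \<open>The quadratic is smallest at -\<alpha>/\<beta>; the 1 added to the
        denominator also covers \<beta> = 0.\<close>
      define t where "t = - \<alpha> / (\<beta> + 1)"
      have t: "\<alpha> = - t * (\<beta> + 1)" "t \<noteq> 0" using a \<beta> by (auto simp: t_def)
      have "0 \<le> 2 * t * \<alpha> + t\<^sup>2 * \<beta>" by (rule *)
      also have "\<dots> = t\<^sup>2 * (- \<beta> - 2)"
        unfolding t(1) by (simp add: power2_eq_square algebra_simps)
      also have "\<dots> < 0" using t(2) \<beta> by (intro mult_pos_neg) auto
      finally show False by simp
    qed
    then show ?thesis by (simp add: \<alpha>_def)
  qed
  define \<sigma> where "\<sigma> = sqrt \<mu>"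
  have mu: "\<mu> \<ge> 0" "\<sigma> \<ge> 0" "\<sigma> * \<sigma> = \<mu>" using ip_nonneg by (auto simp: \<sigma>_def \<mu>_def)
  \<comment> \<open>The defect M (M y) - \<mu> y has mean zero; used as the test vector in
    \<open>stat\<close>, it turns out to be orthogonal to itself.\<close>
  have MM: "M (M y) i = \<mu> * y i" if "i < n" for i
  proof -
    let ?w = "\<lambda>i. 1 * M (M y) i + (-\<mu>) * y i"
    have w0: "(\<Sum>i<n. ?w i) = 0"
      using M_mean[OF M_mean[OF y0]] y0 by (simp add: sum_subtractf flip: sum_distrib_left)
    have "ip ?w ?w = 0" using stat[OF w0] M_sym[of "M y" ?w] ip_add[of 1 "M (M y)" "- \<mu>" y ?w]
      by simp
    then show ?thesis using that by (auto simp: ip_sq sum_nonneg_eq_0_iff)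
  qed
  \<comment> \<open>Since (M - \<sigma>)(M + \<sigma>) y = 0, the vector M y + \<sigma> y is an
    eigenvector of M for \<sigma>, unless it vanishes, and then y itself is one for
    -\<sigma>.\<close>
  have "\<exists>u s. (\<Sum>i<n. u i) = 0 \<and> (\<exists>i<n. u i \<noteq> 0) \<and> (\<forall>i<n. M u i = s * u i) \<and> \<bar>s\<bar> = \<sigma>"
  proof (cases "\<exists>i<n. M y i + \<sigma> * y i \<noteq> 0")
    case True
    let ?u = "\<lambda>i. 1 * M y i + \<sigma> * y i"
    have "(\<Sum>i<n. ?u i) = 0" using M_mean[OF y0] y0 by (simp add: sum.distrib flip: sum_distrib_left)
    moreover have "\<forall>i<n. M ?u i = \<sigma> * ?u i" unfolding M_lin using MM mu(3)
      by (auto simp: algebra_simps)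
    ultimately show ?thesis using True mu by (intro exI[of _ ?u] exI[of _ \<sigma>]) auto
  next
    case False
    have "\<exists>i<n. y i \<noteq> 0" 
      by (rule ccontr) (use y1 in \<open>auto simp: ip_def\<close>)
    then show ?thesis using False y0 mu
      by (intro exI[of _ y] exI[of _ "-\<sigma>"]) (auto simp: add_eq_0_iff)
  qed
  then obtain u s where u: "(\<Sum>i<n. u i) = 0" "\<exists>i<n. u i \<noteq> 0" "\<And>i. i < n \<Longrightarrow> M u i = s * u i" "\<bar>s\<bar> = \<sigma>"
    by blast
  have "graph_lap n c u i = ((1 - s) / h) * u i" if "i < n" for i
    using u(3)[OF that] h by (simp add: M_def field_simps)
  from ev[OF u(1,2) this] have "\<sigma> \<le> z" using h u(4) by simp
  then have "\<mu> \<le> z\<^sup>2" using mu by (metis power2_eq_square power_mono)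
  moreover have "0 \<le> ip v v" by (rule ip_nonneg)
  ultimately have "ip (M v) (M v) \<le> z\<^sup>2 * ip v v"
    using bound[OF v] by (meson mult_right_mono order_trans)
  then show ?thesis by (simp add: ip_sq M_def)
qed

section \<open>Moments and total variation\<close>

text \<open>Fubini for the region below the graph of f. Integrals become integrals of measures of
  sets, so that a bound on two measures that is uniform over sets carries over to
  expectations.\<close>

lemma (in finite_measure) layer_cake:
  assumes [measurable]: "f \<in> borel_measurable M" and f: "\<And>x. x \<in> space M \<Longrightarrow> 0 \<le> f x \<and> f x \<le> (c::real)"
  shows "integrable lborel (\<lambda>t. indicator {0..c} t * measure M {x \<in> space M. t < f x})" (is ?int)
    and "(\<integral>x. f x \<partial>M) = (\<integral>t. indicator {0..c} t * measure M {x \<in> space M. t < f x} \<partial>lborel)" (is ?eq)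
proof -
  interpret P: pair_sigma_finite M lborel ..
  let ?A = "{p \<in> space (M \<Otimes>\<^sub>M lborel). 0 \<le> snd p \<and> snd p \<le> c \<and> snd p < f (fst p)}"
  have A[measurable]: "?A \<in> sets (M \<Otimes>\<^sub>M lborel)" by measurable
  have "emeasure (M \<Otimes>\<^sub>M lborel) ?A \<le> emeasure (M \<Otimes>\<^sub>M lborel) (space M \<times> {0..c})"
    by (intro emeasure_mono) (auto simp: space_pair_measure)
  also have "\<dots> = emeasure M (space M) * emeasure lborel {0..c}"
    by (intro lborel.emeasure_pair_measure_Times) auto
  also have "\<dots> < \<infinity>"
    by (cases "0 \<le> c") (auto simp: ennreal_mult_less_top less_top[symmetric] ennreal_mult_eq_top_iff)
  finally have int: "integrable (M \<Otimes>\<^sub>M lborel) (\<lambda>(x, t). indicator ?A (x, t) :: real)"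
    by (simp add: integrable_real_indicator[OF A])
  have fst: "(\<integral>x. indicator ?A (x, t) \<partial>M) = indicator {0..c} t * measure M {x \<in> space M. t < f x}" for t
  proof -
    have "(\<integral>x. indicator ?A (x, t) \<partial>M) =
      (\<integral>x. indicator {0..c} t * indicator {x \<in> space M. t < f x} x \<partial>M :: real)"
      by (intro Bochner_Integration.integral_cong) (auto simp: space_pair_measure split: split_indicator)
    then show ?thesis by simp
  qed
  have snd: "(\<integral>t. indicator ?A (x, t) \<partial>lborel) = f x" if x: "x \<in> space M" for x
  proof -
    have "(\<integral>t. indicator ?A (x, t) \<partial>lborel) = (\<integral>t. indicator {0..<f x} t \<partial>lborel :: real)"
      using f[OF x] x
      by (intro Bochner_Integration.integral_cong) (auto simp: space_pair_measure split: split_indicator)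
    then show ?thesis using f[OF x] by simp
  qed
  show ?int using P.integrable_snd[OF int] by (simp add: fst)
  have "(\<integral>t. (\<integral>x. indicator ?A (x, t) \<partial>M) \<partial>lborel) = (\<integral>x. (\<integral>t. indicator ?A (x, t) \<partial>lborel) \<partial>M :: real)"
    by (rule P.Fubini_integral[OF int])
  also have "\<dots> = (\<integral>x. f x \<partial>M)" by (intro Bochner_Integration.integral_cong) (auto simp: snd)
  finally show ?eq by (simp add: fst)
qed

text \<open>Adding b makes the integrand non-negative with values in [0,2b]. The factor 2b is the
  length of the interval of levels in the layer cake formula.\<close>

lemma integral_diff_le_setwise:
  assumes "prob_space M" "prob_space M'" and sets: "sets M = sets M'"
    and fM: "f \<in> borel_measurable M" and f: "\<And>x. x \<in> space M \<Longrightarrow> \<bar>f x\<bar> \<le> (b::real)"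
    and \<epsilon>: "\<And>B. B \<in> sets M \<Longrightarrow> \<bar>measure M B - measure M' B\<bar> \<le> \<epsilon>"
  shows "\<bar>(\<integral>x. f x \<partial>M) - (\<integral>x. f x \<partial>M')\<bar> \<le> 2 * b * \<epsilon>"
proof -
  interpret M: prob_space M by fact
  interpret M': prob_space M' by fact
  note sp = sets_eq_imp_space_eq[OF sets]
  let ?g = "\<lambda>x. f x + b"
  have b: "0 \<le> b" using M.not_empty f by fastforce
  have fM': "f \<in> borel_measurable M'" using fM measurable_cong_sets[OF sets refl] by blast
  have gM: "?g \<in> borel_measurable M" "?g \<in> borel_measurable M'" using fM fM' by simp_all
  have g: "x \<in> space M \<Longrightarrow> 0 \<le> ?g x \<and> ?g x \<le> 2 * b" for x using f[of x] by auto
  have g': "x \<in> space M' \<Longrightarrow> 0 \<le> ?g x \<and> ?g x \<le> 2 * b" for x using g[of x] sp by auto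
  let ?D = "\<lambda>t. indicator {0..2 * b} t * measure M {x \<in> space M. t < ?g x}"
  let ?D' = "\<lambda>t. indicator {0..2 * b} t * measure M' {x \<in> space M'. t < ?g x}"
  have L: "integrable lborel ?D" "(\<integral>x. ?g x \<partial>M) = (\<integral>t. ?D t \<partial>lborel)"
    using M.layer_cake[OF gM(1) g] by blast+
  have L': "integrable lborel ?D'" "(\<integral>x. ?g x \<partial>M') = (\<integral>t. ?D' t \<partial>lborel)"
    using M'.layer_cake[OF gM(2) g'] by blast+
  have int: "integrable M f" using f fM by (intro M.integrable_const_bound[where B = b]) auto
  have int': "integrable M' f" using f[folded sp] fM' by (intro M'.integrable_const_bound[where B = b]) (auto simp: sp)
  have "(\<integral>x. f x \<partial>M) - (\<integral>x. f x \<partial>M') = (\<integral>x. ?g x \<partial>M) - (\<integral>x. ?g x \<partial>M')"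
    using int int' by (simp add: M.prob_space M'.prob_space)
  also have "\<dots> = (\<integral>t. ?D t - ?D' t \<partial>lborel)"
    unfolding L(2) L'(2) by (rule Bochner_Integration.integral_diff[OF L(1) L'(1), symmetric])
  finally have "\<bar>(\<integral>x. f x \<partial>M) - (\<integral>x. f x \<partial>M')\<bar> = \<bar>\<integral>t. ?D t - ?D' t \<partial>lborel\<bar>"
    by (rule arg_cong)
  also have "\<dots> \<le> (\<integral>t. \<bar>?D t - ?D' t\<bar> \<partial>lborel)" by (rule integral_abs_bound)
  also have "\<dots> \<le> (\<integral>t. indicator {0..2 * b} t * \<epsilon> \<partial>lborel)"
  proof (rule integral_mono)
    fix t
    have "{x \<in> space M. t < ?g x} \<in> sets M" using gM(1) by measurable
    from \<epsilon>[OF this] show "\<bar>?D t - ?D' t\<bar> \<le> indicator {0..2 * b} t * \<epsilon>"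
      by (auto simp: sp split: split_indicator)
  next
    show "integrable lborel (\<lambda>t. indicator {0..2 * b} t * \<epsilon>)"
      using b by (intro integrable_mult_left integrable_real_indicator) auto
  qed (intro integrable_abs Bochner_Integration.integrable_diff L(1) L'(1))
  also have "\<dots> = 2 * b * \<epsilon>" using b by simp
  finally show ?thesis .
qed

lemma (in prob_space) AE_imp_ex: "AE x in M. P x \<Longrightarrow> \<exists>x\<in>space M. P x"
proof (rule ccontr)
  assume *: "AE x in M. P x" "\<not> (\<exists>x\<in>space M. P x)"
  from *(1) AE_space have "AE x in M. False" by eventually_elim (use *(2) in auto)
  then show False by simp
qed

text \<open>Cauchy-Schwarz, in the form that the variance of |X| is non-negative.\<close>

lemma (in prob_space) expectation_abs_le_sqrt:
  fixes X :: "'a \<Rightarrow> real"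
  assumes "X \<in> borel_measurable M" and "integrable M (\<lambda>x. (X x)\<^sup>2)" and "expectation (\<lambda>x. (X x)\<^sup>2) \<le> c"
  shows "integrable M X" and "expectation (\<lambda>x. \<bar>X x\<bar>) \<le> sqrt c"
proof -
  show int: "integrable M X" using assms square_integrable_imp_integrable by blast
  have "variance (\<lambda>x. \<bar>X x\<bar>) = expectation (\<lambda>x. \<bar>X x\<bar>\<^sup>2) - (expectation (\<lambda>x. \<bar>X x\<bar>))\<^sup>2"
    using int assms by (intro variance_eq) auto
  then have "(expectation (\<lambda>x. \<bar>X x\<bar>))\<^sup>2 \<le> c" using variance_positive[of "\<lambda>x. \<bar>X x\<bar>"] assms(3) by simp
  then show "expectation (\<lambda>x. \<bar>X x\<bar>) \<le> sqrt c" by (rule real_le_rsqrt)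
qed

text \<open>Splitting at s gives two geometric series. The diagonal term may be counted twice, which
  only enlarges the bound.\<close>

lemma sum_geometric_dist_le:
  fixes q :: real assumes q: "0 \<le> q" "q < 1"
  shows "(\<Sum>t=1..T. q ^ nat \<bar>int s - int t\<bar>) \<le> 2 / (1 - q)"
proof -
  have geo: "(\<Sum>k<m. q ^ k) \<le> 1 / (1 - q)" for m
    using q sum_le_suminf[of "\<lambda>k. q ^ k" "{..<m}"] suminf_geometric[of q] by auto
  have "(\<Sum>t=1..T. q ^ nat \<bar>int s - int t\<bar>) \<le>
      (\<Sum>t\<in>{t. t \<in> {1..T} \<and> t \<le> s}. q ^ nat \<bar>int s - int t\<bar>) + (\<Sum>t\<in>{t. t \<in> {1..T} \<and> s \<le> t}. q ^ nat \<bar>int s - int t\<bar>)"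
  proof -
    have "{1..T} = {t. t \<in> {1..T} \<and> t \<le> s} \<union> {t. t \<in> {1..T} \<and> s \<le> t}" by auto
    then have "(\<Sum>t=1..T. q ^ nat \<bar>int s - int t\<bar>) = (\<Sum>t\<in>{t. t \<in> {1..T} \<and> t \<le> s} \<union> {t. t \<in> {1..T} \<and> s \<le> t}. q ^ nat \<bar>int s - int t\<bar>)"
      by (rule arg_cong)
    also have "\<dots> \<le> (\<Sum>t\<in>{t. t \<in> {1..T} \<and> t \<le> s}. q ^ nat \<bar>int s - int t\<bar>) + (\<Sum>t\<in>{t. t \<in> {1..T} \<and> s \<le> t}. q ^ nat \<bar>int s - int t\<bar>)"
      using q by (subst sum_Un) (auto intro!: sum_nonneg)
    finally show ?thesis .
  qed
  also have "(\<Sum>t\<in>{t. t \<in> {1..T} \<and> t \<le> s}. q ^ nat \<bar>int s - int t\<bar>) \<le> 1 / (1 - q)"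
  proof -
    have "(\<Sum>t\<in>{t. t \<in> {1..T} \<and> t \<le> s}. q ^ nat \<bar>int s - int t\<bar>) = (\<Sum>k\<in>(\<lambda>t. s - t) ` {t. t \<in> {1..T} \<and> t \<le> s}. q ^ k)"
      by (subst sum.reindex) (auto simp: inj_on_def intro!: sum.cong arg_cong[where f = "\<lambda>k. q ^ k"])
    also have "\<dots> \<le> (\<Sum>k<Suc s. q ^ k)" using q by (intro sum_mono2) auto
    finally show ?thesis using geo[of "Suc s"] by simp
  qed
  also have "(\<Sum>t\<in>{t. t \<in> {1..T} \<and> s \<le> t}. q ^ nat \<bar>int s - int t\<bar>) \<le> 1 / (1 - q)"
  proof -
    have "(\<Sum>t\<in>{t. t \<in> {1..T} \<and> s \<le> t}. q ^ nat \<bar>int s - int t\<bar>) = (\<Sum>k\<in>(\<lambda>t. t - s) ` {t. t \<in> {1..T} \<and> s \<le> t}. q ^ k)"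
      by (subst sum.reindex) (auto simp: inj_on_def intro!: sum.cong arg_cong[where f = "\<lambda>k. q ^ k"])
    also have "\<dots> \<le> (\<Sum>k<Suc T. q ^ k)" using q by (intro sum_mono2) auto
    finally show ?thesis using geo[of "Suc T"] by simp
  qed
  finally show ?thesis by simp
qed

text \<open>Every row of the matrix of correlations has a sum bounded independently of T, so the
  second moment grows like T and not like its square. Orthogonal summands are the case q = 0, where
  \<open>0 ^ 0 = 1\<close> leaves the diagonal.\<close>

lemma (in prob_space) second_moment_sum_le:
  fixes Z :: "nat \<Rightarrow> 'a \<Rightarrow> real"
  assumes q: "0 \<le> q" "q < 1" and B: "0 \<le> B"
    and int: "\<And>s t. integrable M (\<lambda>x. Z s x * Z t x)"
    and cov: "\<And>s t. s \<le> t \<Longrightarrow> \<bar>expectation (\<lambda>x. Z s x * Z t x)\<bar> \<le> B * q ^ (t - s)"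
  shows "integrable M (\<lambda>x. (\<Sum>t=1..T. Z t x)\<^sup>2)"
    and "expectation (\<lambda>x. (\<Sum>t=1..T. Z t x)\<^sup>2) \<le> real T * (2 * B / (1 - q))"
proof -
  have eq: "(\<Sum>t=1..T. Z t x)\<^sup>2 = (\<Sum>s=1..T. \<Sum>t=1..T. Z s x * Z t x)" for x
    by (simp add: power2_eq_square sum_product)
  show "integrable M (\<lambda>x. (\<Sum>t=1..T. Z t x)\<^sup>2)" unfolding eq using int by auto
  have "expectation (\<lambda>x. (\<Sum>t=1..T. Z t x)\<^sup>2) = (\<Sum>s=1..T. \<Sum>t=1..T. expectation (\<lambda>x. Z s x * Z t x))"
    unfolding eq using int by (simp add: Bochner_Integration.integral_sum)
  also have "\<dots> \<le> (\<Sum>s=1..T. \<Sum>t=1..T. B * q ^ nat \<bar>int s - int t\<bar>)"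
  proof (intro sum_mono)
    fix s t :: nat
    consider "s \<le> t" | "t \<le> s" by linarith
    then show "expectation (\<lambda>x. Z s x * Z t x) \<le> B * q ^ nat \<bar>int s - int t\<bar>"
    proof cases
      case 1
      then have *: "nat \<bar>int s - int t\<bar> = t - s" by auto
      show ?thesis unfolding * by (rule abs_le_D1[OF cov[OF 1]])
    next
      case 2
      then have *: "nat \<bar>int s - int t\<bar> = s - t" by auto
      have **: "(\<lambda>x. Z s x * Z t x) = (\<lambda>x. Z t x * Z s x)" by (intro ext mult.commute)
      show ?thesis unfolding * ** by (rule abs_le_D1[OF cov[OF 2]])
    qed
  qed
  also have "\<dots> \<le> (\<Sum>s=1..T. B * (2 / (1 - q)))"
    unfolding sum_distrib_left[symmetric] by (intro mult_left_mono sum_mono sum_geometric_dist_le q B)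
  also have "\<dots> = real T * (2 * B / (1 - q))" by simp
  finally show "expectation (\<lambda>x. (\<Sum>t=1..T. Z t x)\<^sup>2) \<le> real T * (2 * B / (1 - q))" .
qed

section \<open>Step functions on a grid\<close>

definition grid_step :: "real \<Rightarrow> nat \<Rightarrow> nat \<Rightarrow> real \<Rightarrow> real" where
  "grid_step R m k r = of_bool (real k * R / real m \<le> r)"

lemma grid_step_measurable[measurable]: "grid_step R m k \<in> borel_measurable borel"
  unfolding grid_step_def[abs_def] by measurable

lemma abs_grid_step_le: "\<bar>grid_step R m k r\<bar> \<le> 1"
  by (simp add: grid_step_def)

text \<open>The step with index 0 is 1 on all of [0,R] and carries the value at 0; the others carry
  the increments between neighbouring grid points. With m cells and Lipschitz constant L the
  absolute coefficients sum to at most |\<psi>(0)| + L R, whatever m is.\<close>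

definition grid_coeff :: "real \<Rightarrow> nat \<Rightarrow> (real \<Rightarrow> real) \<Rightarrow> nat \<Rightarrow> real" where
  "grid_coeff R m \<psi> k = (if k = 0 then \<psi> 0 else \<psi> (real k * R / real m) - \<psi> (real (k - 1) * R / real m))"

lemma abs_grid_coeff_le:
  assumes "L-lipschitz_on {0..R} \<psi>" and m: "0 < m" and R: "0 \<le> R" and "\<bar>\<psi> 0\<bar> \<le> s" and k: "k \<le> m"
  shows "\<bar>grid_coeff R m \<psi> k\<bar> \<le> (if k = 0 then s else L * R / m)"
proof (cases k)
  case 0
  then show ?thesis using assms(4) by (simp add: grid_coeff_def)
next
  case (Suc j)
  have "real (Suc j) * R / real m \<le> real m * R / real m" "real j * R / real m \<le> real m * R / real m"
    using k Suc m R by (intro divide_right_mono mult_right_mono; simp)+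
  then have "dist (\<psi> (real (Suc j) * R / real m)) (\<psi> (real j * R / real m)) \<le>
    L * dist (real (Suc j) * R / real m) (real j * R / real m)"
    using m R by (intro lipschitz_onD[OF assms(1)]) auto
  also have "dist (real (Suc j) * R / real m) (real j * R / real m) = R / m"
    using m R by (simp add: dist_real_def field_simps)
  finally show ?thesis using Suc by (simp add: grid_coeff_def dist_real_def)
qed

text \<open>The coefficients telescope: at r the combination of steps takes the value of \<psi> at
  the last grid point not exceeding r, which is at distance at most R/m. For R = 0 all grid points
  coincide and the increments vanish.\<close>

lemma grid_approx:
  assumes "L-lipschitz_on {0..R} \<psi>" and m: "0 < m" and r: "r \<in> {0..R}"
  shows "\<bar>\<psi> r - (\<Sum>k\<le>m. grid_coeff R m \<psi> k * grid_step R m k r)\<bar> \<le> L * R / m"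
proof (cases "R = 0")
  case True
  have "(\<Sum>k\<le>m. grid_coeff R m \<psi> k * grid_step R m k r) = (\<Sum>k\<le>m. if k = 0 then \<psi> 0 else 0)"
    using r True by (intro sum.cong) (auto simp: grid_coeff_def grid_step_def)
  then show ?thesis using True r by simp
next
  case False
  with r have R: "0 < R" by auto
  define l where "l = nat \<lfloor>r * m / R\<rfloor>"
  have l: "real l \<le> r * m / R" "r * m / R < real l + 1"
    using r R by (auto simp: l_def)
  have "r * m / R \<le> m" using r R by (simp add: divide_le_eq mult.commute mult_right_mono)
  then have lm: "l \<le> m" using l by linarith
  have iff: "real k * R / real m \<le> r \<longleftrightarrow> k \<le> l" for k
  proof -
    have "real k * R / real m \<le> r \<longleftrightarrow> real k \<le> r * m / R" using m R by (simp add: field_simps)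
    also have "\<dots> \<longleftrightarrow> k \<le> l" using l by linarith
    finally show ?thesis .
  qed
  have tele: "(\<Sum>k\<le>j. grid_coeff R m \<psi> k) = \<psi> (real j * R / real m)" for j
    by (induction j) (auto simp: grid_coeff_def)
  have "(\<Sum>k\<le>m. grid_coeff R m \<psi> k * grid_step R m k r) = (\<Sum>k\<le>m. if k \<le> l then grid_coeff R m \<psi> k else 0)"
    by (intro sum.cong) (auto simp: grid_step_def iff)
  also have "\<dots> = (\<Sum>k\<le>l. grid_coeff R m \<psi> k)"
    using lm by (subst sum.inter_filter[symmetric]) (auto intro!: sum.cong)
  also have "\<dots> = \<psi> (real l * R / real m)" by (rule tele)
  finally have eq: "(\<Sum>k\<le>m. grid_coeff R m \<psi> k * grid_step R m k r) = \<psi> (real l * R / real m)" .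
  have lr: "real l * R / real m \<le> r" using iff by simp
  have "r * m \<le> (real l + 1) * R" using l(2) R by (simp add: divide_less_eq)
  then have "r \<le> (real l + 1) * R / m" using m by (simp add: le_divide_eq)
  then have "r - real l * R / m \<le> R / m" by (simp add: distrib_right add_divide_distrib)
  then have "dist r (real l * R / real m) \<le> R / m" using lr by (simp add: dist_real_def)
  moreover have "dist (\<psi> r) (\<psi> (real l * R / real m)) \<le> L * dist r (real l * R / real m)"
    using lr r R m by (intro lipschitz_onD[OF assms(1)]) auto
  ultimately have "dist (\<psi> r) (\<psi> (real l * R / real m)) \<le> L * (R / m)"
    using lipschitz_on_nonneg[OF assms(1)] by (meson mult_left_mono order_trans)
  then show ?thesis unfolding eq by (simp add: dist_real_def)
qed

section \<open>Chains driven by independent noise\<close>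

primrec orbit :: "('a \<Rightarrow> 'b \<Rightarrow> 'a) \<Rightarrow> 'a \<times> (nat \<Rightarrow> 'b) \<Rightarrow> nat \<Rightarrow> 'a" where
  "orbit f s 0 = fst s"
| "orbit f s (Suc t) = f (orbit f s t) (snd s t)"

text \<open>The recursion appends the latest noise; this form removes the earliest. It allows
  induction over time with a changing starting point, which takes the place of conditioning on the
  past.\<close>

lemma orbit_Suc_shift: "orbit f (x, w) (Suc t) = orbit f (f x (w 0), \<lambda>k. w (Suc k)) t"
  by (induction t) auto

locale driven_chain = noise: prob_space \<nu> for \<nu> :: "'b measure" +
  fixes M :: "'a measure" and f :: "'a \<Rightarrow> 'b \<Rightarrow> 'a"
  assumes step_measurable: "case_prod f \<in> M \<Otimes>\<^sub>M \<nu> \<rightarrow>\<^sub>M M"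
begin

abbreviation "noise_seq \<equiv> PiM (UNIV :: nat set) (\<lambda>_. \<nu>)"

sublocale seq: sequence_space \<nu> ..

lemma step_measurable'[measurable (raw)]:
  assumes "g \<in> L \<rightarrow>\<^sub>M M" "h \<in> L \<rightarrow>\<^sub>M \<nu>"
  shows "(\<lambda>x. f (g x) (h x)) \<in> L \<rightarrow>\<^sub>M M"
  using measurable_compose[OF measurable_Pair[OF assms] step_measurable] by simp

lemma orbit_measurable[measurable]: "(\<lambda>s. orbit f s t) \<in> M \<Otimes>\<^sub>M noise_seq \<rightarrow>\<^sub>M M"
proof (induction t)
  case (Suc t)
  note [measurable] = Suc
  show ?case by (simp del: split_paired_All) measurable
qed simp

lemma orbit_measurable'[measurable (raw)]:
  assumes "g \<in> L \<rightarrow>\<^sub>M M" "h \<in> L \<rightarrow>\<^sub>M noise_seq"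
  shows "(\<lambda>x. orbit f (g x, h x) t) \<in> L \<rightarrow>\<^sub>M M"
  using measurable_compose[OF measurable_Pair[OF assms] orbit_measurable] by simp

lemma shift_measurable[measurable]: "(\<lambda>w k. w (Suc k)) \<in> noise_seq \<rightarrow>\<^sub>M noise_seq"
  by (rule measurable_PiM_single') (auto simp: space_PiM PiE_iff)

text \<open>\<open>PiM_iter\<close> read backwards: the first noise is independent of the remaining
  sequence, and that sequence has the law of the whole. Together with the removal of the first step
  this is the Markov property.\<close>

lemma head_tail_distr: "distr noise_seq (\<nu> \<Otimes>\<^sub>M noise_seq) (\<lambda>w. (w 0, \<lambda>k. w (Suc k))) = \<nu> \<Otimes>\<^sub>M noise_seq"
proof -
  have "distr noise_seq (\<nu> \<Otimes>\<^sub>M noise_seq) (\<lambda>w. (w 0, \<lambda>k. w (Suc k))) =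
    distr (distr (\<nu> \<Otimes>\<^sub>M noise_seq) noise_seq (\<lambda>(s, \<omega>). case_nat s \<omega>)) (\<nu> \<Otimes>\<^sub>M noise_seq) (\<lambda>w. (w 0, \<lambda>k. w (Suc k)))"
    by (simp add: seq.PiM_iter)
  also have "\<dots> = distr (\<nu> \<Otimes>\<^sub>M noise_seq) (\<nu> \<Otimes>\<^sub>M noise_seq) (\<lambda>p. p)"
    by (subst distr_distr) (simp_all add: comp_def split_beta')
  also have "\<dots> = \<nu> \<Otimes>\<^sub>M noise_seq" by (rule distr_id)
  finally show ?thesis .
qed

lemma nn_integral_head_tail:
  assumes [measurable]: "case_prod F \<in> borel_measurable (\<nu> \<Otimes>\<^sub>M noise_seq)"
  shows "(\<integral>\<^sup>+w. F (w 0) (\<lambda>k. w (Suc k)) \<partial>noise_seq) = (\<integral>\<^sup>+n. \<integral>\<^sup>+w. F n w \<partial>noise_seq \<partial>\<nu>)"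
proof -
  have "(\<integral>\<^sup>+w. F (w 0) (\<lambda>k. w (Suc k)) \<partial>noise_seq) =
    (\<integral>\<^sup>+p. case_prod F p \<partial>distr noise_seq (\<nu> \<Otimes>\<^sub>M noise_seq) (\<lambda>w. (w 0, \<lambda>k. w (Suc k))))"
    by (subst nn_integral_distr) auto
  also have "\<dots> = (\<integral>\<^sup>+n. \<integral>\<^sup>+w. F n w \<partial>noise_seq \<partial>\<nu>)"
    unfolding head_tail_distr by (subst seq.nn_integral_fst[symmetric]) auto
  finally show ?thesis .
qed

lemma integral_head_tail:
  fixes F :: "'b \<Rightarrow> (nat \<Rightarrow> 'b) \<Rightarrow> real"
  assumes [measurable]: "case_prod F \<in> borel_measurable (\<nu> \<Otimes>\<^sub>M noise_seq)"
    and b: "\<And>n w. \<bar>F n w\<bar> \<le> b"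
  shows "(\<integral>w. F (w 0) (\<lambda>k. w (Suc k)) \<partial>noise_seq) = (\<integral>n. \<integral>w. F n w \<partial>noise_seq \<partial>\<nu>)"
proof -
  interpret P: pair_prob_space \<nu> noise_seq ..
  have int: "integrable (\<nu> \<Otimes>\<^sub>M noise_seq) (case_prod F)"
    using b by (intro P.integrable_const_bound[where B = b]) auto
  have "(\<integral>w. F (w 0) (\<lambda>k. w (Suc k)) \<partial>noise_seq) =
    (\<integral>p. case_prod F p \<partial>distr noise_seq (\<nu> \<Otimes>\<^sub>M noise_seq) (\<lambda>w. (w 0, \<lambda>k. w (Suc k))))"
    by (subst integral_distr) auto
  also have "\<dots> = (\<integral>n. \<integral>w. F n w \<partial>noise_seq \<partial>\<nu>)"
    unfolding head_tail_distr by (subst P.integral_fst[OF int, symmetric]) auto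
  finally show ?thesis .
qed

text \<open>Almost every first noise leads back to X, where the induction hypothesis applies to the
  remaining sequence.\<close>

lemma AE_orbit_in_invariant_set:
  assumes X: "X \<in> sets M" and inv: "\<And>x. x \<in> X \<Longrightarrow> AE n in \<nu>. f x n \<in> X" and x: "x \<in> X"
  shows "AE w in noise_seq. orbit f (x, w) t \<in> X"
  using x
proof (induction t arbitrary: x)
  case 0
  then show ?case by simp
next
  case (Suc t)
  then have [measurable]: "x \<in> space M" "X \<in> sets M" using X sets.sets_into_space by auto
  interpret P: pair_prob_space \<nu> noise_seq ..
  have "AE p in \<nu> \<Otimes>\<^sub>M noise_seq. orbit f (f x (fst p), snd p) t \<in> X"
  proof (rule P.AE_pair_measure)
    show "{p \<in> space (\<nu> \<Otimes>\<^sub>M noise_seq). orbit f (f x (fst p), snd p) t \<in> X} \<in> sets (\<nu> \<Otimes>\<^sub>M noise_seq)"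
      by measurable
    show "AE n in \<nu>. AE w in noise_seq. orbit f (f x (fst (n, w)), snd (n, w)) t \<in> X"
      using inv[OF Suc.prems] by eventually_elim (simp add: Suc.IH)
  qed
  then have "AE p in distr noise_seq (\<nu> \<Otimes>\<^sub>M noise_seq) (\<lambda>w. (w 0, \<lambda>k. w (Suc k))). orbit f (f x (fst p), snd p) t \<in> X"
    unfolding head_tail_distr .
  then show ?case unfolding orbit_Suc_shift
    by (subst (asm) AE_distr_iff) auto
qed

text \<open>Martingale differences without conditional expectations: once the first t noises are
  split off, the claim is \<open>zero\<close> at the state that has been reached. It is shown from
  every starting point, so that it can be applied with a given past.\<close>

lemma orbit_expectation_zero:
  fixes u :: "'a \<Rightarrow> 'b \<Rightarrow> real"
  assumes [measurable]: "case_prod u \<in> borel_measurable (M \<Otimes>\<^sub>M \<nu>)"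
    and b: "\<And>x n. \<bar>u x n\<bar> \<le> b" and zero: "\<And>x. x \<in> space M \<Longrightarrow> (\<integral>n. u x n \<partial>\<nu>) = 0"
    and x: "x \<in> space M"
  shows "(\<integral>w. u (orbit f (x, w) t) (w t) \<partial>noise_seq) = 0"
  using x
proof (induction t arbitrary: x)
  case 0
  then show ?case using zero[OF 0] integral_head_tail[of "\<lambda>n _. u x n" b] b
    by (simp add: measurable_compose_Pair1 split_beta' seq.prob_space)
next
  case (Suc t)
  note [measurable] = Suc.prems
  have "(\<integral>w. u (orbit f (x, w) (Suc t)) (w (Suc t)) \<partial>noise_seq) =
    (\<integral>n. \<integral>w. u (orbit f (f x n, w) t) (w t) \<partial>noise_seq \<partial>\<nu>)"
    unfolding orbit_Suc_shift using b
    by (intro integral_head_tail[of "\<lambda>n w. u (orbit f (f x n, w) t) (w t)" b]) (simp_all add: split_beta')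
  also have "\<dots> = (\<integral>n. 0 \<partial>\<nu>)"
    by (intro Bochner_Integration.integral_cong refl Suc.IH)
      (rule measurable_space[OF step_measurable'], auto intro: Suc.prems)
  finally show ?case by simp
qed

end

section \<open>Stationary chains: shift invariance and second moments of sums along a path\<close>

locale stationary_chain = driven_chain \<nu> M f + init: prob_space \<pi>
  for \<nu> :: "'b measure" and M :: "'a measure" and f :: "'a \<Rightarrow> 'b \<Rightarrow> 'a" and \<pi> :: "'a measure" +
  assumes sets_init: "sets \<pi> = sets M"
    and stationary: "distr (\<pi> \<Otimes>\<^sub>M \<nu>) M (case_prod f) = \<pi>"
begin

abbreviation "paths \<equiv> \<pi> \<Otimes>\<^sub>M noise_seq"

sublocale paths: pair_prob_space \<pi> noise_seq ..

lemma measurable_init: "measurable \<pi> L = measurable M L" "measurable L \<pi> = measurable L M"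
  by (rule measurable_cong_sets; simp add: sets_init)+

lemma sets_paths: "sets paths = sets (M \<Otimes>\<^sub>M noise_seq)"
  by (rule sets_pair_measure_cong[OF sets_init refl])

lemma measurable_paths: "measurable paths L = measurable (M \<Otimes>\<^sub>M noise_seq) L"
    "measurable L paths = measurable L (M \<Otimes>\<^sub>M noise_seq)"
  by (rule measurable_cong_sets; simp add: sets_paths)+

lemma space_init: "space \<pi> = space M"
  by (rule sets_eq_imp_space_eq[OF sets_init])

text \<open>The time shift on paths, coded by starting point and noise: the first noise is consumed
  by the new starting point.\<close>

definition shift :: "'a \<times> (nat \<Rightarrow> 'b) \<Rightarrow> 'a \<times> (nat \<Rightarrow> 'b)" where
  "shift s = (f (fst s) (snd s 0), \<lambda>k. snd s (Suc k))"

lemma orbit_shift: "orbit f (shift s) t = orbit f s (Suc t)"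
  by (cases s) (simp only: shift_def orbit_Suc_shift fst_conv snd_conv)

lemma orbit_shift_pow: "orbit f ((shift ^^ a) s) t = orbit f s (a + t)"
  by (induction a arbitrary: s) (simp_all add: orbit_shift funpow_swap1 del: orbit.simps(2))

lemma snd_shift_pow: "snd ((shift ^^ a) s) t = snd s (a + t)"
  by (induction a arbitrary: s) (simp_all add: shift_def funpow_swap1)

lemma fst_shift_pow: "fst ((shift ^^ a) s) = orbit f s a"
  using orbit_shift_pow[of a s 0] by simp

lemma shift_paths_measurable: "shift \<in> paths \<rightarrow>\<^sub>M paths"
  unfolding shift_def[abs_def] measurable_paths by measurable

text \<open>It suffices to test rectangles. The new starting point is made of the old one and the
  first noise, both independent of the later noise, and by stationarity it has the law \<pi>
  again.\<close>

lemma paths_shift_invariant: "distr paths paths shift = paths"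
proof (rule pair_measure_eqI[symmetric])
  show "sigma_finite_measure \<pi>" "sigma_finite_measure noise_seq" ..
  show "sets paths = sets (distr paths paths shift)" by simp
  fix A B assume A: "A \<in> sets \<pi>" and B: "B \<in> sets noise_seq"
  then have [measurable]: "A \<in> sets M" "B \<in> sets noise_seq" by (auto simp: sets_init)
  note [measurable] = step_measurable
  have meas2: "measurable (\<pi> \<Otimes>\<^sub>M \<nu>) L = measurable (M \<Otimes>\<^sub>M \<nu>) L" for L :: "'c measure"
    by (rule measurable_cong_sets) (auto intro: sets_pair_measure_cong simp: sets_init)
  have "emeasure (distr paths paths shift) (A \<times> B) = (\<integral>\<^sup>+s. indicator (A \<times> B) (shift s) \<partial>paths)"
    using A B shift_paths_measurable by (subst emeasure_distr)
      (auto intro!: nn_integral_cong simp flip: nn_integral_indicator split: split_indicator)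
  also have "\<dots> = (\<integral>\<^sup>+x. \<integral>\<^sup>+w. indicator A (f x (w 0)) * indicator B (\<lambda>k. w (Suc k)) \<partial>noise_seq \<partial>\<pi>)"
    by (subst seq.nn_integral_fst[symmetric])
      (auto simp: shift_def[abs_def] measurable_paths indicator_times)
  also have "\<dots> = (\<integral>\<^sup>+x. (\<integral>\<^sup>+n. indicator A (f x n) \<partial>\<nu>) * emeasure noise_seq B \<partial>\<pi>)"
  proof (rule nn_integral_cong)
    fix x assume "x \<in> space \<pi>"
    then have [measurable]: "x \<in> space M" by (simp add: space_init)
    show "(\<integral>\<^sup>+w. indicator A (f x (w 0)) * indicator B (\<lambda>k. w (Suc k)) \<partial>noise_seq) =
      (\<integral>\<^sup>+n. indicator A (f x n) \<partial>\<nu>) * emeasure noise_seq B"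
      using B by (subst nn_integral_head_tail[of "\<lambda>n w. indicator A (f x n) * indicator B w"])
        (auto simp: nn_integral_cmult nn_integral_multc split_beta')
  qed
  also have "\<dots> = (\<integral>\<^sup>+x. \<integral>\<^sup>+n. indicator A (f x n) \<partial>\<nu> \<partial>\<pi>) * emeasure noise_seq B"
    by (rule nn_integral_multc) (simp add: measurable_init)
  also have "(\<integral>\<^sup>+x. \<integral>\<^sup>+n. indicator A (f x n) \<partial>\<nu> \<partial>\<pi>) = emeasure (distr (\<pi> \<Otimes>\<^sub>M \<nu>) M (case_prod f)) A"
  proof -
    have "emeasure (distr (\<pi> \<Otimes>\<^sub>M \<nu>) M (case_prod f)) A =
      (\<integral>\<^sup>+p. indicator A p \<partial>distr (\<pi> \<Otimes>\<^sub>M \<nu>) M (case_prod f))" by simp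
    also have "\<dots> = (\<integral>\<^sup>+p. indicator A (f (fst p) (snd p)) \<partial>(\<pi> \<Otimes>\<^sub>M \<nu>))"
      by (subst nn_integral_distr) (auto simp: meas2 split_beta')
    also have "\<dots> = (\<integral>\<^sup>+x. \<integral>\<^sup>+n. indicator A (f x n) \<partial>\<nu> \<partial>\<pi>)"
      by (subst noise.nn_integral_fst[symmetric]) (auto simp: meas2)
    finally show ?thesis by simp
  qed
  also have "\<dots> = emeasure \<pi> A" by (simp add: stationary)
  finally show "emeasure \<pi> A * emeasure noise_seq B = emeasure (distr paths paths shift) (A \<times> B)" by simp
qed

lemma shift_pow_measurable: "(shift ^^ a) \<in> paths \<rightarrow>\<^sub>M paths"
  proof (induction a)
  case (Suc a)
  show ?case using measurable_comp[OF Suc shift_paths_measurable] by (simp add: comp_def)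
qed simp

lemma paths_shift_pow_invariant: "distr paths paths (shift ^^ a) = paths"
proof (induction a)
  case (Suc a)
  have "distr paths paths (shift ^^ Suc a) = distr (distr paths paths (shift ^^ a)) paths shift"
    by (subst distr_distr[OF shift_paths_measurable shift_pow_measurable]) simp
  also have "\<dots> = paths" unfolding Suc by (rule paths_shift_invariant)
  finally show ?case .
qed (simp add: distr_id[unfolded id_def] id_def)

text \<open>Reduces correlations between times s and t to those between times 0 and t - s.\<close>

lemma integral_shift_pow:
  fixes F :: "_ \<Rightarrow> real"
  assumes "F \<in> borel_measurable (M \<Otimes>\<^sub>M noise_seq)"
  shows "(\<integral>s. F ((shift ^^ a) s) \<partial>paths) = (\<integral>s. F s \<partial>paths)"
  using integral_distr[OF shift_pow_measurable[of a], of F] assms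
  by (simp add: paths_shift_pow_invariant measurable_paths)

lemma AE_orbit:
  assumes "AE x in \<pi>. x \<in> X" and X: "X \<in> sets M"
  shows "AE s in paths. orbit f s t \<in> X"
proof -
  have set: "{s \<in> space paths. fst s \<in> X} \<in> sets paths"
    using measurable_sets[OF measurable_fst[of \<pi> noise_seq], of X] X
    by (simp add: sets_init vimage_def Int_def conj_commute)
  have "AE s in paths. fst s \<in> X"
    by (rule paths.AE_pair_measure[OF set]) (use assms in simp)
  then have "AE s in distr paths paths (shift ^^ t). fst s \<in> X" unfolding paths_shift_pow_invariant .
  then show ?thesis
    by (subst (asm) AE_distr_iff[OF shift_pow_measurable set]) (simp add: fst_shift_pow)
qed

lemma AE_noise:
  assumes "AE n in \<nu>. n \<in> X" and X: "X \<in> sets \<nu>"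
  shows "AE s in paths. snd s t \<in> X"
proof -
  have "AE w in noise_seq. w t \<in> X"
    by (rule AE_PiM_component[OF noise.prob_space_axioms UNIV_I assms(1)])
  moreover have "{s \<in> space paths. snd s t \<in> X} \<in> sets paths"
    using measurable_sets[OF measurable_compose[OF measurable_snd[of \<pi> noise_seq] measurable_component_singleton[of t UNIV "\<lambda>_. \<nu>"]], of X] X
    by (simp add: vimage_def Int_def conj_commute)
  ultimately show ?thesis
    by (intro paths.AE_pair_measure) simp_all
qed

text \<open>For s < t the shift moves s to time 0. With the start and the first noise fixed, the
  first factor is constant and the second has mean zero, so only diagonal terms survive. The factor
  2 comes from \<open>second_moment_sum_le\<close>, applied with q = 0.\<close>

lemma martingale_second_moment:
  fixes u :: "'a \<Rightarrow> 'b \<Rightarrow> real"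
  assumes u: "case_prod u \<in> borel_measurable (M \<Otimes>\<^sub>M \<nu>)"
    and b: "\<And>x n. \<bar>u x n\<bar> \<le> b" and zero: "\<And>x. x \<in> space M \<Longrightarrow> (\<integral>n. u x n \<partial>\<nu>) = 0"
  shows "(\<lambda>s. \<Sum>t=1..T. u (orbit f s t) (snd s t)) \<in> borel_measurable paths"
    and "integrable paths (\<lambda>s. (\<Sum>t=1..T. u (orbit f s t) (snd s t))\<^sup>2)"
    and "(\<integral>s. (\<Sum>t=1..T. u (orbit f s t) (snd s t))\<^sup>2 \<partial>paths) \<le> real T * (2 * b\<^sup>2)"
proof -
  let ?Z = "\<lambda>t s. u (orbit f s t) (snd s t)"
  note [measurable] = u
  have Z[measurable]: "?Z t \<in> borel_measurable (M \<Otimes>\<^sub>M noise_seq)" for t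
  proof -
    have "(\<lambda>s. (orbit f s t, snd s t)) \<in> M \<Otimes>\<^sub>M noise_seq \<rightarrow>\<^sub>M M \<Otimes>\<^sub>M \<nu>" by measurable
    from measurable_compose[OF this u] show ?thesis by simp
  qed
  show "(\<lambda>s. \<Sum>t=1..T. ?Z t s) \<in> borel_measurable paths"
    unfolding measurable_paths by measurable
  have b0: "0 \<le> b" using b[of undefined undefined] by linarith
  have ZZ: "\<bar>?Z s x * ?Z t x\<bar> \<le> b\<^sup>2" for s t x
    unfolding abs_mult power2_eq_square by (intro mult_mono b b0) auto
  have int: "integrable paths (\<lambda>x. ?Z s x * ?Z t x)" for s t
    using ZZ by (intro paths.integrable_const_bound[where B = "b\<^sup>2"]) (auto simp: measurable_paths)
  have cov: "\<bar>\<integral>x. ?Z s x * ?Z t x \<partial>paths\<bar> \<le> b\<^sup>2 * 0 ^ (t - s)" if "s \<le> t" for s t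
  proof (cases "s = t")
    case True
    have "\<bar>\<integral>x. ?Z t x * ?Z t x \<partial>paths\<bar> \<le> (\<integral>x. \<bar>?Z t x * ?Z t x\<bar> \<partial>paths)" by (rule integral_abs_bound)
    also have "\<dots> \<le> b\<^sup>2" using ZZ int[of t t] by (intro paths.integral_le_const integrable_abs AE_I2) blast+
    finally show ?thesis using True by simp
  next
    case False
    \<comment> \<open>The shift by s turns time t into \<open>Suc k\<close>, and the removal of the
      first noise leaves k steps.\<close>
    define k where "k = t - s - 1"
    then have t: "t = s + Suc k" using False that by simp
    have "(\<integral>x. ?Z s x * ?Z t x \<partial>paths) = (\<integral>x. (\<lambda>x. ?Z 0 x * ?Z (Suc k) x) ((shift ^^ s) x) \<partial>paths)"
      by (simp add: orbit_shift_pow snd_shift_pow fst_shift_pow t del: orbit.simps(2))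
    also have "\<dots> = (\<integral>x. ?Z 0 x * ?Z (Suc k) x \<partial>paths)" by (rule integral_shift_pow) measurable
    also have "\<dots> = (\<integral>x. \<integral>w. ?Z 0 (x, w) * ?Z (Suc k) (x, w) \<partial>noise_seq \<partial>\<pi>)"
      using int by (rule paths.integral_fst'[symmetric])
    also have "\<dots> = (\<integral>x. 0 \<partial>\<pi>)"
    proof (rule Bochner_Integration.integral_cong)
      fix x assume "x \<in> space \<pi>"
      then have x[measurable]: "x \<in> space M" by (simp add: space_init)
      have "(\<integral>w. ?Z 0 (x, w) * ?Z (Suc k) (x, w) \<partial>noise_seq) =
        (\<integral>n. \<integral>w. u x n * ?Z k (f x n, w) \<partial>noise_seq \<partial>\<nu>)"
        unfolding orbit_Suc_shift orbit.simps(1) fst_conv snd_conv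
      proof (rule integral_head_tail)
        show "\<bar>u x n * u (orbit f (f x n, w) k) (w k)\<bar> \<le> b\<^sup>2" for n w
          unfolding abs_mult power2_eq_square by (intro mult_mono b b0) auto
      qed (simp add: split_beta')
      also have "\<dots> = (\<integral>n. 0 \<partial>\<nu>)"
      proof (rule Bochner_Integration.integral_cong)
        fix n assume "n \<in> space \<nu>"
        then have "f x n \<in> space M" using x measurable_space[OF step_measurable] by (auto simp: space_pair_measure)
        from orbit_expectation_zero[OF u b zero this]
        show "(\<integral>w. u x n * ?Z k (f x n, w) \<partial>noise_seq) = 0" by simp
      qed simp
      finally show "(\<integral>w. ?Z 0 (x, w) * ?Z (Suc k) (x, w) \<partial>noise_seq) = 0" by simp
    qed simp
    finally show ?thesis by simp
  qed
  show "integrable paths (\<lambda>s. (\<Sum>t=1..T. ?Z t s)\<^sup>2)"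
    by (rule paths.second_moment_sum_le(1)[where q = 0 and B = "b\<^sup>2"]) (auto intro: int cov)
  have "(\<integral>s. (\<Sum>t=1..T. ?Z t s)\<^sup>2 \<partial>paths) \<le> real T * (2 * b\<^sup>2 / (1 - 0))"
    by (rule paths.second_moment_sum_le(2)) (auto intro: int cov)
  then show "(\<integral>s. (\<Sum>t=1..T. ?Z t s)\<^sup>2 \<partial>paths) \<le> real T * (2 * b\<^sup>2)" by simp
qed

text \<open>From a starting point x, the mean of g after k steps differs from m by at most 2b V(x)
  \<eta>^k, because setwise convergence controls bounded integrands; the factor at time 0 is at most
  2b. Integration against \<pi> replaces V(x) by A and gives geometric decay of
  correlations.\<close>

lemma ergodic_second_moment:
  fixes g :: "'a \<Rightarrow> real"
  assumes g[measurable]: "g \<in> borel_measurable M" and b: "\<And>x. \<bar>g x\<bar> \<le> b"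
    and \<eta>: "0 \<le> \<eta>" "\<eta> < 1" and V: "integrable \<pi> V" and V0: "AE x in \<pi>. 0 \<le> V x"
    and mix: "\<And>t. AE x in \<pi>. \<forall>B\<in>sets M. \<bar>measure (distr noise_seq M (\<lambda>w. orbit f (x, w) t)) B - measure \<pi> B\<bar> \<le> V x * \<eta> ^ t"
  defines "A \<equiv> \<integral>x. V x \<partial>\<pi>" and "m \<equiv> \<integral>x. g x \<partial>\<pi>"
  shows "(\<lambda>s. \<Sum>t=1..T. g (orbit f s t) - m) \<in> borel_measurable paths"
    and "integrable paths (\<lambda>s. (\<Sum>t=1..T. g (orbit f s t) - m)\<^sup>2)"
    and "(\<integral>s. (\<Sum>t=1..T. g (orbit f s t) - m)\<^sup>2 \<partial>paths) \<le> real T * (8 * b\<^sup>2 * (1 + A) / (1 - \<eta>))"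
proof -
  let ?Z = "\<lambda>t s. g (orbit f s t) - m"
  have b0: "0 \<le> b" using b[of undefined] by linarith
  have A0: "0 \<le> A" unfolding A_def using V0 by (rule integral_nonneg_AE)
  have gint: "integrable \<pi> g" using b by (intro init.integrable_const_bound[where B = b]) (auto simp: measurable_init)
  have "m \<le> b" unfolding m_def using gint b by (intro init.integral_le_const) (auto simp: abs_le_iff)
  moreover have "- b \<le> m" unfolding m_def using gint b by (intro init.integral_ge_const) (auto simp: abs_le_iff minus_le_iff)
  ultimately have gm: "\<bar>g x - m\<bar> \<le> 2 * b" for x using b[of x] by linarith
  have Z[measurable]: "?Z t \<in> borel_measurable (M \<Otimes>\<^sub>M noise_seq)" for t by measurable
  show "(\<lambda>s. \<Sum>t=1..T. ?Z t s) \<in> borel_measurable paths"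
    unfolding measurable_paths by measurable
  have ZZ: "\<bar>?Z s x * ?Z t x\<bar> \<le> 4 * b\<^sup>2" for s t x
  proof -
    have "\<bar>?Z s x * ?Z t x\<bar> \<le> (2 * b) * (2 * b)"
      unfolding abs_mult by (intro mult_mono gm) (use b0 in auto)
    then show ?thesis by (simp add: power2_eq_square)
  qed
  have int: "integrable paths (\<lambda>x. ?Z s x * ?Z t x)" for s t
    using ZZ by (intro paths.integrable_const_bound[where B = "4 * b\<^sup>2"]) (auto simp: measurable_paths)
  have cov: "\<bar>\<integral>x. ?Z s x * ?Z t x \<partial>paths\<bar> \<le> (4 * b\<^sup>2 * (1 + A)) * \<eta> ^ (t - s)" if "s \<le> t" for s t
  proof -
    define k where "k = t - s"
    then have t: "t = s + k" using that by simp
    have "(\<integral>x. ?Z s x * ?Z t x \<partial>paths) = (\<integral>x. (\<lambda>x. ?Z 0 x * ?Z k x) ((shift ^^ s) x) \<partial>paths)"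
      by (simp add: orbit_shift_pow snd_shift_pow fst_shift_pow t)
    also have "\<dots> = (\<integral>x. ?Z 0 x * ?Z k x \<partial>paths)" by (rule integral_shift_pow) measurable
    also have "\<dots> = (\<integral>x. \<integral>w. ?Z 0 (x, w) * ?Z k (x, w) \<partial>noise_seq \<partial>\<pi>)"
      using int by (rule paths.integral_fst'[symmetric])
    finally have eq: "(\<integral>x. ?Z s x * ?Z t x \<partial>paths) = (\<integral>x. \<integral>w. ?Z 0 (x, w) * ?Z k (x, w) \<partial>noise_seq \<partial>\<pi>)" .
    have intk: "integrable \<pi> (\<lambda>x. \<integral>w. ?Z 0 (x, w) * ?Z k (x, w) \<partial>noise_seq)"
      using paths.integrable_fst'[OF int[of 0 k]] by simp
    have bound: "AE x in \<pi>. \<bar>\<integral>w. ?Z 0 (x, w) * ?Z k (x, w) \<partial>noise_seq\<bar> \<le> 4 * b\<^sup>2 * \<eta> ^ k * V x"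
      using mix[of k] AE_space V0
    proof eventually_elim
      case (elim x)
      then have [measurable]: "x \<in> space M" by (simp add: space_init)
      let ?D = "distr noise_seq M (\<lambda>w. orbit f (x, w) k)"
      interpret D: prob_space ?D by (rule seq.prob_space_distr) measurable
      have "\<bar>(\<integral>y. g y \<partial>?D) - (\<integral>y. g y \<partial>\<pi>)\<bar> \<le> 2 * b * (V x * \<eta> ^ k)"
        using elim(1) b by (intro integral_diff_le_setwise D.prob_space_axioms init.prob_space_axioms)
          (auto simp: sets_init)
      moreover have "(\<integral>y. g y \<partial>?D) = (\<integral>w. g (orbit f (x, w) k) \<partial>noise_seq)"
        by (rule integral_distr) measurable
      moreover have "(\<integral>w. ?Z 0 (x, w) * ?Z k (x, w) \<partial>noise_seq) =
        (g x - m) * ((\<integral>w. g (orbit f (x, w) k) \<partial>noise_seq) - m)"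
      proof -
        have "integrable noise_seq (\<lambda>w. g (orbit f (x, w) k))"
          using b by (intro seq.integrable_const_bound[where B = b]) auto
        then show ?thesis by (simp add: seq.P.prob_space)
      qed
      ultimately have "\<bar>\<integral>w. ?Z 0 (x, w) * ?Z k (x, w) \<partial>noise_seq\<bar> \<le> (2 * b) * (2 * b * (V x * \<eta> ^ k))"
        unfolding m_def[symmetric] by (simp only: abs_mult) (intro mult_mono gm; use b0 in simp)
      then show ?case by (simp add: power2_eq_square mult_ac)
    qed
    have "\<bar>\<integral>x. ?Z s x * ?Z t x \<partial>paths\<bar> \<le> (\<integral>x. \<bar>\<integral>w. ?Z 0 (x, w) * ?Z k (x, w) \<partial>noise_seq\<bar> \<partial>\<pi>)"
      unfolding eq by (rule integral_abs_bound)
    also have "\<dots> \<le> (\<integral>x. 4 * b\<^sup>2 * \<eta> ^ k * V x \<partial>\<pi>)"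
      using bound intk V by (intro integral_mono_AE integrable_abs integrable_mult_right)
    also have "\<dots> = 4 * b\<^sup>2 * \<eta> ^ k * A" by (simp add: A_def)
    also have "\<dots> \<le> 4 * b\<^sup>2 * \<eta> ^ k * (1 + A)" using \<eta> by (intro mult_left_mono) auto
    finally show ?thesis by (simp add: k_def mult_ac)
  qed
  have B0: "0 \<le> 4 * b\<^sup>2 * (1 + A)" using A0 by simp
  show "integrable paths (\<lambda>s. (\<Sum>t=1..T. ?Z t s)\<^sup>2)"
    by (rule paths.second_moment_sum_le(1)[OF \<eta> B0 int cov])
  have "(\<integral>s. (\<Sum>t=1..T. ?Z t s)\<^sup>2 \<partial>paths) \<le> real T * (2 * (4 * b\<^sup>2 * (1 + A)) / (1 - \<eta>))"
    by (rule paths.second_moment_sum_le(2)[OF \<eta> B0 int cov])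
  then show "(\<integral>s. (\<Sum>t=1..T. ?Z t s)\<^sup>2 \<partial>paths) \<le> real T * (8 * b\<^sup>2 * (1 + A) / (1 - \<eta>))" by (simp add: mult_ac)
qed

end

section \<open>Geometry of the state space\<close>

definition state_inner :: "network \<Rightarrow> state \<Rightarrow> state \<Rightarrow> real" where
  "state_inner N x y = (\<Sum>i<nodes N. \<Sum>a<block_dim N. x i a * y i a)"

text \<open>The nested norm is the Euclidean norm over pairs of a node and a coordinate, which makes
  the triangle and Cauchy-Schwarz inequalities for \<open>L2_set\<close> available.\<close>

lemma state_norm_L2_set: "state_norm N x = L2_set (\<lambda>p. x (fst p) (snd p)) ({..<nodes N} \<times> {..<block_dim N})"
  by (simp add: state_norm_def L2_set_def sum_nonneg sum.cartesian_product split_beta')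

lemma state_norm_nonneg: "0 \<le> state_norm N x"
  by (simp add: state_norm_def)

lemma state_inner_pairs: "state_inner N x y = (\<Sum>p\<in>{..<nodes N} \<times> {..<block_dim N}. x (fst p) (snd p) * y (fst p) (snd p))"
  by (simp add: state_inner_def sum.cartesian_product split_beta')

lemma state_norm_sq: "(state_norm N x)\<^sup>2 = state_inner N x x"
  by (simp add: state_norm_L2_set L2_set_def sum_nonneg state_inner_pairs power2_eq_square)

lemma state_norm_eq_sqrt: "state_norm N x = sqrt (state_inner N x x)"
  using state_norm_nonneg[of N x] by (simp flip: state_norm_sq)

lemma abs_state_inner_le: "\<bar>state_inner N x y\<bar> \<le> state_norm N x * state_norm N y"
proof -
  have "\<bar>state_inner N x y\<bar> \<le> (\<Sum>p\<in>{..<nodes N} \<times> {..<block_dim N}. \<bar>x (fst p) (snd p)\<bar> * \<bar>y (fst p) (snd p)\<bar>)"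
    unfolding state_inner_pairs abs_mult[symmetric] by (rule sum_abs)
  also have "\<dots> \<le> state_norm N x * state_norm N y"
    unfolding state_norm_L2_set by (rule L2_set_mult_ineq)
  finally show ?thesis .
qed

lemma state_norm_cong:
  "(\<And>i a. i < nodes N \<Longrightarrow> a < block_dim N \<Longrightarrow> x i a = y i a) \<Longrightarrow> state_norm N x = state_norm N y"
  unfolding state_norm_L2_set by (rule L2_set_cong) auto

lemma state_inner_cong:
  "(\<And>i a. i < nodes N \<Longrightarrow> a < block_dim N \<Longrightarrow> x i a = x' i a) \<Longrightarrow>
   (\<And>i a. i < nodes N \<Longrightarrow> a < block_dim N \<Longrightarrow> y i a = y' i a) \<Longrightarrow> state_inner N x y = state_inner N x' y'"
  by (simp add: state_inner_def)

lemma state_norm_triangle: "state_norm N (\<lambda>i a. x i a + y i a) \<le> state_norm N x + state_norm N y"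
  unfolding state_norm_L2_set by (rule L2_set_triangle_ineq)

lemma state_norm_scale: "state_norm N (\<lambda>i a. c * x i a) = \<bar>c\<bar> * state_norm N x"
  by (simp add: state_norm_eq_sqrt state_inner_def power2_eq_square algebra_simps real_sqrt_mult
      flip: sum_distrib_left)

lemma state_inner_diff_sq:
  "state_inner N x x - state_inner N y y = state_inner N (\<lambda>i a. x i a - y i a) (\<lambda>i a. x i a + y i a)"
  by (simp add: state_inner_def sum_subtractf[symmetric] algebra_simps)

lemma state_inner_sum_right: "state_inner N w (\<lambda>i a. \<Sum>k\<in>S. c k * f k i a) = (\<Sum>k\<in>S. c k * state_inner N w (f k))"
proof -
  have "state_inner N w (\<lambda>i a. \<Sum>k\<in>S. c k * f k i a) =
    (\<Sum>p\<in>{..<nodes N} \<times> {..<block_dim N}. \<Sum>k\<in>S. c k * (w (fst p) (snd p) * f k (fst p) (snd p)))"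
    unfolding state_inner_pairs by (simp add: sum_distrib_left mult_ac)
  also have "\<dots> = (\<Sum>k\<in>S. c k * state_inner N w (f k))"
    unfolding state_inner_pairs sum_distrib_left by (rule sum.swap)
  finally show ?thesis .
qed

lemma state_inner_comm: "state_inner N x y = state_inner N y x"
  by (simp add: state_inner_def mult.commute)

lemma state_norm_diff_sq:
  "(state_norm N (\<lambda>i a. x i a - y i a))\<^sup>2 = (state_norm N x)\<^sup>2 - 2 * state_inner N x y + (state_norm N y)\<^sup>2"
proof -
  have "(state_norm N (\<lambda>i a. x i a - y i a))\<^sup>2 =
    (\<Sum>p\<in>{..<nodes N} \<times> {..<block_dim N}. x (fst p) (snd p) * x (fst p) (snd p) - 2 * (x (fst p) (snd p) * y (fst p) (snd p)) + y (fst p) (snd p) * y (fst p) (snd p))"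
    unfolding state_norm_sq state_inner_pairs by (intro sum.cong refl) (simp add: algebra_simps)
  also have "\<dots> = (state_norm N x)\<^sup>2 - 2 * state_inner N x y + (state_norm N y)\<^sup>2"
    unfolding state_norm_sq state_inner_pairs by (simp add: sum.distrib sum_subtractf sum_distrib_left)
  finally show ?thesis .
qed

lemma L2_set_sum_le: "L2_set (\<lambda>a. \<Sum>j\<in>J. f j a) A \<le> (\<Sum>j\<in>J. L2_set (f j) A)"
proof (induction J rule: infinite_finite_induct)
  case (insert j J)
  then show ?case using L2_set_triangle_ineq[of "f j" "\<lambda>a. \<Sum>j\<in>J. f j a" A] by simp
qed (auto simp: L2_set_def)

lemma node_dist_nonneg: "0 \<le> node_dist N x i j"
  by (simp add: node_dist_def)

lemma node_dist_commute: "node_dist N x i j = node_dist N x j i"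
  unfolding node_dist_def L2_set_def by (simp add: power2_commute)

lemma block_norm_le:
  assumes "i < nodes N"
  shows "L2_set (x i) {..<block_dim N} \<le> state_norm N x"
  unfolding state_norm_def using assms by (intro member_le_L2_set) auto

lemma node_dist_le:
  assumes "i < nodes N" "j < nodes N"
  shows "node_dist N x i j \<le> 2 * state_norm N x"
proof -
  have "node_dist N x i j \<le> L2_set (x j) {..<block_dim N} + L2_set (\<lambda>a. - x i a) {..<block_dim N}"
    unfolding node_dist_def using L2_set_triangle_ineq[of "x j" "\<lambda>a. - x i a"] by simp
  also have "L2_set (\<lambda>a. - x i a) {..<block_dim N} = L2_set (x i) {..<block_dim N}"
    by (simp add: L2_set_def)
  finally show ?thesis using block_norm_le[OF assms(1), of x] block_norm_le[OF assms(2), of x] by linarith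
qed

section \<open>The force as a linear function of the coupling, and its size\<close>

lemma force_apply:
  assumes "i < nodes N" "a < block_dim N"
  shows "force N \<psi> x i a = (\<Sum>j<nodes N. weight N i j * \<psi> (node_dist N x i j) * (x j a - x i a))"
  using assms by (simp add: force_def)

lemma force_cong:
  assumes "\<And>i j. i < nodes N \<Longrightarrow> j < nodes N \<Longrightarrow> \<psi> (node_dist N x i j) = \<psi>' (node_dist N x i j)"
  shows "force N \<psi> x = force N \<psi>' x"
  unfolding force_def using assms by (intro restrict_ext) simp

lemma force_sum:
  assumes "i < nodes N" "a < block_dim N"
  shows "force N (\<lambda>r. \<Sum>k\<in>S. c k * g k r) x i a = (\<Sum>k\<in>S. c k * force N (g k) x i a)"
proof -
  have "force N (\<lambda>r. \<Sum>k\<in>S. c k * g k r) x i a =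
    (\<Sum>j<nodes N. \<Sum>k\<in>S. c k * (weight N i j * g k (node_dist N x i j) * (x j a - x i a)))"
    unfolding force_apply[OF assms] by (intro sum.cong refl) (simp add: sum_distrib_left sum_distrib_right mult_ac)
  also have "\<dots> = (\<Sum>k\<in>S. c k * force N (g k) x i a)"
    unfolding force_apply[OF assms] sum_distrib_left by (rule sum.swap)
  finally show ?thesis .
qed

lemma force_diff:
  assumes "i < nodes N" "a < block_dim N"
  shows "force N (\<lambda>r. \<psi> r - \<psi>' r) x i a = force N \<psi> x i a - force N \<psi>' x i a"
  unfolding force_apply[OF assms] sum_subtractf[symmetric]
  by (intro sum.cong refl) (simp add: algebra_simps)

lemma force_scale:
  assumes "i < nodes N" "a < block_dim N"
  shows "force N (\<lambda>r. c * \<psi> r) x i a = c * force N \<psi> x i a"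
  unfolding force_apply[OF assms] sum_distrib_left
  by (intro sum.cong refl) (simp add: algebra_simps)

text \<open>Each of the n blocks is a sum of n vectors of norm at most K s R, and the norm of a
  state is at most the sum of the norms of its blocks; hence the square of n. Blocks are estimated
  as a whole, so d does not appear.\<close>

lemma state_norm_force_le:
  assumes w: "\<And>i j. i < nodes N \<Longrightarrow> j < nodes N \<Longrightarrow> 0 \<le> weight N i j \<and> weight N i j \<le> K"
    and s: "\<And>i j. i < nodes N \<Longrightarrow> j < nodes N \<Longrightarrow> \<bar>\<psi> (node_dist N x i j)\<bar> \<le> s"
    and R: "\<And>i j. i < nodes N \<Longrightarrow> j < nodes N \<Longrightarrow> node_dist N x i j \<le> R"
  shows "state_norm N (force N \<psi> x) \<le> (real (nodes N))\<^sup>2 * K * R * s"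
proof -
  have blk: "L2_set (force N \<psi> x i) {..<block_dim N} \<le> real (nodes N) * (K * s * R)" if i: "i < nodes N" for i
  proof -
    have "L2_set (force N \<psi> x i) {..<block_dim N} =
      L2_set (\<lambda>a. \<Sum>j<nodes N. weight N i j * \<psi> (node_dist N x i j) * (x j a - x i a)) {..<block_dim N}"
      using i by (intro L2_set_cong) (auto simp: force_apply)
    also have "\<dots> \<le> (\<Sum>j<nodes N. L2_set (\<lambda>a. weight N i j * \<psi> (node_dist N x i j) * (x j a - x i a)) {..<block_dim N})"
      by (rule L2_set_sum_le)
    also have "\<dots> \<le> (\<Sum>j<nodes N. K * s * R)"
    proof (rule sum_mono)
      fix j assume "j \<in> {..<nodes N}"
      then have j: "j < nodes N" by simp
      have "L2_set (\<lambda>a. weight N i j * \<psi> (node_dist N x i j) * (x j a - x i a)) {..<block_dim N} =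
        \<bar>weight N i j * \<psi> (node_dist N x i j)\<bar> * node_dist N x i j"
        unfolding node_dist_def[of N x i j]
        by (simp add: L2_set_def power_mult_distrib real_sqrt_mult abs_mult flip: sum_distrib_left)
      also have "\<dots> \<le> K * s * R"
        unfolding abs_mult using w[OF i j] s[OF i j] R[OF i j] node_dist_nonneg[of N x i j]
        by (intro mult_mono) auto
      finally show "L2_set (\<lambda>a. weight N i j * \<psi> (node_dist N x i j) * (x j a - x i a)) {..<block_dim N} \<le> K * s * R" .
    qed
    finally show ?thesis by simp
  qed
  have "state_norm N (force N \<psi> x) \<le> (\<Sum>i<nodes N. \<bar>L2_set (force N \<psi> x i) {..<block_dim N}\<bar>)"
    unfolding state_norm_def by (rule L2_set_le_sum_abs)
  also have "\<dots> \<le> (\<Sum>i<nodes N. real (nodes N) * (K * s * R))"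
    using blk by (intro sum_mono) auto
  also have "\<dots> = (real (nodes N))\<^sup>2 * K * R * s" by (simp add: power2_eq_square)
  finally show ?thesis .
qed

section \<open>Measurability on the state space, and the projection to mean zero\<close>

lemma space_state_space: "space (state_space N) = {..<nodes N} \<rightarrow>\<^sub>E {..<block_dim N} \<rightarrow>\<^sub>E UNIV"
  by (simp add: state_space_def block_space_def space_PiM)

lemma measurable_state_component[measurable (raw)]:
  assumes "g \<in> L \<rightarrow>\<^sub>M state_space N" "i < nodes N" "a < block_dim N"
  shows "(\<lambda>\<omega>. g \<omega> i a) \<in> borel_measurable L"
proof -
  have "(\<lambda>x. x i) \<in> state_space N \<rightarrow>\<^sub>M block_space N"
    unfolding state_space_def using assms by (intro measurable_component_singleton) auto
  moreover have "(\<lambda>x. x a) \<in> block_space N \<rightarrow>\<^sub>M borel"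
    unfolding block_space_def using assms by (intro measurable_component_singleton) auto
  ultimately show ?thesis
    by (rule measurable_compose[OF measurable_compose[OF assms(1)]])
qed

lemma measurable_state_restrict:
  assumes "\<And>i a. i < nodes N \<Longrightarrow> a < block_dim N \<Longrightarrow> (\<lambda>\<omega>. g \<omega> i a) \<in> borel_measurable L"
  shows "(\<lambda>\<omega>. \<lambda>i\<in>{..<nodes N}. \<lambda>a\<in>{..<block_dim N}. g \<omega> i a) \<in> L \<rightarrow>\<^sub>M state_space N"
  unfolding state_space_def block_space_def
  by (intro measurable_restrict) (use assms in auto)

lemma measurable_node_dist[measurable (raw)]:
  assumes "g \<in> L \<rightarrow>\<^sub>M state_space N" "i < nodes N" "j < nodes N"
  shows "(\<lambda>\<omega>. node_dist N (g \<omega>) i j) \<in> borel_measurable L"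
  unfolding node_dist_def L2_set_def using assms by measurable

lemma measurable_state_inner[measurable (raw)]:
  assumes "g \<in> L \<rightarrow>\<^sub>M state_space N" "h \<in> L \<rightarrow>\<^sub>M state_space N"
  shows "(\<lambda>\<omega>. state_inner N (g \<omega>) (h \<omega>)) \<in> borel_measurable L"
  unfolding state_inner_def using assms by measurable

lemma measurable_state_norm[measurable (raw)]:
  assumes "g \<in> L \<rightarrow>\<^sub>M state_space N"
  shows "(\<lambda>\<omega>. state_norm N (g \<omega>)) \<in> borel_measurable L"
  unfolding state_norm_eq_sqrt using assms by measurable

lemma measurable_force[measurable (raw)]:
  assumes [measurable]: "g \<in> L \<rightarrow>\<^sub>M state_space N" "\<psi> \<in> borel_measurable borel"
  shows "(\<lambda>\<omega>. force N \<psi> (g \<omega>)) \<in> L \<rightarrow>\<^sub>M state_space N"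
  unfolding force_def by (intro measurable_state_restrict) measurable

lemma measurable_proj: "proj N \<in> state_space N \<rightarrow>\<^sub>M state_space N"
  unfolding proj_def by (intro measurable_state_restrict) measurable

lemma proj_mean_zero:
  assumes "a < block_dim N"
  shows "(\<Sum>i<nodes N. proj N x i a) = 0"
  using assms by (cases "nodes N = 0") (simp_all add: proj_def sum_subtractf)

text \<open>Pythagoras in each coordinate: the mixed term of projection and average vanishes because
  the projection has mean zero.\<close>

lemma state_norm_proj_le: "state_norm N (proj N x) \<le> state_norm N x"
proof -
  have "(state_norm N (proj N x))\<^sup>2 \<le> (state_norm N x)\<^sup>2"
  proof -
    let ?n = "nodes N" 
    have *: "(\<Sum>i<?n. (proj N x i a)\<^sup>2) \<le> (\<Sum>i<?n. (x i a)\<^sup>2)" if a: "a < block_dim N" for a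
    proof -
      let ?m = "(\<Sum>j<?n. x j a) / real ?n"
      have "(\<Sum>i<?n. (x i a)\<^sup>2) = (\<Sum>i<?n. (proj N x i a)\<^sup>2 + 2 * ?m * proj N x i a + ?m\<^sup>2)"
      proof (intro sum.cong refl)
        fix i assume "i \<in> {..<?n}"
        then have e: "proj N x i a + ?m = x i a" using a by (simp add: proj_def)
        have "(p + m)\<^sup>2 = p\<^sup>2 + 2 * m * p + m\<^sup>2" for p m :: real
          by (simp add: power2_eq_square algebra_simps)
        from this[of "proj N x i a" ?m] show "(x i a)\<^sup>2 = (proj N x i a)\<^sup>2 + 2 * ?m * proj N x i a + ?m\<^sup>2"
          unfolding e .
      qed
      also have "\<dots> = (\<Sum>i<?n. (proj N x i a)\<^sup>2) + 2 * ?m * (\<Sum>i<?n. proj N x i a) + (\<Sum>i<?n. ?m\<^sup>2)"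
        by (simp add: sum.distrib sum_distrib_left)
      also have "\<dots> \<ge> (\<Sum>i<?n. (proj N x i a)\<^sup>2)"
        by (simp add: proj_mean_zero[OF a] sum_nonneg)
      finally show ?thesis .
    qed
    have swap: "state_inner N (y :: state) y = (\<Sum>a<block_dim N. \<Sum>i<nodes N. (y i a)\<^sup>2)" for y
      unfolding state_inner_def power2_eq_square by (rule sum.swap)
    show ?thesis unfolding state_norm_sq swap by (rule sum_mono) (rule *, simp)
  qed
  then show ?thesis using state_norm_nonneg by (rule power2_le_imp_le)
qed

section \<open>Trajectories of the network\<close>

text \<open>The weights of the state-dependent graph. With them the Laplacian of the network is
  \<open>graph_lap\<close>, acting on each of the d coordinates separately.\<close>

definition link_strength :: "network \<Rightarrow> state \<Rightarrow> nat \<Rightarrow> nat \<Rightarrow> real" where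
  "link_strength N x i j = weight N i j * coupling N (node_dist N x i j)"

lemma trajectory_eq_orbit: "trajectory N s t = orbit (step N) s t"
  by (induction t) auto

lemma step_apply:
  assumes "i < nodes N" "a < block_dim N"
  shows "step N x w i a = (x i a - step_size N * graph_lap (nodes N) (link_strength N x) (\<lambda>i. x i a) i) + step_size N * w i a"
proof -
  have "force N (coupling N) x i a = - graph_lap (nodes N) (link_strength N x) (\<lambda>i. x i a) i"
    unfolding force_apply[OF assms] graph_lap_def link_strength_def sum_negf[symmetric]
    by (intro sum.cong) (auto simp: algebra_simps)
  then show ?thesis using assms by (simp add: step_def)
qed

text \<open>A scalar eigenvector is lifted by placing it in the first coordinate of every block. In
  the absence of loops the diagonal entry of the matrix, a full row sum, agrees with that of
  \<open>graph_lap\<close>, where the term of the node itself drops out.\<close>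

lemma laplacian_eigenvalue:
  assumes no_loops: "\<And>i. i < nodes N \<Longrightarrow> weight N i i = 0" and d: "1 \<le> block_dim N"
    and ev: "\<And>i. i < nodes N \<Longrightarrow> graph_lap (nodes N) (link_strength N x) v i = l * v i"
    and nz: "\<exists>i<nodes N. v i \<noteq> 0"
  shows "l \<in> spectrum (laplacian N x)"
proof -
  let ?n = "nodes N" and ?d = "block_dim N"
  let ?V = "Matrix.vec (?n * ?d) (\<lambda>p. if p mod ?d = 0 then v (p div ?d) else 0)"
  have L: "laplacian N x \<in> carrier_mat (?n * ?d) (?n * ?d)" by (simp add: laplacian_def)
  have idx: "j * ?d < ?n * ?d" if "j < ?n" for j using that d by simp
  have "?V \<noteq> 0\<^sub>v (?n * ?d)"
  proof
    assume V: "?V = 0\<^sub>v (?n * ?d)"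
    obtain i where i: "i < ?n" "v i \<noteq> 0" using nz by blast
    have "vec_index ?V (i * ?d) = v i" using idx[OF i(1)] d by simp
    then show False using V i idx[OF i(1)] by simp
  qed
  moreover have "laplacian N x *\<^sub>v ?V = l \<cdot>\<^sub>v ?V"
  proof (rule eq_vecI)
    fix p assume "p < dim_vec (l \<cdot>\<^sub>v ?V)"
    then have p: "p < ?n * ?d" by simp
    let ?i = "p div ?d"
    have i: "?i < ?n" using p d by (simp add: less_mult_imp_div_less)
    let ?A = "\<lambda>q. laplacian N x $$ (p, q)"
    have "vec_index (laplacian N x *\<^sub>v ?V) p = (\<Sum>q\<in>{0..<?n * ?d}. ?A q * vec_index ?V q)"
      using p L by (simp add: scalar_prod_def laplacian_def)
    also have "\<dots> = (\<Sum>q\<in>(\<lambda>j. j * ?d) ` {..<?n}. ?A q * vec_index ?V q)"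
    proof (rule sum.mono_neutral_right)
      show "\<forall>q\<in>{0..<?n * ?d} - (\<lambda>j. j * ?d) ` {..<?n}. ?A q * vec_index ?V q = 0"
      proof
        fix q assume q: "q \<in> {0..<?n * ?d} - (\<lambda>j. j * ?d) ` {..<?n}"
        have "q mod ?d \<noteq> 0"
        proof
          assume "q mod ?d = 0"
          then have "q = (q div ?d) * ?d" by auto
          moreover have "q div ?d < ?n" using q by (simp add: less_mult_imp_div_less)
          ultimately show False using q by blast
        qed
        then show "?A q * vec_index ?V q = 0" using q by simp
      qed
    qed (use idx in auto)
    also have "\<dots> = (\<Sum>j<?n. ?A (j * ?d) * v j)"
      using d idx by (subst sum.reindex) (auto simp: inj_on_def)
    also have "\<dots> = l * (if p mod ?d = 0 then v ?i else 0)"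
    proof (cases "p mod ?d = 0")
      case False
      then have "?A (j * ?d) = 0" if "j < ?n" for j
        using p idx[OF that] by (simp add: laplacian_def Let_def)
      then show ?thesis using False by simp
    next
      case True
      let ?c = "link_strength N x ?i"
      have A: "?A (j * ?d) = (if j = ?i then \<Sum>l<?n. ?c l else - ?c j)" if "j < ?n" for j
        using p idx[OF that] True d by (auto simp: laplacian_def Let_def link_strength_def)
      have "(\<Sum>j<?n. ?A (j * ?d) * v j) = (\<Sum>j<?n. (if j = ?i then (\<Sum>l<?n. ?c l) * v ?i else 0) - ?c j * v j)"
        using no_loops[OF i] by (intro sum.cong) (auto simp: A link_strength_def)
      also have "\<dots> = graph_lap ?n (link_strength N x) v ?i"
        using i by (simp add: sum_subtractf graph_lap_def right_diff_distrib sum_distrib_right)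
      finally show ?thesis using ev[OF i] True by simp
    qed
    also have "\<dots> = vec_index (l \<cdot>\<^sub>v ?V) p" using p by simp
    finally show "vec_index (laplacian N x *\<^sub>v ?V) p = vec_index (l \<cdot>\<^sub>v ?V) p" .
  qed (use L in simp)
  ultimately have "eigenvector (laplacian N x) ?V l" using L by (auto simp: eigenvector_def)
  then show ?thesis by (auto simp: spectrum_def eigenvalue_def)
qed

section \<open>One step of the network: contraction of the linear part\<close>

context contractive_network
begin

abbreviation "n \<equiv> nodes N"
abbreviation "d \<equiv> block_dim N"
abbreviation "h \<equiv> step_size N"
abbreviation "K \<equiv> max_weight N"

lemma two_nodes:
  assumes "num_edges N \<noteq> 0"
  shows "2 \<le> n"
proof (rule ccontr)
  assume "\<not> 2 \<le> n"
  then have "n = 1" using nodes by simp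
  then have "j \<notin> neighbours N i" if "i < n" for i j
    using that no_loops[of 0] by (auto simp: neighbours_def)
  then have empty: "{{i, j} |i j. i < nodes N \<and> j \<in> neighbours N i} = {}" by blast
  show False using assms unfolding num_edges_def empty by simp
qed

lemma weight_le: "i < n \<Longrightarrow> j < n \<Longrightarrow> weight N i j \<le> K"
proof -
  assume ij: "i < n" "j < n"
  have "{weight N i j |i j. i < n \<and> j < n} = (\<lambda>(i, j). weight N i j) ` ({..<n} \<times> {..<n})" by auto
  then have "finite {weight N i j |i j. i < n \<and> j < n}" by simp
  then show ?thesis unfolding max_weight_def using ij by (intro Max_ge) auto
qed

lemma K_nonneg: "0 \<le> K"
  using weight_le[of 0 0] weight_nonneg[of 0 0] nodes by simp

lemma link_strength_sym: "i < n \<Longrightarrow> j < n \<Longrightarrow> link_strength N x i j = link_strength N x j i"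
  by (simp add: link_strength_def undirected node_dist_commute[of N x i])

lemma link_strength_nonneg: "i < n \<Longrightarrow> j < n \<Longrightarrow> 0 \<le> link_strength N x i j"
  by (simp add: link_strength_def weight_nonneg less_imp_le[OF coupling_pos])

text \<open>The matrix is frozen at x while y is any centred vector: y = x gives the dynamics,
  another choice tests how small z can be. On centred vectors connectivity excludes the eigenvalue
  0, so the eigenvalues l lie between \<open>lambda_2\<close> and \<open>lambda_max\<close>, and |1
  - h l| is at most its larger value at these two ends.\<close>

lemma linear_part_contraction:
  assumes z: "contraction N x \<le> z" and y: "\<And>a. a < d \<Longrightarrow> (\<Sum>i<n. y i a) = 0"
  shows "state_norm N (\<lambda>i a. y i a - h * graph_lap n (link_strength N x) (\<lambda>i. y i a) i) \<le> z * state_norm N y"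
proof -
  let ?c = "link_strength N x"
  have z0: "0 \<le> z" using z by (auto simp: contraction_def)
  have ev: "\<bar>1 - h * l\<bar> \<le> z" if v: "(\<Sum>i<n. v i) = 0" "\<exists>i<n. v i \<noteq> 0"
    "\<And>i. i < n \<Longrightarrow> graph_lap n ?c v i = l * v i" for v l
  proof -
    have l: "l \<in> spectrum (laplacian N x)"
      using no_loops block_dim v(3,2) by (rule laplacian_eigenvalue)
    have "l \<noteq> 0"
    proof
      assume l0: "l = 0"
      have const: "v i = v j" if "i < n" "j < n" for i j
      proof (rule graph_lap_eq_0_imp_const[where c = ?c and n = n and v = v and i = i and j = j])
        show "(i, j) \<in> {(i, j). i < n \<and> j \<in> neighbours N i}\<^sup>*" using that by (rule connected)
        show "a < n \<and> b < n \<and> 0 < ?c a b" if "(a, b) \<in> {(i, j). i < n \<and> j \<in> neighbours N i}" for a b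
          using that coupling_pos by (auto simp: neighbours_def link_strength_def)
        show "graph_lap n ?c v i = 0" if "i < n" for i using v(3)[OF that] l0 by simp
      qed (fact link_strength_sym link_strength_nonneg)+
      obtain i where i: "i < n" "v i \<noteq> 0" using v(2) by blast
      have "(\<Sum>j<n. v j) = (\<Sum>j<n. v i)" by (intro sum.cong refl const) (use i in auto)
      then show False using v(1) i nodes by simp
    qed
    \<comment> \<open>Finiteness gives \<open>Min\<close> and \<open>Max\<close> in
      \<open>lambda_2\<close> and \<open>lambda_max\<close> their meaning.\<close>
    have fin: "finite (spectrum (laplacian N x))"
      by (rule card_finite_spectrum(1)[of _ "n * d"]) (simp add: laplacian_def)
    have "lambda_2 N x \<le> l" "l \<le> lambda_max N x"
      unfolding lambda_2_def lambda_max_def using fin l \<open>l \<noteq> 0\<close> by auto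
    then have "h * lambda_2 N x \<le> h * l" "h * l \<le> h * lambda_max N x"
      using step_size by simp_all
    then show ?thesis using z unfolding contraction_def by linarith
  qed
  have *: "(\<Sum>i<n. (y i a - h * graph_lap n ?c (\<lambda>i. y i a) i)\<^sup>2) \<le> z\<^sup>2 * (\<Sum>i<n. (y i a)\<^sup>2)" if "a < d" for a
  proof (rule graph_lap_contraction[where c = ?c and v = "\<lambda>i. y i a"])
    show "\<bar>1 - h * l\<bar> \<le> z" if "(\<Sum>i<n. v i) = 0" "\<exists>i<n. v i \<noteq> 0"
      "\<And>i. i < n \<Longrightarrow> graph_lap n ?c v i = l * v i" for v l
      using that by (rule ev)
  qed (fact link_strength_sym step_size z0 y[OF that])+
  have swap: "(state_norm N u)\<^sup>2 = (\<Sum>a<d. \<Sum>i<n. (u i a)\<^sup>2)" for u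
    unfolding state_norm_sq unfolding state_inner_def power2_eq_square by (rule sum.swap)
  have "(state_norm N (\<lambda>i a. y i a - h * graph_lap n ?c (\<lambda>i. y i a) i))\<^sup>2 \<le> (\<Sum>a<d. z\<^sup>2 * (\<Sum>i<n. (y i a)\<^sup>2))"
    unfolding swap by (rule sum_mono) (use * in auto)
  also have "\<dots> = (z * state_norm N y)\<^sup>2"
    by (simp add: power_mult_distrib swap sum_distrib_left)
  finally show ?thesis by (rule power2_le_imp_le) (intro mult_nonneg_nonneg z0 state_norm_nonneg)
qed

lemma step_mean_zero:
  assumes "\<And>a. a < d \<Longrightarrow> (\<Sum>i<n. x i a) = 0" "\<And>a. a < d \<Longrightarrow> (\<Sum>i<n. w i a) = 0" "a < d"
  shows "(\<Sum>i<n. step N x w i a) = 0"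
proof -
  have "(\<Sum>i<n. step N x w i a) = (\<Sum>i<n. x i a) - h * (\<Sum>i<n. graph_lap n (link_strength N x) (\<lambda>i. x i a) i) + h * (\<Sum>i<n. w i a)"
    using assms(3) by (simp add: step_apply sum.distrib sum_subtractf sum_distrib_left)
  also have "(\<Sum>i<n. graph_lap n (link_strength N x) (\<lambda>i. x i a) i) = 0"
    using link_strength_sym by (rule graph_lap_sum_zero)
  finally show ?thesis using assms by simp
qed

lemma step_norm_le:
  assumes z: "contraction N x \<le> z" and x: "\<And>a. a < d \<Longrightarrow> (\<Sum>i<n. x i a) = 0"
  shows "state_norm N (step N x w) \<le> z * state_norm N x + h * state_norm N w"
proof -
  have "state_norm N (step N x w) = state_norm N (\<lambda>i a. (x i a - h * graph_lap n (link_strength N x) (\<lambda>i. x i a) i) + h * w i a)"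
    by (rule state_norm_cong) (simp add: step_apply)
  also have "\<dots> \<le> state_norm N (\<lambda>i a. x i a - h * graph_lap n (link_strength N x) (\<lambda>i. x i a) i) + state_norm N (\<lambda>i a. h * w i a)"
    by (rule state_norm_triangle)
  also have "\<dots> \<le> z * state_norm N x + h * state_norm N w"
    using linear_part_contraction[OF z x] step_size by (simp add: state_norm_scale)
  finally show ?thesis .
qed

end

text \<open>A ball in the orthogonal complement of the diagonal. For c = R/2 all distances in it are
  at most R, and the trajectories almost surely stay inside.\<close>

definition centred_ball :: "network \<Rightarrow> real \<Rightarrow> state set" where
  "centred_ball N c = {x \<in> space (state_space N). state_norm N x \<le> c \<and> (\<forall>a<block_dim N. (\<Sum>i<nodes N. x i a) = 0)}"

lemma centred_ball_sets[measurable]: "centred_ball N c \<in> sets (state_space N)"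
  unfolding centred_ball_def by measurable

lemma step_in_space: "step N x w \<in> space (state_space N)"
  by (auto simp: space_state_space step_def)

lemma proj_in_space: "proj N x \<in> space (state_space N)"
  by (auto simp: space_state_space proj_def)

lemma proj_in_centred_ball: "state_norm N x \<le> c \<Longrightarrow> proj N x \<in> centred_ball N c"
  using state_norm_proj_le[of N x] by (auto simp: centred_ball_def proj_in_space proj_mean_zero)

lemma abs_measure_diff_le_tv_dist:
  assumes "prob_space M" "prob_space M'" "B \<in> sets M"
  shows "\<bar>measure M B - measure M' B\<bar> \<le> tv_dist M M'"
  unfolding tv_dist_def
proof (rule cSUP_upper[OF assms(3)])
  have "\<bar>measure M A - measure M' A\<bar> \<le> 1" for A
    using prob_space.prob_le_1[OF assms(1), of A] prob_space.prob_le_1[OF assms(2), of A]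
      measure_nonneg[of M A] measure_nonneg[of M' A] by linarith
  then show "bdd_above ((\<lambda>B. \<bar>measure M B - measure M' B\<bar>) ` sets M)" by (intro bdd_aboveI2)
qed

section \<open>Measurability of the step; the laws of the start and of the noise\<close>

context contractive_network
begin

text \<open>Continuity is known on [0,\<infinity>) only. Freezing the function at its value at 0 on
  the negative half-line makes it continuous everywhere, and leaves forces unchanged because
  distances are non-negative.\<close>

lemma coupling_measurable: "(\<lambda>r. coupling N (max 0 r)) \<in> borel_measurable borel"
proof (rule borel_measurable_continuous_onI)
  have "continuous_on UNIV (coupling N \<circ> max 0)"
    by (intro continuous_on_compose continuous_intros continuous_on_subset[OF coupling_continuous]) auto
  then show "continuous_on UNIV (\<lambda>r. coupling N (max 0 r))" by (simp add: comp_def)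
qed

lemma force_coupling: "force N (coupling N) x = force N (\<lambda>r. coupling N (max 0 r)) x"
  by (rule force_cong) (simp add: node_dist_nonneg)

lemma measurable_step:
  assumes [measurable]: "f \<in> L \<rightarrow>\<^sub>M state_space N" "g \<in> L \<rightarrow>\<^sub>M state_space N"
  shows "(\<lambda>\<omega>. step N (f \<omega>) (g \<omega>)) \<in> L \<rightarrow>\<^sub>M state_space N"
proof -
  note [measurable] = coupling_measurable
  show ?thesis unfolding step_def force_coupling by (intro measurable_state_restrict) measurable
qed

lemma sets_noise_vector_law: "sets (noise_vector_law N) = sets (state_space N)"
  unfolding noise_vector_law_def state_space_def by (rule sets_PiM_cong) (simp_all add: noise_law)

lemma sets_init_vector_law: "sets (init_vector_law N) = sets (state_space N)"
  unfolding init_vector_law_def state_space_def by (rule sets_PiM_cong) (simp_all add: init_law)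

lemma prob_space_noise_vector_law: "prob_space (noise_vector_law N)"
  unfolding noise_vector_law_def by (rule prob_space_PiM) (simp add: noise_law)

lemma prob_space_init_vector_law: "prob_space (init_vector_law N)"
  unfolding init_vector_law_def by (rule prob_space_PiM) (simp add: init_law)

lemma proj_measurable_noise: "proj N \<in> noise_vector_law N \<rightarrow>\<^sub>M state_space N"
  using measurable_proj measurable_cong_sets[OF sets_noise_vector_law refl] by blast

lemma proj_measurable_init: "proj N \<in> init_vector_law N \<rightarrow>\<^sub>M state_space N"
  using measurable_proj measurable_cong_sets[OF sets_init_vector_law refl] by blast

lemma sets_noise_measure: "sets (noise_measure N) = sets (state_space N)"
  by (simp add: noise_measure_def)

lemma sets_init_measure: "sets (init_measure N) = sets (state_space N)"
  by (simp add: init_measure_def)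

lemma prob_space_noise_measure: "prob_space (noise_measure N)"
  unfolding noise_measure_def by (rule prob_space.prob_space_distr[OF prob_space_noise_vector_law proj_measurable_noise])

lemma prob_space_init_measure: "prob_space (init_measure N)"
  unfolding init_measure_def by (rule prob_space.prob_space_distr[OF prob_space_init_vector_law proj_measurable_init])

lemma measurable_noise_measure: "measurable (noise_measure N) L = measurable (state_space N) L"
  "measurable L (noise_measure N) = measurable L (state_space N)"
  by (rule measurable_cong_sets; simp add: sets_noise_measure)+

sublocale chain: driven_chain "noise_measure N" "state_space N" "step N"
proof (intro driven_chain.intro driven_chain_axioms.intro prob_space_noise_measure)
  have "snd \<in> state_space N \<Otimes>\<^sub>M noise_measure N \<rightarrow>\<^sub>M state_space N"
    unfolding measurable_noise_measure(2)[symmetric] by (rule measurable_snd)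
  then have "(\<lambda>p. step N (fst p) (snd p)) \<in> state_space N \<Otimes>\<^sub>M noise_measure N \<rightarrow>\<^sub>M state_space N"
    by (intro measurable_step measurable_fst)
  then show "case_prod (step N) \<in> state_space N \<Otimes>\<^sub>M noise_measure N \<rightarrow>\<^sub>M state_space N"
    by (simp add: split_beta')
qed

lemma noise_AE: "AE w in noise_measure N. w \<in> centred_ball N \<omega>"
proof -
  have "AE w in noise_vector_law N. proj N w \<in> centred_ball N \<omega>"
    using noise_bounded by eventually_elim (rule proj_in_centred_ball)
  then show ?thesis unfolding noise_measure_def
    by (subst AE_distr_iff[OF proj_measurable_noise]) (auto simp: centred_ball_sets)
qed

lemma init_AE: "AE x in init_measure N. x \<in> centred_ball N R0"
proof -
  have "AE w in init_vector_law N. proj N w \<in> centred_ball N R0"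
    using init_bounded by eventually_elim (rule proj_in_centred_ball)
  then show ?thesis unfolding init_measure_def
    by (subst AE_distr_iff[OF proj_measurable_init]) (auto simp: centred_ball_sets)
qed

lemma R0_nonneg: "0 \<le> R0"
proof -
  obtain x where "x \<in> centred_ball N R0"
    using prob_space.AE_imp_ex[OF prob_space_init_measure init_AE] by blast
  then show ?thesis using state_norm_nonneg[of N x] by (auto simp: centred_ball_def)
qed

lemma \<omega>_nonneg: "0 \<le> \<omega>"
proof -
  obtain x where "x \<in> centred_ball N \<omega>"
    using prob_space.AE_imp_ex[OF prob_space_noise_measure noise_AE] by blast
  then show ?thesis using state_norm_nonneg[of N x] by (auto simp: centred_ball_def)
qed

text \<open>The noise is essentially bounded, hence integrable, and the projection only subtracts an
  average of centred variables.\<close>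

lemma noise_measure_mean:
  assumes i: "i < n" and a: "a < d"
  shows "integrable (noise_measure N) (\<lambda>w. w i a)" and "(\<integral>w. w i a \<partial>noise_measure N) = 0"
proof -
  interpret noise: prob_space "noise_vector_law N" by (rule prob_space_noise_vector_law)
  have meas: "(\<lambda>w. w i a) \<in> borel_measurable (state_space N)" if "i < n" for i
    using that a by measurable
  have int: "integrable (noise_vector_law N) (\<lambda>w. w i a)" if "i < n" for i
  proof (rule noise.integrable_const_bound)
    show "AE w in noise_vector_law N. norm (w i a) \<le> \<omega>"
      using noise_bounded
    proof eventually_elim
      case (elim w)
      have "\<bar>w i a\<bar> \<le> L2_set (w i) {..<d}"
        using member_le_L2_set[of "{..<d}" a "\<lambda>a. \<bar>w i a\<bar>"] a by (simp add: L2_set_def)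
      then show ?case using block_norm_le[OF that, of w] elim by simp
    qed
  qed (use meas[OF that] measurable_cong_sets[OF sets_noise_vector_law refl] in blast)
  have proj: "proj N w i a = w i a - (\<Sum>j<n. w j a) / real n" for w
    using i a by (simp add: proj_def)
  have pint: "integrable (noise_vector_law N) (\<lambda>w. proj N w i a)"
    unfolding proj using int i by (intro Bochner_Integration.integrable_diff integrable_divide Bochner_Integration.integrable_sum) simp_all
  show "integrable (noise_measure N) (\<lambda>w. w i a)"
    unfolding noise_measure_def by (subst integrable_distr_eq[OF proj_measurable_noise meas[OF i]]) (rule pint)
  have "(\<integral>w. w i a \<partial>noise_measure N) = (\<integral>w. proj N w i a \<partial>noise_vector_law N)"
    unfolding noise_measure_def by (rule integral_distr[OF proj_measurable_noise meas[OF i]])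
  also have "\<dots> = (\<integral>w. w i a \<partial>noise_vector_law N) - (\<integral>w. (\<Sum>j<n. w j a) / real n \<partial>noise_vector_law N)"
    unfolding proj using int i
    by (intro Bochner_Integration.integral_diff integrable_divide Bochner_Integration.integrable_sum) simp_all
  also have "(\<integral>w. (\<Sum>j<n. w j a) / real n \<partial>noise_vector_law N) = (\<Sum>j<n. \<integral>w. w j a \<partial>noise_vector_law N) / real n"
    using int by (simp add: Bochner_Integration.integral_sum)
  also have "(\<integral>w. w i a \<partial>noise_vector_law N) - \<dots> = 0"
    using i a by (simp add: noise_mean)
  finally show "(\<integral>w. w i a \<partial>noise_measure N) = 0" .
qed

lemma noise_inner_mean: "(\<integral>w. state_inner N w y \<partial>noise_measure N) = 0"
proof -
  have "(\<integral>w. state_inner N w y \<partial>noise_measure N) = (\<Sum>i<n. \<integral>w. (\<Sum>a<d. w i a * y i a) \<partial>noise_measure N)"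
    unfolding state_inner_def
    by (intro Bochner_Integration.integral_sum Bochner_Integration.integrable_sum integrable_mult_left noise_measure_mean(1)) simp_all
  also have "\<dots> = (\<Sum>i<n. \<Sum>a<d. \<integral>w. w i a * y i a \<partial>noise_measure N)"
    by (intro sum.cong refl Bochner_Integration.integral_sum integrable_mult_left noise_measure_mean(1)) simp_all
  also have "\<dots> = 0"
    by (intro sum.neutral ballI) (simp add: noise_measure_mean(2))
  finally show ?thesis .
qed

section \<open>Uniform contraction along trajectories and the trapping ball\<close>

definition z :: real where "z = real_of_ereal (zeta N)"

lemma prob_space_init_paths: "prob_space (sample_measure N (init_measure N))"
proof -
  interpret init: prob_space "init_measure N" by (rule prob_space_init_measure)
  interpret pair_prob_space "init_measure N" chain.noise_seq ..
  show ?thesis unfolding sample_measure_def noise_seq_measure_def by (rule P.prob_space_axioms)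
qed

lemma zeta_AE: "AE s in sample_measure N (init_measure N). \<forall>t. ereal (contraction N (trajectory N s t)) \<le> zeta N"
  unfolding AE_all_countable
proof
  fix t
  have "esssup (sample_measure N (init_measure N)) (\<lambda>s. ereal (contraction N (trajectory N s t))) \<le> zeta N"
    unfolding zeta_def by (rule SUP_upper) simp
  note * = this
  from esssup_AE[of "\<lambda>s. ereal (contraction N (trajectory N s t))" "sample_measure N (init_measure N)"]
  show "AE s in sample_measure N (init_measure N). ereal (contraction N (trajectory N s t)) \<le> zeta N"
    by eventually_elim (rule order_trans[OF _ *])
qed

text \<open>Evaluated on an actual path, \<open>zeta N\<close> is at least a maximum of absolute
  values, hence non-negative; being also less than 1, it is finite.\<close>

lemma zeta_eq: "zeta N = ereal z" and z_nonneg: "0 \<le> z" and z_less: "z < 1"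
proof -
  obtain s where "\<forall>t. ereal (contraction N (trajectory N s t)) \<le> zeta N"
    using prob_space.AE_imp_ex[OF prob_space_init_paths zeta_AE] by blast
  then have "ereal (contraction N (trajectory N s 0)) \<le> zeta N" by blast
  moreover have "0 \<le> contraction N (trajectory N s 0)" by (simp add: contraction_def)
  ultimately have 0: "0 \<le> zeta N" by (meson ereal_less_eq(5) order_trans)
  with uniformly_contractive show "zeta N = ereal z" by (cases "zeta N") (auto simp: z_def)
  with 0 uniformly_contractive show "0 \<le> z" "z < 1" by auto
qed

lemma radius_eq: "radius N R0 \<omega> = 2 * (R0 + h * \<omega> / (1 - z))"
  by (simp add: radius_def z_def)

lemma radius_half: "radius N R0 \<omega> / 2 = R0 + h * \<omega> / (1 - z)"
  unfolding radius_eq by (rule nonzero_mult_div_cancel_left) simp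

text \<open>The radius is made for this recursion: z (R/2) + h \<omega> = z R0 + h \<omega> / (1 -
  z), which is at most R/2 because z < 1.\<close>

lemma step_in_centred_ball:
  assumes z: "contraction N x \<le> z" and x: "x \<in> centred_ball N (radius N R0 \<omega> / 2)" and w: "w \<in> centred_ball N \<omega>"
  shows "step N x w \<in> centred_ball N (radius N R0 \<omega> / 2)"
proof -
  have "state_norm N (step N x w) \<le> z * state_norm N x + h * state_norm N w"
    using x by (intro step_norm_le z) (simp add: centred_ball_def)
  also have "\<dots> \<le> z * (radius N R0 \<omega> / 2) + h * \<omega>"
    using x w z_nonneg step_size by (intro add_mono mult_left_mono) (auto simp: centred_ball_def)
  also have "\<dots> = z * R0 + h * \<omega> / (1 - z)"
    using z_less by (simp add: radius_eq field_simps)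
  also have "\<dots> \<le> radius N R0 \<omega> / 2"
    using mult_right_mono[OF less_imp_le[OF z_less] R0_nonneg] by (simp add: radius_half)
  finally show ?thesis using x w step_mean_zero[of x w] step_in_space by (simp add: centred_ball_def)
qed

lemma noise_seq_AE: "AE w in noise_seq_measure N. \<forall>t. w t \<in> centred_ball N \<omega>"
  unfolding AE_all_countable noise_seq_measure_def
  using AE_PiM_component[OF prob_space_noise_measure UNIV_I noise_AE] by blast

lemma trajectory_AE:
  "AE s in sample_measure N (init_measure N). \<forall>t. contraction N (trajectory N s t) \<le> z \<and> trajectory N s t \<in> centred_ball N (radius N R0 \<omega> / 2)"
proof -
  interpret init: prob_space "init_measure N" by (rule prob_space_init_measure)
  interpret pair_prob_space "init_measure N" chain.noise_seq ..
  have sets1: "{s \<in> space (init_measure N \<Otimes>\<^sub>M chain.noise_seq). fst s \<in> centred_ball N R0} \<in> sets (init_measure N \<Otimes>\<^sub>M chain.noise_seq)"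
    using measurable_sets[OF measurable_fst[of "init_measure N" chain.noise_seq], of "centred_ball N R0"]
    by (simp add: sets_init_measure centred_ball_sets vimage_def Int_def conj_commute)
  have sets2: "{s \<in> space (init_measure N \<Otimes>\<^sub>M chain.noise_seq). \<forall>t. snd s t \<in> centred_ball N \<omega>} \<in> sets (init_measure N \<Otimes>\<^sub>M chain.noise_seq)"
  proof (rule sets.sets_Collect_countable_All)
    fix t
    show "{s \<in> space (init_measure N \<Otimes>\<^sub>M chain.noise_seq). snd s t \<in> centred_ball N \<omega>} \<in> sets (init_measure N \<Otimes>\<^sub>M chain.noise_seq)"
      using measurable_sets[OF measurable_compose[OF measurable_snd[of "init_measure N" chain.noise_seq] measurable_component_singleton[of t UNIV "\<lambda>_. noise_measure N"]], of "centred_ball N \<omega>"]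
      by (simp add: sets_noise_measure centred_ball_sets vimage_def Int_def conj_commute)
  qed
  have 1: "AE s in sample_measure N (init_measure N). fst s \<in> centred_ball N R0"
    unfolding sample_measure_def noise_seq_measure_def
    by (rule AE_pair_measure[OF sets1]) (use init_AE in simp)
  have 2: "AE s in sample_measure N (init_measure N). \<forall>t. snd s t \<in> centred_ball N \<omega>"
    unfolding sample_measure_def noise_seq_measure_def
    by (rule AE_pair_measure[OF sets2]) (use noise_seq_AE[unfolded noise_seq_measure_def] in simp)
  have R0: "R0 \<le> radius N R0 \<omega> / 2"
    using z_less step_size \<omega>_nonneg by (simp add: radius_eq)
  show ?thesis using 1 2 zeta_AE
  proof eventually_elim
    case (elim s)
    then have c: "contraction N (trajectory N s t) \<le> z" for t by (simp add: zeta_eq)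
    have "trajectory N s t \<in> centred_ball N (radius N R0 \<omega> / 2)" for t
    proof (induction t)
      case 0
      then show ?case using elim(1) R0 by (auto simp: centred_ball_def)
    next
      case (Suc t)
      then show ?case using step_in_centred_ball[OF c Suc] elim(2) by simp
    qed
    with c show ?case by blast
  qed
qed

lemma radius_nonneg: "0 \<le> radius N R0 \<omega>"
  using R0_nonneg \<omega>_nonneg step_size z_less by (simp add: radius_eq)

lemma node_dist_le_radius:
  assumes "x \<in> centred_ball N (radius N R0 \<omega> / 2)" "i < n" "j < n"
  shows "node_dist N x i j \<in> {0..radius N R0 \<omega>}"
  using node_dist_le[OF assms(2,3), of x] assms(1) node_dist_nonneg[of N x i j]
  by (simp add: centred_ball_def)

text \<open>Since \<open>h \<omega> / (1 - z) \<le> R / 2\<close>, a lower bound on \<open>z\<close> bounds the noise independently of the step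
  size. It is obtained by testing the contraction on the difference of two unit vectors.\<close>

lemma noise_bound_le:
  assumes n2: "2 \<le> n" and S: "\<And>r. r \<in> {0..radius N R0 \<omega>} \<Longrightarrow> coupling N r \<le> S"
  shows "\<omega> \<le> real n * K * S * radius N R0 \<omega>"
proof -
  \<comment> \<open>Twice the bound n K S on the degree of a node: the entries of the test vector
    differ by at most 2, so h times the Laplacian moves its entries 1 and -1 towards 0 by at most m
    h.\<close>
  define m where "m = 2 * real n * K * S"
  obtain s where s: "contraction N (trajectory N s 0) \<le> z" "trajectory N s 0 \<in> centred_ball N (radius N R0 \<omega> / 2)"
    using prob_space.AE_imp_ex[OF prob_space_init_paths trajectory_AE] by blast
  define x where "x = trajectory N s 0"
  let ?c = "link_strength N x"
  have c: "0 \<le> ?c i j" "?c i j \<le> K * S" if "i < n" "j < n" for i j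
    using link_strength_nonneg[OF that] weight_le[OF that] weight_nonneg[OF that] K_nonneg
      S[OF node_dist_le_radius[OF s(2) that]] less_imp_le[OF coupling_pos[of "node_dist N x i j"]]
    by (auto simp: link_strength_def x_def intro!: mult_mono)
  let ?v = "\<lambda>i. if i = 0 then 1 else if i = Suc 0 then -1 else 0 :: real"
  let ?y = "\<lambda>i a. if a = (0::nat) then ?v i else 0"
  have deg: "(\<Sum>j<n. ?c i j) \<le> real n * (K * S)" if "i < n" for i
    using sum_bounded_above[of "{..<n}" "?c i" "K * S"] c(2)[OF that] by simp
  have v01: "(\<Sum>i<n. f (?v i)) = f 1 + f (-1) + real (n - 2) * f 0" for f :: "real \<Rightarrow> real"
  proof -
    have "{..<n} = insert 0 (insert (Suc 0) {2..<n})" using n2 by auto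
    then have "(\<Sum>i<n. f (?v i)) = f 1 + (f (-1) + (\<Sum>i=2..<n. f (?v i)))" by simp
    also have "(\<Sum>i=2..<n. f (?v i)) = (\<Sum>i=2..<n. f 0)" by (intro sum.cong) auto
    finally show ?thesis using n2 by simp
  qed
  \<comment> \<open>If m h exceeds 1 the claim is weaker than z \<ge> 0; otherwise 1 - m h is
    non-negative and inequalities may be squared.\<close>
  have z_ge: "1 - m * h \<le> z"
  proof (cases "m * h \<le> 1")
    case False
    then show ?thesis using z_nonneg by linarith
  next
    case True
    let ?u = "\<lambda>i. ?v i - h * graph_lap n ?c ?v i"
    have "state_norm N (\<lambda>i a. ?y i a - h * graph_lap n ?c (\<lambda>i. ?y i a) i) \<le> z * state_norm N ?y"
    proof (rule linear_part_contraction)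
      show "contraction N x \<le> z" using s(1) by (simp add: x_def)
      show "(\<Sum>i<n. ?y i a) = 0" for a using v01[of "\<lambda>t. t"] by (cases "a = 0") simp_all
    qed
    then have "(state_norm N (\<lambda>i a. ?y i a - h * graph_lap n ?c (\<lambda>i. ?y i a) i))\<^sup>2 \<le> (z * state_norm N ?y)\<^sup>2"
      using state_norm_nonneg by (intro power_mono)
    also have "\<dots> = z\<^sup>2 * 2"
    proof -
      have "(state_norm N ?y)\<^sup>2 = (\<Sum>i<n. \<Sum>a<d. if a = 0 then (?v i)\<^sup>2 else 0)"
        unfolding state_norm_sq state_inner_def by (intro sum.cong refl) (simp add: power2_eq_square)
      also have "\<dots> = (\<Sum>i<n. (?v i)\<^sup>2)" using block_dim by simp
      also have "\<dots> = 2" using v01[of "\<lambda>t. t\<^sup>2"] by simp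
      finally show ?thesis by (simp add: power_mult_distrib)
    qed
    finally have A: "(state_norm N (\<lambda>i a. ?y i a - h * graph_lap n ?c (\<lambda>i. ?y i a) i))\<^sup>2 \<le> z\<^sup>2 * 2" .
    have B: "(?u 0)\<^sup>2 + (?u 1)\<^sup>2 \<le> (state_norm N (\<lambda>i a. ?y i a - h * graph_lap n ?c (\<lambda>i. ?y i a) i))\<^sup>2"
    proof -
      have "(?u 0)\<^sup>2 + (?u 1)\<^sup>2 = (\<Sum>i\<in>{0, 1}. (?u i)\<^sup>2)" by simp
      also have "\<dots> \<le> (\<Sum>i<n. (?u i)\<^sup>2)" using n2 by (intro sum_mono2) auto
      also have "\<dots> = (\<Sum>i<n. \<Sum>a\<in>{0}. (?y i a - h * graph_lap n ?c (\<lambda>i. ?y i a) i) * (?y i a - h * graph_lap n ?c (\<lambda>i. ?y i a) i))"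
        by (simp add: power2_eq_square)
      also have "\<dots> \<le> (\<Sum>i<n. \<Sum>a<d. (?y i a - h * graph_lap n ?c (\<lambda>i. ?y i a) i) * (?y i a - h * graph_lap n ?c (\<lambda>i. ?y i a) i))"
        using block_dim by (intro sum_mono sum_mono2) auto
      finally show ?thesis unfolding state_norm_sq state_inner_def .
    qed
    have "1 - m * h \<le> ?u 0"
    proof -
      have "graph_lap n ?c ?v 0 \<le> (\<Sum>j<n. ?c 0 j * 2)"
        unfolding graph_lap_def using c n2 by (intro sum_mono mult_left_mono) auto
      also have "\<dots> \<le> m" using deg[of 0] n2 by (simp add: m_def flip: sum_distrib_right)
      finally show ?thesis using mult_left_mono[of "graph_lap n ?c ?v 0" m h] step_size by (simp add: mult.commute)
    qed
    then have C: "(1 - m * h)\<^sup>2 \<le> (?u 0)\<^sup>2" using True by (intro power_mono) auto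
    have "1 - m * h \<le> - ?u 1"
    proof -
      have "- graph_lap n ?c ?v 1 \<le> (\<Sum>j<n. ?c 1 j * 2)"
        unfolding graph_lap_def sum_negf[symmetric] mult_minus_right[symmetric]
        using c n2 by (intro sum_mono mult_left_mono) auto
      also have "\<dots> \<le> m" using deg[of 1] n2 by (simp add: m_def flip: sum_distrib_right)
      finally show ?thesis using mult_left_mono[of "- graph_lap n ?c ?v 1" m h] step_size by (simp add: mult.commute)
    qed
    then have D: "(1 - m * h)\<^sup>2 \<le> (- ?u 1)\<^sup>2" using True by (intro power_mono) auto
    have "(1 - m * h)\<^sup>2 \<le> z\<^sup>2"
      using order_trans[OF B A] C D[unfolded power2_minus] by linarith
    then show ?thesis using z_nonneg by (rule power2_le_imp_le)
  qed
  have m0: "0 \<le> m"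
  proof -
    have "0 \<le> S" using S[of 0] less_imp_le[OF coupling_pos[of 0]] radius_nonneg by simp
    then show ?thesis using K_nonneg by (simp add: m_def)
  qed
  have "h * \<omega> / (1 - z) \<le> radius N R0 \<omega> / 2" using R0_nonneg by (simp add: radius_half)
  then have "h * \<omega> \<le> (1 - z) * (radius N R0 \<omega> / 2)" using z_less by (simp add: divide_le_eq mult.commute)
  also have "\<dots> \<le> (m * h) * (radius N R0 \<omega> / 2)"
    using z_ge radius_nonneg by (intro mult_right_mono) auto
  also have "\<dots> = h * (real n * K * S * radius N R0 \<omega>)" by (simp add: m_def)
  finally show ?thesis using step_size by simp
qed

section \<open>Consequences of geometric ergodicity for the invariant law\<close>

lemma transition_eq: "transition N t x = distr chain.noise_seq (state_space N) (\<lambda>w. orbit (step N) (x, w) t)"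
  by (simp add: transition_def noise_seq_measure_def trajectory_eq_orbit)

lemma prob_space_transition: "x \<in> space (state_space N) \<Longrightarrow> prob_space (transition N t x)"
  unfolding transition_eq by (rule chain.seq.P.prob_space_distr) measurable

text \<open>The kernel \<open>transition N 1\<close> integrates over whole noise sequences, of which
  it reads the first entry; integrating out the rest turns invariance into stationarity of a single
  step.\<close>

lemma invariant_law_stationary:
  assumes "invariant_law N \<pi>"
  shows "stationary_chain (noise_measure N) (state_space N) (step N) \<pi>"
proof -
  have \<pi>: "prob_space \<pi>" "sets \<pi> = sets (state_space N)"
    and inv: "\<And>B. B \<in> sets \<pi> \<Longrightarrow> emeasure \<pi> B = (\<integral>\<^sup>+x. emeasure (transition N 1 x) B \<partial>\<pi>)"
    using assms by (auto simp: invariant_law_def)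
  interpret \<pi>: prob_space \<pi> by (rule \<pi>)
  have sp: "space \<pi> = space (state_space N)" by (rule sets_eq_imp_space_eq[OF \<pi>(2)])
  have meas: "measurable (\<pi> \<Otimes>\<^sub>M noise_measure N) L = measurable (state_space N \<Otimes>\<^sub>M noise_measure N) L" for L :: "'c measure"
    by (rule measurable_cong_sets) (auto intro: sets_pair_measure_cong simp: \<pi>)
  have "distr (\<pi> \<Otimes>\<^sub>M noise_measure N) (state_space N) (case_prod (step N)) = \<pi>"
  proof (rule measure_eqI)
    fix B assume "B \<in> sets (distr (\<pi> \<Otimes>\<^sub>M noise_measure N) (state_space N) (case_prod (step N)))"
    then have B[measurable]: "B \<in> sets (state_space N)" by simp
    note [measurable] = chain.step_measurable
    have "emeasure (distr (\<pi> \<Otimes>\<^sub>M noise_measure N) (state_space N) (case_prod (step N))) B =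
      (\<integral>\<^sup>+p. indicator B p \<partial>distr (\<pi> \<Otimes>\<^sub>M noise_measure N) (state_space N) (case_prod (step N)))" by simp
    also have "\<dots> = (\<integral>\<^sup>+p. indicator B (step N (fst p) (snd p)) \<partial>(\<pi> \<Otimes>\<^sub>M noise_measure N))"
      by (subst nn_integral_distr) (auto simp: meas split_beta')
    also have "\<dots> = (\<integral>\<^sup>+x. \<integral>\<^sup>+w. indicator B (step N x w) \<partial>noise_measure N \<partial>\<pi>)"
      by (subst chain.noise.nn_integral_fst[symmetric]) (auto simp: meas)
    also have "\<dots> = (\<integral>\<^sup>+x. emeasure (transition N 1 x) B \<partial>\<pi>)"
    proof (rule nn_integral_cong)
      fix x assume "x \<in> space \<pi>"
      then have [measurable]: "x \<in> space (state_space N)" by (simp add: sp)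
      have "emeasure (transition N 1 x) B = (\<integral>\<^sup>+y. indicator B y \<partial>transition N 1 x)"
        by (simp add: transition_eq)
      also have "\<dots> = (\<integral>\<^sup>+w. indicator B (step N x (w 0)) \<partial>chain.noise_seq)"
        unfolding transition_eq by (subst nn_integral_distr) auto
      also have "\<dots> = (\<integral>\<^sup>+w. \<integral>\<^sup>+w'. indicator B (step N x w) \<partial>chain.noise_seq \<partial>noise_measure N)"
        by (rule chain.nn_integral_head_tail[of "\<lambda>w _. indicator B (step N x w)"]) (simp add: split_beta')
      finally show "(\<integral>\<^sup>+w. indicator B (step N x w) \<partial>noise_measure N) = emeasure (transition N 1 x) B"
        by (simp add: chain.seq.P.emeasure_space_1)
    qed
    also have "\<dots> = emeasure \<pi> B" by (rule inv[symmetric]) (simp add: \<pi> B)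
    finally show "emeasure (distr (\<pi> \<Otimes>\<^sub>M noise_measure N) (state_space N) (case_prod (step N))) B = emeasure \<pi> B" .
  qed (simp add: \<pi>)
  then show ?thesis
    by (intro stationary_chain.intro chain.driven_chain_axioms \<pi> stationary_chain_axioms.intro)
qed

text \<open>The hypothesis speaks of starting points in X only, and \<pi> is not assumed to charge X
  or the ball. Take one point of X whose orbit almost surely stays in the ball. Its laws at all
  times give full mass to the ball and to X, and convergence in total variation passes this on to
  \<pi>.\<close>

lemma geometric_ergodicity_AE:
  assumes erg: "geometrically_ergodic N \<pi> V \<eta>"
  shows "AE x in \<pi>. x \<in> centred_ball N (radius N R0 \<omega> / 2)" (is ?ball)
    and "AE x in \<pi>. 0 \<le> V x" (is ?pos)
    and "AE x in \<pi>. \<forall>B\<in>sets (state_space N).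
      \<bar>measure (distr chain.noise_seq (state_space N) (\<lambda>w. orbit (step N) (x, w) t)) B - measure \<pi> B\<bar> \<le> V x * \<eta> ^ t" (is ?mix)
proof -
  obtain X where X: "X \<in> sets (state_space N)" and init: "AE x in init_measure N. x \<in> X"
    and inv: "\<And>x. x \<in> X \<Longrightarrow> AE w in noise_measure N. step N x w \<in> X"
    and tv: "\<And>x t. x \<in> X \<Longrightarrow> tv_dist (transition N t x) \<pi> \<le> V x * \<eta> ^ t"
    using erg unfolding geometrically_ergodic_def by blast
  have \<eta>: "0 \<le> \<eta>" "\<eta> < 1" and inv_law: "invariant_law N \<pi>"
    using erg by (auto simp: geometrically_ergodic_def)
  then have \<pi>: "prob_space \<pi>" "sets \<pi> = sets (state_space N)" by (auto simp: invariant_law_def)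
  interpret \<pi>: prob_space \<pi> by (rule \<pi>)
  have XS: "x \<in> X \<Longrightarrow> x \<in> space (state_space N)" for x using sets.sets_into_space[OF X] by blast
  have mix: "\<bar>measure (transition N t x) B - measure \<pi> B\<bar> \<le> V x * \<eta> ^ t" if "x \<in> X" "B \<in> sets (state_space N)" for x t B
  proof -
    have "B \<in> sets (transition N t x)" using that by (simp add: transition_eq)
    from abs_measure_diff_le_tv_dist[OF prob_space_transition[OF XS[OF that(1)]] \<pi>(1) this] tv[OF that(1), of t]
    show ?thesis by linarith
  qed
  \<comment> \<open>At time 0 and for the empty set the mixing bound reads 0 \<le> V x.\<close>
  have V0: "0 \<le> V x" if "x \<in> X" for x
    using mix[OF that sets.empty_sets, of 0] by simp
  have full: "AE x in \<pi>. x \<in> Y" if Y: "Y \<in> sets (state_space N)" and x: "x \<in> X"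
    and stay: "\<And>t. AE w in chain.noise_seq. orbit (step N) (x, w) t \<in> Y" for Y x
  proof -
    have [measurable]: "x \<in> space (state_space N)" by (rule XS[OF x])
    have "measure (transition N t x) Y = 1" for t
    proof -
      interpret T: prob_space "transition N t x" by (rule prob_space_transition) measurable
      have "AE y in transition N t x. y \<in> Y"
        unfolding transition_eq using stay[of t] Y by (subst AE_distr_iff) auto
      then show ?thesis using Y by (subst T.prob_eq_1) (simp_all add: transition_eq)
    qed
    then have le: "\<bar>1 - measure \<pi> Y\<bar> \<le> V x * \<eta> ^ t" for t using mix[OF x Y, of t] by simp
    have "(\<lambda>t. V x * \<eta> ^ t) \<longlonglongrightarrow> V x * 0"
      using \<eta> by (intro tendsto_mult tendsto_const LIMSEQ_realpow_zero)
    then have "\<bar>1 - measure \<pi> Y\<bar> \<le> V x * 0" by (rule LIMSEQ_le_const) (use le in blast)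
    then have "measure \<pi> Y = 1" using \<pi>.prob_le_1[of Y] by simp
    then show ?thesis using Y by (subst (asm) \<pi>.prob_eq_1) (simp_all add: \<pi>)
  qed
  interpret init: prob_space "init_measure N" by (rule prob_space_init_measure)
  interpret pair_prob_space "init_measure N" chain.noise_seq ..
  \<comment> \<open>By Fubini almost every start has almost surely good paths, and almost every
    start lies in X; one point with both properties is enough.\<close>
  have "AE x in init_measure N. AE w in chain.noise_seq. \<forall>t. contraction N (trajectory N (x, w) t) \<le> z \<and>
      trajectory N (x, w) t \<in> centred_ball N (radius N R0 \<omega> / 2)"
    using trajectory_AE unfolding sample_measure_def noise_seq_measure_def by (rule AE_pair)
  with init have "AE x in init_measure N. x \<in> X \<and> (AE w in chain.noise_seq. \<forall>t. contraction N (trajectory N (x, w) t) \<le> z \<and>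
      trajectory N (x, w) t \<in> centred_ball N (radius N R0 \<omega> / 2))"
    by eventually_elim blast
  from init.AE_imp_ex[OF this] obtain x where x: "x \<in> X" and ball: "AE w in chain.noise_seq. \<forall>t. contraction N (trajectory N (x, w) t) \<le> z \<and>
      trajectory N (x, w) t \<in> centred_ball N (radius N R0 \<omega> / 2)" by blast
  show ?ball
  proof (rule full[OF centred_ball_sets x])
    fix t show "AE w in chain.noise_seq. orbit (step N) (x, w) t \<in> centred_ball N (radius N R0 \<omega> / 2)"
      using ball by eventually_elim (simp add: trajectory_eq_orbit)
  qed
  have AEX: "AE x in \<pi>. x \<in> X"
    by (rule full[OF X x]) (rule chain.AE_orbit_in_invariant_set[OF X inv x])
  then show ?pos by eventually_elim (rule V0)
  from AEX show ?mix
    by eventually_elim (use mix in \<open>simp add: transition_eq\<close>)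
qed

end

section \<open>The hypothesis space\<close>

text \<open>Turns the supremum and the infimum of the definition into usable bounds: a Lipschitz
  function on [0,R] is bounded, so the supremum is finite, and the infimum of the Lipschitz
  constants is again one, as every difference quotient is a lower bound for them.\<close>

lemma hyp_spaceD:
  assumes "\<psi> \<in> hyp_space R S" "0 \<le> R"
  obtains s l where "0 \<le> s" "l-lipschitz_on {0..R} \<psi>" "\<And>r. r \<in> {0..R} \<Longrightarrow> \<bar>\<psi> r\<bar> \<le> s" "s + l \<le> S"
proof
  obtain C where C: "C-lipschitz_on {0..R} \<psi>" and le: "(SUP r\<in>{0..R}. \<bar>\<psi> r\<bar>) + lip_const R \<psi> \<le> S"
    using assms(1) by (auto simp: hyp_space_def)
  have "\<bar>\<psi> r\<bar> \<le> \<bar>\<psi> 0\<bar> + C * R" if "r \<in> {0..R}" for r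
  proof -
    have "dist (\<psi> r) (\<psi> 0) \<le> C * dist r 0" using that assms(2) by (intro lipschitz_onD[OF C]) auto
    also have "\<dots> \<le> C * R" using that lipschitz_on_nonneg[OF C] by (intro mult_left_mono) auto
    finally show ?thesis by (simp add: dist_real_def)
  qed
  then have bdd: "bdd_above ((\<lambda>r. \<bar>\<psi> r\<bar>) ` {0..R})" by (intro bdd_aboveI2)
  show sup: "\<bar>\<psi> r\<bar> \<le> (SUP r\<in>{0..R}. \<bar>\<psi> r\<bar>)" if "r \<in> {0..R}" for r
    using that bdd by (rule cSUP_upper)
  show "0 \<le> (SUP r\<in>{0..R}. \<bar>\<psi> r\<bar>)" using sup[of 0] assms(2) by simp
  show "(SUP r\<in>{0..R}. \<bar>\<psi> r\<bar>) + lip_const R \<psi> \<le> S" by (rule le)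
  show "(lip_const R \<psi>)-lipschitz_on {0..R} \<psi>"
  proof (rule lipschitz_onI)
    show "0 \<le> lip_const R \<psi>"
      unfolding lip_const_def using C lipschitz_on_nonneg by (intro cInf_greatest) auto
    fix x y assume xy: "x \<in> {0..R}" "y \<in> {0..R}"
    show "dist (\<psi> x) (\<psi> y) \<le> lip_const R \<psi> * dist x y"
    proof (cases "x = y")
      case False
      have "dist (\<psi> x) (\<psi> y) / dist x y \<le> lip_const R \<psi>"
        unfolding lip_const_def
      proof (rule cInf_greatest)
        fix D assume "D \<in> {C. C-lipschitz_on {0..R} \<psi>}"
        then have "dist (\<psi> x) (\<psi> y) \<le> D * dist x y" using xy by (auto dest: lipschitz_onD)
        then show "dist (\<psi> x) (\<psi> y) / dist x y \<le> D" using False by (simp add: divide_le_eq)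
      qed (use C in auto)
      then show ?thesis using False by (simp add: divide_le_eq)
    qed simp
  qed
qed

lemma hyp_spaceI:
  assumes "\<And>r. r \<notin> {0..R} \<Longrightarrow> \<psi> r = 0" "l-lipschitz_on {0..R} \<psi>"
    and "\<And>r. r \<in> {0..R} \<Longrightarrow> \<bar>\<psi> r\<bar> \<le> s" "s + l \<le> S" "0 \<le> R"
  shows "\<psi> \<in> hyp_space R S"
proof -
  have "(SUP r\<in>{0..R}. \<bar>\<psi> r\<bar>) \<le> s" using assms(3,5) by (intro cSUP_least) auto
  moreover have "lip_const R \<psi> \<le> l"
    unfolding lip_const_def using assms(2) lipschitz_on_nonneg
    by (intro cInf_lower bdd_belowI[of _ 0]) auto
  ultimately show ?thesis using assms(1,2,4) by (auto simp: hyp_space_def)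
qed

text \<open>A difference of two hypotheses can be twice as large and leave the space; half of it
  stays inside, and coercivity is applied to that half.\<close>

lemma hyp_space_diff:
  assumes "\<psi> \<in> hyp_space R S" "\<psi>' \<in> hyp_space R S" "0 \<le> R"
  shows "(2 * S)-lipschitz_on {0..R} (\<lambda>r. \<psi> r - \<psi>' r)"
    and "r \<in> {0..R} \<Longrightarrow> \<bar>\<psi> r - \<psi>' r\<bar> \<le> 2 * S"
    and "(\<lambda>r. (1 / 2) * (\<psi> r - \<psi>' r)) \<in> hyp_space R S"
    and "0 \<le> S"
proof -
  obtain s l where 1: "0 \<le> s" "l-lipschitz_on {0..R} \<psi>" "\<And>r. r \<in> {0..R} \<Longrightarrow> \<bar>\<psi> r\<bar> \<le> s" "s + l \<le> S"
    using hyp_spaceD[OF assms(1,3)] by blast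
  obtain s' l' where 2: "0 \<le> s'" "l'-lipschitz_on {0..R} \<psi>'" "\<And>r. r \<in> {0..R} \<Longrightarrow> \<bar>\<psi>' r\<bar> \<le> s'" "s' + l' \<le> S"
    using hyp_spaceD[OF assms(2,3)] by blast
  have nn: "0 \<le> l" "0 \<le> l'" using 1 2 lipschitz_on_nonneg by blast+
  have d: "(l + l')-lipschitz_on {0..R} (\<lambda>r. \<psi> r - \<psi>' r)" by (rule lipschitz_on_diff[OF 1(2) 2(2)])
  show "(2 * S)-lipschitz_on {0..R} (\<lambda>r. \<psi> r - \<psi>' r)"
    using d by (rule lipschitz_on_le) (use 1 2 in auto)
  have b: "\<bar>\<psi> r - \<psi>' r\<bar> \<le> s + s'" if "r \<in> {0..R}" for r
    using 1(3)[OF that] 2(3)[OF that] by linarith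
  show "\<bar>\<psi> r - \<psi>' r\<bar> \<le> 2 * S" if "r \<in> {0..R}" using b[OF that] 1 2 nn by linarith
  show "0 \<le> S" using 1 nn by linarith
  show "(\<lambda>r. (1 / 2) * (\<psi> r - \<psi>' r)) \<in> hyp_space R S"
  proof (rule hyp_spaceI)
    show "(1 / 2) * (\<psi> r - \<psi>' r) = 0" if "r \<notin> {0..R}" for r
      using that assms(1,2) by (auto simp: hyp_space_def)
    show "((1 / 2) * (l + l'))-lipschitz_on {0..R} (\<lambda>r. (1 / 2) * (\<psi> r - \<psi>' r))"
      using lipschitz_on_cmult_real[OF d, of "1 / 2"] by simp
    show "\<bar>(1 / 2) * (\<psi> r - \<psi>' r)\<bar> \<le> (1 / 2) * (s + s')" if "r \<in> {0..R}" for r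
      using b[OF that] by simp
    show "(1 / 2) * (s + s') + (1 / 2) * (l + l') \<le> S" using add_mono[OF 1(4) 2(4)] by (simp add: field_simps)
  qed (rule assms)
qed

section \<open>The law of the distances, the weighted norm and coercivity\<close>

lemma space_rho: "space (rho N \<pi> R) = {0..R}"
  unfolding rho_def using sets.space_closed[of "restrict_space borel {0..R}"]
  by (intro space_measure_of) (simp add: space_restrict_space)

lemma sets_rho: "sets (rho N \<pi> R) = sets (restrict_space borel {0..R})"
proof -
  have "sets (rho N \<pi> R) = sigma_sets {0..R} (sets (restrict_space borel {0..R}))"
    unfolding rho_def using sets.space_closed[of "restrict_space borel {0..R}"]
    by (intro sets_measure_of) (simp add: space_restrict_space)
  also have "\<dots> = sets (restrict_space borel {0..R})"
    using sets.sigma_sets_eq[of "restrict_space borel {0..R}"] by (simp add: space_restrict_space)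
  finally show ?thesis .
qed

text \<open>The set function behind \<open>rho\<close> is a finite multiple of a finite sum of
  probabilities, and \<open>measure_of\<close> yields its value or zero. Finiteness is used for the
  measurability of integrals with a parameter.\<close>

lemma finite_measure_rho:
  assumes "prob_space \<pi>"
  shows "finite_measure (rho N \<pi> R)"
proof
  have fin: "finite (neighbours N i)" for i by (simp add: neighbours_def)
  have F: "emeasure \<pi> A \<noteq> \<top>" for A
    using finite_measure.emeasure_finite[OF prob_space.finite_measure[OF assms]] by simp
  show "emeasure (rho N \<pi> R) (space (rho N \<pi> R)) \<noteq> \<infinity>"
    unfolding space_rho unfolding rho_def emeasure_measure_of_conv
    by (auto simp: ennreal_mult_eq_top_iff fin F)
qed

lemma L2_norm_cong:
  assumes "\<And>r. r \<in> {0..R} \<Longrightarrow> \<psi> r = \<psi>' r"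
  shows "L2_norm N \<pi> R \<psi> = L2_norm N \<pi> R \<psi>'"
  unfolding L2_norm_def using assms
  by (intro arg_cong[where f = sqrt] Bochner_Integration.integral_cong) (auto simp: space_rho)

lemma L2_norm_nonneg: "0 \<le> L2_norm N \<pi> R \<psi>"
  by (simp add: L2_norm_def)

lemma L2_norm_scale: "L2_norm N \<pi> R (\<lambda>r. c * \<psi> r) = \<bar>c\<bar> * L2_norm N \<pi> R \<psi>"
proof -
  have "(\<integral>r. \<bar>c * \<psi> r * r\<bar>\<^sup>2 \<partial>rho N \<pi> R) = (\<integral>r. c\<^sup>2 * \<bar>\<psi> r * r\<bar>\<^sup>2 \<partial>rho N \<pi> R)"
    by (intro Bochner_Integration.integral_cong) (auto simp: power_mult_distrib)
  then show ?thesis by (simp add: L2_norm_def real_sqrt_mult)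
qed

text \<open>The infimum is at most the quotient at \<psi>, and the factor 1 /
  \<open>num_edges N\<close> only lowers it. If the norm of \<psi> vanishes, so does the left
  side.\<close>

lemma coercivity_const_le:
  assumes "0 < coercivity_const N \<pi> R S" "\<psi> \<in> hyp_space R S"
  shows "coercivity_const N \<pi> R S * (L2_norm N \<pi> R \<psi>)\<^sup>2 \<le> (\<integral>x. (state_norm N (force N \<psi> x))\<^sup>2 \<partial>\<pi>)"
proof (cases "L2_norm N \<pi> R \<psi> = 0")
  case False
  define q where "q \<psi> = (\<integral>x. (state_norm N (force N \<psi> x))\<^sup>2 \<partial>\<pi>) / (L2_norm N \<pi> R \<psi>)\<^sup>2" for \<psi>
  have q: "0 \<le> q \<psi>" for \<psi> unfolding q_def by (intro divide_nonneg_nonneg Bochner_Integration.integral_nonneg) auto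
  have e: "num_edges N \<noteq> 0" by (rule notI) (use assms(1) in \<open>simp add: coercivity_const_def\<close>)
  have "(INF \<psi>\<in>{\<psi> \<in> hyp_space R S. L2_norm N \<pi> R \<psi> \<noteq> 0}. q \<psi>) \<le> q \<psi>"
    using q assms(2) False by (intro cINF_lower bdd_belowI2[of _ 0]) auto
  then have "coercivity_const N \<pi> R S \<le> 1 / real (num_edges N) * q \<psi>"
    unfolding coercivity_const_def q_def[symmetric] by (intro mult_left_mono) auto
  also have "\<dots> \<le> q \<psi>" using e q[of \<psi>] by (intro mult_left_le_one_le) auto
  finally show ?thesis using False unfolding q_def by (simp add: le_divide_eq)
qed (simp add: Bochner_Integration.integral_nonneg)

text \<open>Both sides are quadratic in the function, so the factor 1/4 that results from halving
  the difference cancels.\<close>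

lemma coercivity_diff:
  assumes "0 < coercivity_const N \<pi> R S" "\<psi> \<in> hyp_space R S" "\<psi>' \<in> hyp_space R S" "0 \<le> R"
  shows "coercivity_const N \<pi> R S * (L2_norm N \<pi> R (\<lambda>r. \<psi> r - \<psi>' r))\<^sup>2
    \<le> (\<integral>x. (state_norm N (force N (\<lambda>r. \<psi> r - \<psi>' r) x))\<^sup>2 \<partial>\<pi>)"
proof -
  let ?\<delta> = "\<lambda>r. \<psi> r - \<psi>' r"
  have *: "state_norm N (force N (\<lambda>r. (1 / 2) * ?\<delta> r) x) = (1 / 2) * state_norm N (force N ?\<delta> x)" for x
  proof -
    have "state_norm N (force N (\<lambda>r. (1 / 2) * ?\<delta> r) x) = state_norm N (\<lambda>i a. (1 / 2) * force N ?\<delta> x i a)"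
      by (rule state_norm_cong) (rule force_scale)
    then show ?thesis unfolding state_norm_scale by simp
  qed
  have "(\<integral>x. (state_norm N (force N (\<lambda>r. (1 / 2) * ?\<delta> r) x))\<^sup>2 \<partial>\<pi>) = (1 / 4) * (\<integral>x. (state_norm N (force N ?\<delta> x))\<^sup>2 \<partial>\<pi>)"
    unfolding * power_mult_distrib by (simp add: power2_eq_square)
  with coercivity_const_le[OF assms(1) hyp_space_diff(3)[OF assms(2-4)]]
  show ?thesis unfolding L2_norm_scale by (simp add: power_mult_distrib power2_eq_square)
qed

section \<open>The least squares estimator\<close>

locale stationary_network = contractive_network +
  fixes \<pi> V \<eta>
  assumes ergodic: "geometrically_ergodic N \<pi> V \<eta>"
begin

lemma invariant: "invariant_law N \<pi>"
  using ergodic by (simp add: geometrically_ergodic_def)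

sublocale st: stationary_chain "noise_measure N" "state_space N" "step N" \<pi>
  by (rule invariant_law_stationary[OF invariant])

abbreviation "R \<equiv> radius N R0 \<omega>"
abbreviation "state_ball \<equiv> centred_ball N (R / 2)"
abbreviation "noise_ball \<equiv> centred_ball N \<omega>"

text \<open>On the ball the force of \<psi> has norm at most b times the supremum of
  |\<psi>|.\<close>

definition b :: real where "b = (real n)\<^sup>2 * K * R"

lemma b_nonneg: "0 \<le> b"
  using K_nonneg radius_nonneg by (simp add: b_def)

lemma sample_measure_eq: "sample_measure N \<pi> = st.paths"
  by (simp add: sample_measure_def noise_seq_measure_def)

lemma force_norm_le:
  assumes x: "x \<in> state_ball" and s: "\<And>r. r \<in> {0..R} \<Longrightarrow> \<bar>\<psi> r\<bar> \<le> s"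
  shows "state_norm N (force N \<psi> x) \<le> b * s"
  unfolding b_def
proof (rule state_norm_force_le)
  fix i j assume ij: "i < n" "j < n"
  note r = node_dist_le_radius[OF x ij]
  show "\<bar>\<psi> (node_dist N x i j)\<bar> \<le> s" using r by (rule s)
  show "node_dist N x i j \<le> R" using r by simp
qed (simp add: weight_nonneg weight_le)

text \<open>The indicators, almost surely 1 along a stationary path, make the summands bounded
  everywhere, as the second moment estimates demand.\<close>

definition noise_term :: "(real \<Rightarrow> real) \<Rightarrow> state \<Rightarrow> state \<Rightarrow> real" where
  "noise_term g x w = indicator state_ball x * (indicator noise_ball w * state_inner N w (force N g x))"

text \<open>Polarised, because the squared force of a combination of steps expands into products of
  two different steps.\<close>

definition energy_term :: "(real \<Rightarrow> real) \<Rightarrow> (real \<Rightarrow> real) \<Rightarrow> state \<Rightarrow> real" where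
  "energy_term g g' x = indicator state_ball x * state_inner N (force N g x) (force N g' x)"

definition noise_sum :: "nat \<Rightarrow> (real \<Rightarrow> real) \<Rightarrow> sample \<Rightarrow> real" where
  "noise_sum T g s = (\<Sum>t=1..T. noise_term g (orbit (step N) s t) (snd s t))"

definition energy_sum :: "nat \<Rightarrow> (real \<Rightarrow> real) \<Rightarrow> (real \<Rightarrow> real) \<Rightarrow> sample \<Rightarrow> real" where
  "energy_sum T g g' s = (\<Sum>t=1..T. energy_term g g' (orbit (step N) s t) - (\<integral>x. energy_term g g' x \<partial>\<pi>))"

lemma noise_sum_expectation:
  assumes g[measurable]: "g \<in> borel_measurable borel" and g1: "\<And>r. \<bar>g r\<bar> \<le> 1"
  shows "integrable st.paths (noise_sum T g)"
    and "(\<integral>s. \<bar>noise_sum T g s\<bar> \<partial>st.paths) \<le> sqrt (real T * (2 * (\<omega> * b)\<^sup>2))"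
proof -
  have m: "case_prod (noise_term g) \<in> borel_measurable (state_space N \<Otimes>\<^sub>M noise_measure N)"
  proof -
    have [measurable]: "snd \<in> state_space N \<Otimes>\<^sub>M noise_measure N \<rightarrow>\<^sub>M state_space N"
      unfolding measurable_noise_measure(2)[symmetric] by (rule measurable_snd)
    show ?thesis unfolding noise_term_def split_beta' by measurable
  qed
  have bound: "\<bar>noise_term g x w\<bar> \<le> \<omega> * b" for x w
  proof (cases "x \<in> state_ball \<and> w \<in> noise_ball")
    case True
    then have "\<bar>state_inner N w (force N g x)\<bar> \<le> state_norm N w * state_norm N (force N g x)"
      by (intro abs_state_inner_le)
    also have "\<dots> \<le> \<omega> * (b * 1)"
      using True g1 \<omega>_nonneg state_norm_nonneg by (intro mult_mono force_norm_le) (auto simp: centred_ball_def[of N \<omega>])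
    finally show ?thesis using True by (simp add: noise_term_def)
  qed (use \<omega>_nonneg b_nonneg in \<open>auto simp: noise_term_def\<close>)
  have zero: "(\<integral>w. noise_term g x w \<partial>noise_measure N) = 0" for x
  proof -
    \<comment> \<open>The noise lies in its ball almost surely, so cutting it off there does not
      disturb the mean.\<close>
    have "(\<integral>w. noise_term g x w \<partial>noise_measure N) = (\<integral>w. indicator state_ball x * state_inner N w (force N g x) \<partial>noise_measure N)"
    proof (rule integral_cong_AE)
      have [measurable]: "(\<lambda>w. state_inner N w y) \<in> borel_measurable (state_space N)" for y
        unfolding state_inner_def by measurable
      show "noise_term g x \<in> borel_measurable (noise_measure N)"
        "(\<lambda>w. indicator state_ball x * state_inner N w (force N g x)) \<in> borel_measurable (noise_measure N)"
        unfolding noise_term_def measurable_noise_measure by measurable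
      show "AE w in noise_measure N. noise_term g x w = indicator state_ball x * state_inner N w (force N g x)"
        using noise_AE by eventually_elim (simp add: noise_term_def)
    qed
    then show ?thesis by (simp add: noise_inner_mean)
  qed
  note M = st.martingale_second_moment[OF m bound zero, of T, folded noise_sum_def]
  show "integrable st.paths (noise_sum T g)" "(\<integral>s. \<bar>noise_sum T g s\<bar> \<partial>st.paths) \<le> sqrt (real T * (2 * (\<omega> * b)\<^sup>2))"
    using st.paths.expectation_abs_le_sqrt[OF M] by simp_all
qed

lemma energy_term_bound:
  assumes g1: "\<And>r. \<bar>g r\<bar> \<le> 1" and g1': "\<And>r. \<bar>g' r\<bar> \<le> 1"
  shows "\<bar>energy_term g g' x\<bar> \<le> b\<^sup>2"
proof (cases "x \<in> state_ball")
  case True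
  have "\<bar>state_inner N (force N g x) (force N g' x)\<bar> \<le> state_norm N (force N g x) * state_norm N (force N g' x)"
    by (rule abs_state_inner_le)
  also have "\<dots> \<le> (b * 1) * (b * 1)"
    using True g1 g1' b_nonneg state_norm_nonneg by (intro mult_mono force_norm_le) auto
  finally show ?thesis using True by (simp add: energy_term_def power2_eq_square)
qed (simp add: energy_term_def)

lemma energy_term_measurable:
  assumes [measurable]: "g \<in> borel_measurable borel" "g' \<in> borel_measurable borel"
  shows "energy_term g g' \<in> borel_measurable (state_space N)"
  unfolding energy_term_def by measurable

lemma energy_term_integrable:
  assumes "g \<in> borel_measurable borel" "g' \<in> borel_measurable borel" "\<And>r. \<bar>g r\<bar> \<le> 1" "\<And>r. \<bar>g' r\<bar> \<le> 1"
  shows "integrable \<pi> (energy_term g g')"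
  using energy_term_bound[OF assms(3,4)] energy_term_measurable[OF assms(1,2)]
  by (intro st.init.integrable_const_bound[where B = "b\<^sup>2"]) (auto simp: st.measurable_init)

lemma energy_sum_expectation:
  assumes g: "g \<in> borel_measurable borel" "g' \<in> borel_measurable borel" and g1: "\<And>r. \<bar>g r\<bar> \<le> 1" "\<And>r. \<bar>g' r\<bar> \<le> 1"
  shows "integrable st.paths (energy_sum T g g')"
    and "(\<integral>s. \<bar>energy_sum T g g' s\<bar> \<partial>st.paths) \<le> sqrt (real T * (8 * (b\<^sup>2)\<^sup>2 * (1 + (\<integral>x. V x \<partial>\<pi>)) / (1 - \<eta>)))"
proof -
  have \<eta>: "0 \<le> \<eta>" "\<eta> < 1" and V: "integrable \<pi> V"
    using ergodic by (auto simp: geometrically_ergodic_def)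
  note M = st.ergodic_second_moment[OF energy_term_measurable[OF g] energy_term_bound[OF g1] \<eta> V
      geometric_ergodicity_AE(2,3)[OF ergodic], of T, folded energy_sum_def]
  show "integrable st.paths (energy_sum T g g')"
    "(\<integral>s. \<bar>energy_sum T g g' s\<bar> \<partial>st.paths) \<le> sqrt (real T * (8 * (b\<^sup>2)\<^sup>2 * (1 + (\<integral>x. V x \<partial>\<pi>)) / (1 - \<eta>)))"
    using st.paths.expectation_abs_le_sqrt[OF M] by simp_all
qed

text \<open>On the ball all distances are at most R, so the coupling may be replaced by its
  extension by zero; the observed velocity is its force plus the noise.\<close>

lemma residual:
  assumes x: "trajectory N s t \<in> state_ball"
  shows "(state_norm N (\<lambda>i a. (trajectory N s (Suc t) i a - trajectory N s t i a) / h - force N \<psi> (trajectory N s t) i a))\<^sup>2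
    = (state_norm N (\<lambda>i a. snd s t i a - force N (\<lambda>r. \<psi> r - extend_zero R (coupling N) r) (trajectory N s t) i a))\<^sup>2"
proof -
  let ?x = "trajectory N s t"
  have F: "force N (coupling N) ?x = force N (extend_zero R (coupling N)) ?x"
    by (rule force_cong) (use node_dist_le_radius[OF x] in \<open>simp add: extend_zero_def\<close>)
  have "(trajectory N s (Suc t) i a - ?x i a) / h - force N \<psi> ?x i a =
      snd s t i a - force N (\<lambda>r. \<psi> r - extend_zero R (coupling N) r) ?x i a" if "i < n" "a < d" for i a
    using that step_size by (simp add: force_diff F[symmetric] step_def add_divide_distrib)
  then show ?thesis by (intro arg_cong[where f = "\<lambda>u. u\<^sup>2"] state_norm_cong)
qed

text \<open>The residual of the coupling function itself is the pure noise; after expansion of the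
  squares the squared norms of the noise cancel.\<close>

lemma empirical_energy_le:
  assumes T: "1 \<le> T" and e: "num_edges N \<noteq> 0"
    and x: "\<And>t. trajectory N s t \<in> state_ball"
    and min: "error_functional N T (trajectory N s) \<psi> \<le> error_functional N T (trajectory N s) (extend_zero R (coupling N))"
  defines "\<delta> \<equiv> \<lambda>r. \<psi> r - extend_zero R (coupling N) r"
  shows "(\<Sum>t=1..T. (state_norm N (force N \<delta> (trajectory N s t)))\<^sup>2)
    \<le> 2 * (\<Sum>t=1..T. state_inner N (snd s t) (force N \<delta> (trajectory N s t)))"
proof -
  have pos: "0 < 1 / (real T * real (num_edges N))" using T e by simp
  have "(\<Sum>t=1..T. (state_norm N (\<lambda>i a. snd s t i a - force N \<delta> (trajectory N s t) i a))\<^sup>2)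
    \<le> (\<Sum>t=1..T. (state_norm N (\<lambda>i a. snd s t i a - force N (\<lambda>r. 0) (trajectory N s t) i a))\<^sup>2)"
    using min unfolding error_functional_def residual[OF x] \<delta>_def
    by (simp only: mult_le_cancel_left_pos[OF pos] diff_self)
  also have "\<dots> = (\<Sum>t=1..T. (state_norm N (snd s t))\<^sup>2)"
    by (intro sum.cong refl arg_cong[where f = "\<lambda>u. u\<^sup>2"] state_norm_cong) (simp add: force_apply)
  finally show ?thesis
    unfolding state_norm_diff_sq by (simp add: sum.distrib sum_subtractf sum_distrib_left)
qed

text \<open>Bounds the grid coefficients of all differences of two hypotheses at once, since these
  have values and Lipschitz constant at most 2S.\<close>

definition grid_weight :: "real \<Rightarrow> nat \<Rightarrow> nat \<Rightarrow> real" where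
  "grid_weight S T k = (if k = 0 then 2 * S else 2 * S * R / real T)"

lemma grid_weight_nonneg: "0 \<le> S \<Longrightarrow> 0 \<le> grid_weight S T k"
  using radius_nonneg by (simp add: grid_weight_def)

lemma sum_grid_weight: "1 \<le> T \<Longrightarrow> (\<Sum>k\<le>T. grid_weight S T k) = 2 * S * (1 + R)"
  by (simp add: grid_weight_def sum.atMost_shift algebra_simps)

text \<open>The force of a function is replaced by a combination of the forces of the steps
  \<open>1\<^bsub>r \<ge> kR/T\<^esub>\<close>. The absolute coefficients have a sum bounded independently of \<open>T\<close>, which
  reduces suprema over the hypothesis space to finitely many fixed functions.\<close>

lemma grid_force_approx:
  assumes T: "1 \<le> T" and S: "0 \<le> S" and lip: "(2 * S)-lipschitz_on {0..R} \<delta>"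
    and bd: "\<forall>r\<in>{0..R}. \<bar>\<delta> r\<bar> \<le> 2 * S" and x: "x \<in> state_ball"
  defines "c \<equiv> grid_coeff R T \<delta>" and "a \<equiv> 2 * S * (1 + R)" and "\<epsilon> \<equiv> 2 * S * R / real T"
  shows "\<bar>state_inner N w (force N \<delta> x) - (\<Sum>k\<le>T. c k * state_inner N w (force N (grid_step R T k) x))\<bar>
      \<le> state_norm N w * (b * \<epsilon>)"
    and "\<bar>(state_norm N (force N \<delta> x))\<^sup>2 -
      (\<Sum>k\<le>T. \<Sum>l\<le>T. c k * c l * state_inner N (force N (grid_step R T k) x) (force N (grid_step R T l) x))\<bar>
      \<le> b * \<epsilon> * (2 * b * a)"
    and "\<And>k. k \<le> T \<Longrightarrow> \<bar>c k\<bar> \<le> grid_weight S T k"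
proof -
  note bd = bd[rule_format]
  have T0: "0 < T" using T by simp
  have ck: "\<bar>c k\<bar> \<le> grid_weight S T k" if "k \<le> T" for k
    unfolding c_def grid_weight_def using bd[of 0] radius_nonneg
    by (intro abs_grid_coeff_le[OF lip T0 radius_nonneg _ that]) simp
  then show "\<And>k. k \<le> T \<Longrightarrow> \<bar>c k\<bar> \<le> grid_weight S T k" .
  let ?g = "\<lambda>r. \<Sum>k\<le>T. c k * grid_step R T k r"
  let ?F = "force N \<delta> x" and ?G = "force N ?g x"
  have approx: "\<bar>\<delta> r - ?g r\<bar> \<le> \<epsilon>" if "r \<in> {0..R}" for r
    unfolding c_def \<epsilon>_def using grid_approx[OF lip T0 that] .
  have a1: "2 * S \<le> a" using S radius_nonneg by (simp add: a_def algebra_simps)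
  have ga: "\<bar>?g r\<bar> \<le> a" for r
  proof -
    have "\<bar>?g r\<bar> \<le> (\<Sum>k\<le>T. \<bar>c k * grid_step R T k r\<bar>)" by (rule sum_abs)
    also have "\<dots> \<le> (\<Sum>k\<le>T. grid_weight S T k * 1)"
      unfolding abs_mult using ck abs_grid_step_le grid_weight_nonneg[OF S] by (intro sum_mono mult_mono) auto
    finally show ?thesis using sum_grid_weight[OF T] by (simp add: a_def)
  qed
  have G: "?G i k = (\<Sum>l\<le>T. c l * force N (grid_step R T l) x i k)" if "i < n" "k < d" for i k
    using that by (rule force_sum)
  have GG: "state_inner N w ?G = (\<Sum>k\<le>T. c k * state_inner N w (force N (grid_step R T k) x))" for w
    unfolding state_inner_sum_right[symmetric] using G by (intro state_inner_cong) auto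
  have D: "state_norm N (\<lambda>i k. ?F i k - ?G i k) \<le> b * \<epsilon>"
  proof -
    have "state_norm N (\<lambda>i k. ?F i k - ?G i k) = state_norm N (force N (\<lambda>r. \<delta> r - ?g r) x)"
      by (rule state_norm_cong) (rule force_diff[symmetric])
    also have "\<dots> \<le> b * \<epsilon>" using x approx by (rule force_norm_le)
    finally show ?thesis .
  qed
  have "state_inner N w ?F - state_inner N w ?G = state_inner N w (\<lambda>i k. ?F i k - ?G i k)"
    by (simp add: state_inner_def sum_subtractf[symmetric] algebra_simps)
  then have "\<bar>state_inner N w ?F - state_inner N w ?G\<bar> \<le> state_norm N w * state_norm N (\<lambda>i k. ?F i k - ?G i k)"
    using abs_state_inner_le by simp
  also have "\<dots> \<le> state_norm N w * (b * \<epsilon>)" using D state_norm_nonneg by (rule mult_left_mono)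
  finally show "\<bar>state_inner N w ?F - (\<Sum>k\<le>T. c k * state_inner N w (force N (grid_step R T k) x))\<bar>
      \<le> state_norm N w * (b * \<epsilon>)" unfolding GG .
  \<comment> \<open>The difference of the two energies is the inner product of F - G, which is of
    order 1/T, with F + G, for which boundedness suffices.\<close>
  have "state_norm N (\<lambda>i k. ?F i k + ?G i k) \<le> state_norm N ?F + state_norm N ?G" by (rule state_norm_triangle)
  also have "\<dots> \<le> b * a + b * a"
    by (intro add_mono force_norm_le[OF x] order_trans[OF bd a1] ga)
  finally have P: "state_norm N (\<lambda>i k. ?F i k + ?G i k) \<le> 2 * b * a" by (simp add: mult.commute)
  have "\<bar>state_inner N ?F ?F - state_inner N ?G ?G\<bar> \<le> state_norm N (\<lambda>i k. ?F i k - ?G i k) * state_norm N (\<lambda>i k. ?F i k + ?G i k)"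
    unfolding state_inner_diff_sq by (rule abs_state_inner_le)
  also have "\<dots> \<le> b * \<epsilon> * (2 * b * a)"
    by (rule mult_mono[OF D P order_trans[OF state_norm_nonneg D] state_norm_nonneg])
  also have "state_inner N ?G ?G = (\<Sum>k\<le>T. c k * state_inner N (force N (grid_step R T k) x) ?G)"
    unfolding GG[of ?G] by (intro sum.cong refl arg_cong[where f = "\<lambda>u. c _ * u"] state_inner_comm)
  also have "\<dots> = (\<Sum>k\<le>T. \<Sum>l\<le>T. c k * c l * state_inner N (force N (grid_step R T k) x) (force N (grid_step R T l) x))"
    unfolding GG by (simp add: sum_distrib_left mult.assoc)
  finally show "\<bar>(state_norm N ?F)\<^sup>2 -
      (\<Sum>k\<le>T. \<Sum>l\<le>T. c k * c l * state_inner N (force N (grid_step R T k) x) (force N (grid_step R T l) x))\<bar>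
      \<le> b * \<epsilon> * (2 * b * a)" unfolding state_norm_sq .
qed

text \<open>Dominates the fluctuations for all differences of hypotheses simultaneously. It does not
  mention the estimator, so its expectation can be taken term by term.\<close>

definition deviation :: "real \<Rightarrow> nat \<Rightarrow> sample \<Rightarrow> real" where
  "deviation S T s =
    2 * (\<Sum>k\<le>T. grid_weight S T k * \<bar>noise_sum T (grid_step R T k) s\<bar>) +
    (\<Sum>k\<le>T. \<Sum>l\<le>T. grid_weight S T k * grid_weight S T l * \<bar>energy_sum T (grid_step R T k) (grid_step R T l) s\<bar>)"

text \<open>The path is fixed, and with it \<psi>, so the integral against \<pi> concerns a
  deterministic function. Expansion into steps lets the stationary mean be exchanged for the time
  average at the cost of \<open>energy_sum\<close>. The energy is discretised twice, on the way into
  the steps and on the way back, and each time the total error T E is bounded in T.\<close>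

lemma pathwise_error_bound:
  assumes T: "1 \<le> T" and e: "num_edges N \<noteq> 0"
    and S: "0 \<le> S" and lip: "(2 * S)-lipschitz_on {0..R} (\<lambda>r. \<psi> r - extend_zero R (coupling N) r)"
    and bd: "\<forall>r\<in>{0..R}. \<bar>\<psi> r - extend_zero R (coupling N) r\<bar> \<le> 2 * S"
    and x: "\<And>t. trajectory N s t \<in> state_ball" and w: "\<And>t. snd s t \<in> noise_ball"
    and min: "error_functional N T (trajectory N s) \<psi> \<le> error_functional N T (trajectory N s) (extend_zero R (coupling N))"
  shows "real T * (\<integral>x. (state_norm N (force N (\<lambda>r. \<psi> r - extend_zero R (coupling N) r) x))\<^sup>2 \<partial>\<pi>)
    \<le> deviation S T s + 2 * \<omega> * b * (2 * S * R) + 4 * b\<^sup>2 * (2 * S * (1 + R)) * (2 * S * R)"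
proof -
  define \<delta> where "\<delta> = (\<lambda>r. \<psi> r - extend_zero R (coupling N) r)"
  define \<epsilon> where "\<epsilon> = 2 * S * R / real T"
  define a where "a = 2 * S * (1 + R)"
  define E where "E = b * \<epsilon> * (2 * b * a)"
  let ?c = "grid_coeff R T \<delta>" and ?f = "\<lambda>k. force N (grid_step R T k)"
  let ?x = "trajectory N s"
  let ?e = "\<lambda>k l. energy_term (grid_step R T k) (grid_step R T l)"
  have \<epsilon>0: "0 \<le> \<epsilon>" and a0: "0 \<le> a" using S radius_nonneg by (auto simp: \<epsilon>_def a_def)
  have E0: "0 \<le> E" using \<epsilon>0 a0 b_nonneg by (simp add: E_def)
  have T\<epsilon>: "real T * \<epsilon> = 2 * S * R" using T by (simp add: \<epsilon>_def)
  note G = grid_force_approx[OF T S lip bd, folded \<delta>_def, folded a_def \<epsilon>_def E_def]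
  \<comment> \<open>The bound on the coefficients does not involve the state; time 0 only supplies a
    point of the ball.\<close>
  have ck: "\<And>k. k \<le> T \<Longrightarrow> \<bar>?c k\<bar> \<le> grid_weight S T k" using G(3)[OF x[of 0]] .
  have noise: "(\<Sum>t=1..T. state_inner N (snd s t) (force N \<delta> (?x t)))
    \<le> (\<Sum>k\<le>T. grid_weight S T k * \<bar>noise_sum T (grid_step R T k) s\<bar>) + \<omega> * b * (2 * S * R)"
  proof -
    have "(\<Sum>t=1..T. state_inner N (snd s t) (force N \<delta> (?x t))) \<le>
      (\<Sum>t=1..T. (\<Sum>k\<le>T. ?c k * state_inner N (snd s t) (?f k (?x t))) + \<omega> * (b * \<epsilon>))"
    proof (rule sum_mono)
      fix t
      have "state_norm N (snd s t) * (b * \<epsilon>) \<le> \<omega> * (b * \<epsilon>)"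
        using w[of t] b_nonneg \<epsilon>0 by (intro mult_right_mono) (auto simp: centred_ball_def)
      with G(1)[OF x[of t], of "snd s t"]
      show "state_inner N (snd s t) (force N \<delta> (?x t)) \<le> (\<Sum>k\<le>T. ?c k * state_inner N (snd s t) (?f k (?x t))) + \<omega> * (b * \<epsilon>)"
        by (simp add: abs_le_iff)
    qed
    also have "\<dots> = (\<Sum>t=1..T. \<Sum>k\<le>T. ?c k * state_inner N (snd s t) (?f k (?x t))) + \<omega> * b * (real T * \<epsilon>)"
      by (simp add: sum.distrib)
    also have "(\<Sum>t=1..T. \<Sum>k\<le>T. ?c k * state_inner N (snd s t) (?f k (?x t))) = (\<Sum>k\<le>T. ?c k * noise_sum T (grid_step R T k) s)"
      unfolding noise_sum_def noise_term_def sum_distrib_left using x w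
      by (subst sum.swap) (simp add: trajectory_eq_orbit)
    also have "\<dots> \<le> (\<Sum>k\<le>T. grid_weight S T k * \<bar>noise_sum T (grid_step R T k) s\<bar>)"
    proof (rule sum_mono)
      fix k assume "k \<in> {..T}"
      then have "\<bar>?c k\<bar> * \<bar>noise_sum T (grid_step R T k) s\<bar> \<le> grid_weight S T k * \<bar>noise_sum T (grid_step R T k) s\<bar>"
        by (intro mult_right_mono ck) auto
      then show "?c k * noise_sum T (grid_step R T k) s \<le> grid_weight S T k * \<bar>noise_sum T (grid_step R T k) s\<bar>"
        unfolding abs_mult[symmetric] by (rule order_trans[OF abs_ge_self])
    qed
    finally show ?thesis by (simp add: T\<epsilon>)
  qed
  have meas: "integrable \<pi> (?e k l)" for k l
    by (intro energy_term_integrable grid_step_measurable abs_grid_step_le)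
  have e_eq: "(\<Sum>k\<le>T. \<Sum>l\<le>T. ?c k * ?c l * state_inner N (?f k y) (?f l y)) = (\<Sum>k\<le>T. \<Sum>l\<le>T. ?c k * ?c l * ?e k l y)"
    if "y \<in> state_ball" for y
    using that by (simp add: energy_term_def)
  have up: "(state_norm N (force N \<delta> y))\<^sup>2 \<le> (\<Sum>k\<le>T. \<Sum>l\<le>T. ?c k * ?c l * ?e k l y) + E" if "y \<in> state_ball" for y
    using G(2)[OF that] unfolding e_eq[OF that] E_def by (simp add: abs_le_iff)
  have lo: "(\<Sum>k\<le>T. \<Sum>l\<le>T. ?c k * ?c l * ?e k l y) \<le> (state_norm N (force N \<delta> y))\<^sup>2 + E" if "y \<in> state_ball" for y
    using G(2)[OF that] unfolding e_eq[OF that] E_def by (simp add: abs_le_iff)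
  have "(\<integral>y. (state_norm N (force N \<delta> y))\<^sup>2 \<partial>\<pi>) \<le> (\<integral>y. (\<Sum>k\<le>T. \<Sum>l\<le>T. ?c k * ?c l * ?e k l y) + E \<partial>\<pi>)"
  proof (rule integral_mono_AE')
    show "integrable \<pi> (\<lambda>y. (\<Sum>k\<le>T. \<Sum>l\<le>T. ?c k * ?c l * ?e k l y) + E)"
      using meas by (intro Bochner_Integration.integrable_add Bochner_Integration.integrable_sum integrable_mult_right) auto
    show "AE y in \<pi>. (state_norm N (force N \<delta> y))\<^sup>2 \<le> (\<Sum>k\<le>T. \<Sum>l\<le>T. ?c k * ?c l * ?e k l y) + E"
      using geometric_ergodicity_AE(1)[OF ergodic] by eventually_elim (rule up)
    show "AE y in \<pi>. 0 \<le> (\<Sum>k\<le>T. \<Sum>l\<le>T. ?c k * ?c l * ?e k l y) + E"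
      using geometric_ergodicity_AE(1)[OF ergodic] by eventually_elim (rule order_trans[OF zero_le_power2 up])
  qed
  also have "\<dots> = (\<Sum>k\<le>T. \<Sum>l\<le>T. ?c k * ?c l * (\<integral>y. ?e k l y \<partial>\<pi>)) + E"
    using meas by (simp add: Bochner_Integration.integral_sum st.init.prob_space)
  finally have "real T * (\<integral>y. (state_norm N (force N \<delta> y))\<^sup>2 \<partial>\<pi>) \<le>
    real T * ((\<Sum>k\<le>T. \<Sum>l\<le>T. ?c k * ?c l * (\<integral>y. ?e k l y \<partial>\<pi>)) + E)" by (rule mult_left_mono) simp
  also have "\<dots> = (\<Sum>k\<le>T. \<Sum>l\<le>T. ?c k * ?c l * (real T * (\<integral>y. ?e k l y \<partial>\<pi>))) + real T * E"
    by (simp add: distrib_left sum_distrib_left mult_ac)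
  also have "(\<Sum>k\<le>T. \<Sum>l\<le>T. ?c k * ?c l * (real T * (\<integral>y. ?e k l y \<partial>\<pi>))) =
    (\<Sum>k\<le>T. \<Sum>l\<le>T. ?c k * ?c l * (\<Sum>t=1..T. ?e k l (?x t))) -
    (\<Sum>k\<le>T. \<Sum>l\<le>T. ?c k * ?c l * energy_sum T (grid_step R T k) (grid_step R T l) s)"
    unfolding sum_subtractf[symmetric]
    by (intro sum.cong refl) (simp add: energy_sum_def sum_subtractf trajectory_eq_orbit right_diff_distrib)
  also have "(\<Sum>k\<le>T. \<Sum>l\<le>T. ?c k * ?c l * (\<Sum>t=1..T. ?e k l (?x t))) = (\<Sum>t=1..T. \<Sum>k\<le>T. \<Sum>l\<le>T. ?c k * ?c l * ?e k l (?x t))"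
  proof -
    have "(\<Sum>k\<le>T. \<Sum>l\<le>T. ?c k * ?c l * (\<Sum>t=1..T. ?e k l (?x t))) = (\<Sum>k\<le>T. \<Sum>t=1..T. \<Sum>l\<le>T. ?c k * ?c l * ?e k l (?x t))"
      unfolding sum_distrib_left by (intro sum.cong refl sum.swap)
    also have "\<dots> = (\<Sum>t=1..T. \<Sum>k\<le>T. \<Sum>l\<le>T. ?c k * ?c l * ?e k l (?x t))" by (rule sum.swap)
    finally show ?thesis .
  qed
  also have "\<dots> \<le> (\<Sum>t=1..T. (state_norm N (force N \<delta> (?x t)))\<^sup>2 + E)"
    using x by (intro sum_mono lo)
  also have "\<dots> = (\<Sum>t=1..T. (state_norm N (force N \<delta> (?x t)))\<^sup>2) + real T * E" by (simp add: sum.distrib)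
  also have "(\<Sum>t=1..T. (state_norm N (force N \<delta> (?x t)))\<^sup>2) \<le> 2 * (\<Sum>t=1..T. state_inner N (snd s t) (force N \<delta> (?x t)))"
    unfolding \<delta>_def by (rule empirical_energy_le[OF T e x min])
  finally have main: "real T * (\<integral>y. (state_norm N (force N \<delta> y))\<^sup>2 \<partial>\<pi>) \<le>
    2 * (\<Sum>t=1..T. state_inner N (snd s t) (force N \<delta> (?x t))) + 2 * (real T * E)
    - (\<Sum>k\<le>T. \<Sum>l\<le>T. ?c k * ?c l * energy_sum T (grid_step R T k) (grid_step R T l) s)" by linarith
  have energy: "- (\<Sum>k\<le>T. \<Sum>l\<le>T. ?c k * ?c l * energy_sum T (grid_step R T k) (grid_step R T l) s) \<le>
    (\<Sum>k\<le>T. \<Sum>l\<le>T. grid_weight S T k * grid_weight S T l * \<bar>energy_sum T (grid_step R T k) (grid_step R T l) s\<bar>)"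
    unfolding sum_negf[symmetric]
  proof (intro sum_mono)
    fix k l assume kl: "k \<in> {..T}" "l \<in> {..T}"
    have "- (?c k * ?c l * energy_sum T (grid_step R T k) (grid_step R T l) s) \<le> \<bar>?c k\<bar> * \<bar>?c l\<bar> * \<bar>energy_sum T (grid_step R T k) (grid_step R T l) s\<bar>"
      unfolding abs_mult[symmetric] by (rule abs_ge_minus_self)
    also have "\<dots> \<le> grid_weight S T k * grid_weight S T l * \<bar>energy_sum T (grid_step R T k) (grid_step R T l) s\<bar>"
      using kl grid_weight_nonneg[OF S] by (intro mult_right_mono mult_mono ck) auto
    finally show "- (?c k * ?c l * energy_sum T (grid_step R T k) (grid_step R T l) s) \<le> grid_weight S T k * grid_weight S T l * \<bar>energy_sum T (grid_step R T k) (grid_step R T l) s\<bar>" .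
  qed
  have TE: "2 * (real T * E) = 4 * b\<^sup>2 * a * (2 * S * R)"
    unfolding E_def T\<epsilon>[symmetric] by (simp add: power2_eq_square)
  from main noise energy TE show ?thesis
    unfolding deviation_def \<delta>_def[symmetric] a_def[symmetric] by linarith
qed

text \<open>The total weight a = 2S(1 + R) does not grow with the number of steps, so the sum over
  the grid costs a factor a for the noise and its square for the energy.\<close>

lemma deviation_expectation:
  assumes S: "0 \<le> S" and T: "1 \<le> T"
  defines "a \<equiv> 2 * S * (1 + R)"
  shows "integrable st.paths (deviation S T)"
    and "(\<integral>s. deviation S T s \<partial>st.paths) \<le> 2 * (a * sqrt (real T * (2 * (\<omega> * b)\<^sup>2))) +
      a * a * sqrt (real T * (8 * (b\<^sup>2)\<^sup>2 * (1 + (\<integral>x. V x \<partial>\<pi>)) / (1 - \<eta>)))"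
proof -
  note X = noise_sum_expectation[OF grid_step_measurable abs_grid_step_le, of T R T]
  note Y = energy_sum_expectation[OF grid_step_measurable grid_step_measurable abs_grid_step_le abs_grid_step_le, of T R T _ R T]
  note g = grid_weight_nonneg[OF S, of T]
  let ?x = "sqrt (real T * (2 * (\<omega> * b)\<^sup>2))"
  let ?y = "sqrt (real T * (8 * (b\<^sup>2)\<^sup>2 * (1 + (\<integral>x. V x \<partial>\<pi>)) / (1 - \<eta>)))"
  have iX: "integrable st.paths (\<lambda>s. \<Sum>k\<le>T. grid_weight S T k * \<bar>noise_sum T (grid_step R T k) s\<bar>)"
    using X(1) by (intro Bochner_Integration.integrable_sum integrable_mult_right integrable_abs)
  have iY: "integrable st.paths (\<lambda>s. \<Sum>k\<le>T. \<Sum>l\<le>T. grid_weight S T k * grid_weight S T l * \<bar>energy_sum T (grid_step R T k) (grid_step R T l) s\<bar>)"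
    using Y(1) by (intro Bochner_Integration.integrable_sum integrable_mult_right integrable_abs)
  show "integrable st.paths (deviation S T)"
    unfolding deviation_def[abs_def] by (intro Bochner_Integration.integrable_add integrable_mult_right iX iY)
  have "(\<integral>s. deviation S T s \<partial>st.paths) =
    2 * (\<Sum>k\<le>T. grid_weight S T k * (\<integral>s. \<bar>noise_sum T (grid_step R T k) s\<bar> \<partial>st.paths)) +
    (\<Sum>k\<le>T. \<Sum>l\<le>T. grid_weight S T k * grid_weight S T l * (\<integral>s. \<bar>energy_sum T (grid_step R T k) (grid_step R T l) s\<bar> \<partial>st.paths))"
    unfolding deviation_def using iX iY X(1) Y(1) by (simp add: Bochner_Integration.integral_sum)
  also have "\<dots> \<le> 2 * (\<Sum>k\<le>T. grid_weight S T k * ?x) + (\<Sum>k\<le>T. \<Sum>l\<le>T. grid_weight S T k * grid_weight S T l * ?y)"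
    using X(2) Y(2) g by (intro add_mono mult_left_mono sum_mono) auto
  also have "\<dots> = 2 * (a * ?x) + a * a * ?y"
    unfolding a_def sum_grid_weight[OF T, of S, symmetric] by (simp add: sum_distrib_right sum_distrib_left mult_ac)
  finally show "(\<integral>s. deviation S T s \<partial>st.paths) \<le> 2 * (a * ?x) + a * a * ?y" .
qed

section \<open>Passage from single paths to expectations\<close>

lemma good_path_AE: "AE s in st.paths. \<forall>t. trajectory N s t \<in> state_ball \<and> snd s t \<in> noise_ball"
  unfolding AE_all_countable
proof
  fix t
  have "AE s in st.paths. orbit (step N) s t \<in> state_ball"
    using geometric_ergodicity_AE(1)[OF ergodic] centred_ball_sets by (rule st.AE_orbit)
  moreover have "AE s in st.paths. snd s t \<in> noise_ball"
    using noise_AE by (rule st.AE_noise) (simp add: sets_noise_measure centred_ball_sets)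
  ultimately show "AE s in st.paths. trajectory N s t \<in> state_ball \<and> snd s t \<in> noise_ball"
    by eventually_elim (simp add: trajectory_eq_orbit)
qed

text \<open>The norm is an integral with the path as a parameter, so joint measurability of the
  estimator makes it a random variable. On [0,R] the coupling agrees with its continuous
  extension.\<close>

lemma L2_norm_measurable:
  assumes phi: "case_prod phi \<in> borel_measurable (st.paths \<Otimes>\<^sub>M borel)"
  shows "(\<lambda>s. L2_norm N \<pi> R (\<lambda>r. phi s r - coupling N r)) \<in> borel_measurable st.paths"
proof -
  interpret rho: finite_measure "rho N \<pi> R" by (rule finite_measure_rho) (rule st.init.prob_space_axioms)
  have id: "(\<lambda>r. r) \<in> rho N \<pi> R \<rightarrow>\<^sub>M borel"
    unfolding measurable_cong_sets[OF sets_rho refl] by (rule measurable_restrict_space1) simp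
  have snd: "snd \<in> st.paths \<Otimes>\<^sub>M rho N \<pi> R \<rightarrow>\<^sub>M borel"
    by (rule measurable_compose[OF measurable_snd id])
  have 1: "(\<lambda>p. phi (fst p) (snd p)) \<in> borel_measurable (st.paths \<Otimes>\<^sub>M rho N \<pi> R)"
    using measurable_compose[OF measurable_Pair[OF measurable_fst snd] phi] by simp
  have 2: "(\<lambda>p. coupling N (max 0 (snd p))) \<in> borel_measurable (st.paths \<Otimes>\<^sub>M rho N \<pi> R)"
    using measurable_compose[OF snd coupling_measurable] by simp
  have "(\<lambda>p. \<bar>(phi (fst p) (snd p) - coupling N (max 0 (snd p))) * snd p\<bar>\<^sup>2) \<in> borel_measurable (st.paths \<Otimes>\<^sub>M rho N \<pi> R)"
    using 1 2 snd by measurable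
  then have "(\<lambda>s. \<integral>r. \<bar>(phi s r - coupling N (max 0 r)) * r\<bar>\<^sup>2 \<partial>rho N \<pi> R) \<in> borel_measurable st.paths"
    by (intro rho.borel_measurable_lebesgue_integral) (simp add: split_beta')
  then have "(\<lambda>s. L2_norm N \<pi> R (\<lambda>r. phi s r - coupling N (max 0 r))) \<in> borel_measurable st.paths"
    unfolding L2_norm_def by measurable
  moreover have "L2_norm N \<pi> R (\<lambda>r. phi s r - coupling N r) = L2_norm N \<pi> R (\<lambda>r. phi s r - coupling N (max 0 r))" for s
    by (rule L2_norm_cong) simp
  ultimately show ?thesis by simp
qed

text \<open>The squared error has expectation of order 1/\<surd>T, and the mean is at most the root
  of the mean square: this produces the fourth root of T. Of the factor q + 9, the energy
  contributes q, the noise 3 and the discretisation 6.\<close>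

lemma expected_error_bound:
  assumes c: "0 < coercivity_const N \<pi> R S" and hyp: "extend_zero R (coupling N) \<in> hyp_space R S"
    and T: "1 \<le> T" and phi: "case_prod phi \<in> borel_measurable (st.paths \<Otimes>\<^sub>M borel)"
    and min: "AE s in st.paths. is_arg_min (error_functional N T (trajectory N s)) (\<lambda>\<psi>. \<psi> \<in> hyp_space R S) (phi s)"
  defines "q \<equiv> sqrt (8 * (1 + (\<integral>x. V x \<partial>\<pi>)) / (1 - \<eta>))" and "err \<equiv> \<lambda>s. L2_norm N \<pi> R (\<lambda>r. phi s r - coupling N r)"
  shows "0 \<le> S" and "0 \<le> q" and "integrable st.paths err"
    and "(\<integral>s. err s \<partial>st.paths) \<le> sqrt ((2 * S * (1 + R))\<^sup>2 * b\<^sup>2 * (q + 9) / (coercivity_const N \<pi> R S * sqrt (real T)))"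
proof -
  let ?c = "coercivity_const N \<pi> R S"
  define a where "a = 2 * S * (1 + R)"
  define D where "D = 2 * \<omega> * b * (2 * S * R) + 4 * b\<^sup>2 * a * (2 * S * R)"
  \<comment> \<open>By the convention 1/0 = 0 a network without edges has coercivity constant
    0.\<close>
  have e: "num_edges N \<noteq> 0" by (rule notI) (use c in \<open>simp add: coercivity_const_def\<close>)
  show S: "0 \<le> S" using hyp_space_diff(4)[OF hyp hyp radius_nonneg] .
  have A: "0 \<le> (\<integral>x. V x \<partial>\<pi>)" using geometric_ergodicity_AE(2)[OF ergodic] by (rule integral_nonneg_AE)
  have \<eta>: "0 \<le> \<eta>" "\<eta> < 1" using ergodic by (auto simp: geometrically_ergodic_def)
  show q: "0 \<le> q" using A \<eta> by (simp add: q_def)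
  have bound: "AE s in st.paths. (err s)\<^sup>2 \<le> (deviation S T s + D) / (real T * ?c)"
    using good_path_AE min
  proof eventually_elim
    case (elim s)
    have h: "phi s \<in> hyp_space R S"
      and m: "error_functional N T (trajectory N s) (phi s) \<le> error_functional N T (trajectory N s) (extend_zero R (coupling N))"
      using elim(2) hyp by (auto simp: is_arg_min_def not_less)
    note d = hyp_space_diff[OF h hyp radius_nonneg]
    have "err s = L2_norm N \<pi> R (\<lambda>r. phi s r - extend_zero R (coupling N) r)"
      unfolding err_def by (rule L2_norm_cong) (simp add: extend_zero_def)
    then have "?c * (err s)\<^sup>2 \<le> (\<integral>x. (state_norm N (force N (\<lambda>r. phi s r - extend_zero R (coupling N) r) x))\<^sup>2 \<partial>\<pi>)"
      using coercivity_diff[OF c h hyp radius_nonneg] by simp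
    then have "real T * (?c * (err s)\<^sup>2) \<le> real T * (\<integral>x. (state_norm N (force N (\<lambda>r. phi s r - extend_zero R (coupling N) r) x))\<^sup>2 \<partial>\<pi>)"
      by (rule mult_left_mono) simp
    also have "\<dots> \<le> deviation S T s + 2 * \<omega> * b * (2 * S * R) + 4 * b\<^sup>2 * (2 * S * (1 + R)) * (2 * S * R)"
      using elim(1) d(2) by (intro pathwise_error_bound[OF T e S d(1) _ _ _ m]) auto
    finally show ?case using T c by (simp add: D_def a_def le_divide_eq mult_ac add.assoc)
  qed
  have int: "integrable st.paths (\<lambda>s. (deviation S T s + D) / (real T * ?c))"
    using deviation_expectation(1)[OF S T] by (intro integrable_divide Bochner_Integration.integrable_add) auto
  have meas: "err \<in> borel_measurable st.paths" unfolding err_def by (rule L2_norm_measurable[OF phi])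
  have sq: "integrable st.paths (\<lambda>s. (err s)\<^sup>2)"
  proof (rule Bochner_Integration.integrable_bound[OF int])
    show "(\<lambda>s. (err s)\<^sup>2) \<in> borel_measurable st.paths" using meas by measurable
    show "AE s in st.paths. norm ((err s)\<^sup>2) \<le> norm ((deviation S T s + D) / (real T * ?c))"
      using bound
    proof eventually_elim
      case (elim s)
      then show ?case unfolding real_norm_def abs_power2 by (rule order_trans[OF _ abs_ge_self])
    qed
  qed
  have a: "0 \<le> a" "2 * S * R \<le> a" "S \<le> a" using S radius_nonneg by (auto simp: a_def algebra_simps)
  have n2: "2 \<le> n" by (rule two_nodes[OF e])
  \<comment> \<open>Replaces the noise level by quantities on which the constants may depend. After
    that all three contributions are bounded by multiples of a^2 b^2 \<surd>T.\<close>
  have \<omega>: "\<omega> \<le> a * b"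
  proof -
    have "coupling N r \<le> S" if "r \<in> {0..R}" for r
    proof -
      obtain s l where "l-lipschitz_on {0..R} (extend_zero R (coupling N))" "s + l \<le> S"
        "\<And>r. r \<in> {0..R} \<Longrightarrow> \<bar>extend_zero R (coupling N) r\<bar> \<le> s"
        using hyp_spaceD[OF hyp radius_nonneg] by metis
      then show ?thesis using that lipschitz_on_nonneg[of l] by (fastforce simp: extend_zero_def)
    qed
    then have "\<omega> \<le> real n * K * S * R" by (rule noise_bound_le[OF n2])
    also have "\<dots> = S * (real n * (K * R))" by simp
    also have "\<dots> \<le> a * ((real n)\<^sup>2 * (K * R))"
      using a n2 K_nonneg radius_nonneg by (intro mult_mono) (auto simp: power2_eq_square)
    also have "\<dots> = a * b" by (simp add: b_def)
    finally show ?thesis .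
  qed
  have \<omega>b: "\<omega> * b \<le> a * b\<^sup>2" using mult_right_mono[OF \<omega> b_nonneg] by (simp add: power2_eq_square)
  have T1: "1 \<le> sqrt (real T)" using T by simp
  have t1: "2 * (a * sqrt (real T * (2 * (\<omega> * b)\<^sup>2))) \<le> 3 * (a\<^sup>2 * b\<^sup>2 * sqrt (real T))"
  proof -
    have "sqrt 2 \<le> 3 / 2" by (rule real_le_lsqrt) (simp_all add: power2_eq_square)
    then have "2 * sqrt 2 * (a * (\<omega> * b)) \<le> 3 * (a * (a * b\<^sup>2))"
      using mult_left_mono[OF \<omega>b a(1)] a(1) \<omega>_nonneg b_nonneg
      by (intro mult_mono[of "2 * sqrt 2" 3]) simp_all
    then have "2 * sqrt 2 * (a * (\<omega> * b)) * sqrt (real T) \<le> 3 * (a * (a * b\<^sup>2)) * sqrt (real T)"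
      by (rule mult_right_mono) simp
    moreover have "sqrt (real T * (2 * (\<omega> * b)\<^sup>2)) = sqrt (real T) * (sqrt 2 * (\<omega> * b))"
      unfolding real_sqrt_mult[of "real T"] real_sqrt_mult[of 2] using \<omega>_nonneg b_nonneg by simp
    ultimately show ?thesis by (simp add: power2_eq_square mult_ac)
  qed
  have t2: "a * a * sqrt (real T * (8 * (b\<^sup>2)\<^sup>2 * (1 + (\<integral>x. V x \<partial>\<pi>)) / (1 - \<eta>))) = q * (a\<^sup>2 * b\<^sup>2 * sqrt (real T))"
  proof -
    have "real T * (8 * (b\<^sup>2)\<^sup>2 * (1 + (\<integral>x. V x \<partial>\<pi>)) / (1 - \<eta>)) = real T * ((b\<^sup>2)\<^sup>2 * (8 * (1 + (\<integral>x. V x \<partial>\<pi>)) / (1 - \<eta>)))"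
      by simp
    then have "sqrt (real T * (8 * (b\<^sup>2)\<^sup>2 * (1 + (\<integral>x. V x \<partial>\<pi>)) / (1 - \<eta>))) = sqrt (real T) * (b\<^sup>2 * q)"
      by (simp only: real_sqrt_mult q_def real_sqrt_abs abs_power2)
    then show ?thesis by (simp add: power2_eq_square mult_ac)
  qed
  have t3: "D \<le> 6 * (a\<^sup>2 * b\<^sup>2 * sqrt (real T))"
  proof -
    have "2 * (\<omega> * b) * (2 * S * R) \<le> 2 * (a * b\<^sup>2) * a"
      using mult_left_mono[OF \<omega>b, of 2] a(1,2) S radius_nonneg
      by (intro mult_mono[of "2 * (\<omega> * b)"]) simp_all
    moreover have "4 * b\<^sup>2 * a * (2 * S * R) \<le> 4 * b\<^sup>2 * a * a" using a by (intro mult_left_mono) auto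
    ultimately have "D \<le> 6 * (a\<^sup>2 * b\<^sup>2) * 1" unfolding D_def by (simp add: power2_eq_square algebra_simps)
    also have "\<dots> \<le> 6 * (a\<^sup>2 * b\<^sup>2) * sqrt (real T)" using T1 by (intro mult_left_mono) auto
    finally show ?thesis by simp
  qed
  have "(\<integral>s. (err s)\<^sup>2 \<partial>st.paths) \<le> (\<integral>s. (deviation S T s + D) / (real T * ?c) \<partial>st.paths)"
    using sq int bound by (rule integral_mono_AE)
  also have "\<dots> = ((\<integral>s. deviation S T s \<partial>st.paths) + D) / (real T * ?c)"
    using deviation_expectation(1)[OF S T] by (simp add: st.paths.prob_space)
  also have "\<dots> \<le> ((q + 9) * (a\<^sup>2 * b\<^sup>2 * sqrt (real T))) / (real T * ?c)"
    using deviation_expectation(2)[OF S T, folded a_def] t1 t2 t3 c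
    by (intro divide_right_mono) (auto simp: distrib_right)
  also have "\<dots> = a\<^sup>2 * b\<^sup>2 * (q + 9) / (?c * sqrt (real T))"
  proof -
    define t where "t = sqrt (real T)"
    have t: "real T = t * t" "0 < t" using T by (simp_all add: t_def)
    show ?thesis unfolding t_def[symmetric] unfolding t(1) using c t(2) by (simp add: field_simps)
  qed
  finally have E: "(\<integral>s. (err s)\<^sup>2 \<partial>st.paths) \<le> a\<^sup>2 * b\<^sup>2 * (q + 9) / (?c * sqrt (real T))" .
  note J = st.paths.expectation_abs_le_sqrt[OF meas sq E]
  show "integrable st.paths err" by (rule J(1))
  have "\<bar>err s\<bar> = err s" for s by (simp add: err_def L2_norm_nonneg)
  then show "(\<integral>s. err s \<partial>st.paths) \<le> sqrt ((2 * S * (1 + R))\<^sup>2 * b\<^sup>2 * (q + 9) / (?c * sqrt (real T)))"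
    using J(2) by (simp add: a_def)
qed

end

text \<open>Compares fourth powers. On the left the bound on the force contributes n^8 K^4 R^4; two
  powers of K form the K^2 under the root, the other two go into the factor in front, hence the
  square root of K there. The factor 128, the summand 1 and the logarithm only enlarge the right
  side.\<close>

lemma le_gamma_root:
  fixes S R K q c :: real
  assumes S: "0 \<le> S" and R: "0 \<le> R" and K: "0 \<le> K" and c: "0 < c" and T: "1 \<le> T" and \<tau>: "0 \<le> \<tau>" and q: "0 \<le> q"
  shows "sqrt ((2 * S * (1 + R))\<^sup>2 * ((real n)\<^sup>2 * K * R)\<^sup>2 * q / (c * sqrt (real T)))
    \<le> (2 * \<bar>S\<bar> * (1 + \<bar>R\<bar>) * \<bar>R\<bar> * sqrt \<bar>K\<bar>) *
      root 4 ((128 * (real n ^ 8 * q\<^sup>2 + 1) * K\<^sup>2 + \<tau> * c * ln (real T)) / (real T * c\<^sup>2))"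
    (is "sqrt ?y \<le> ?\<gamma> * root 4 ?X")
proof -
  have \<gamma>: "0 \<le> ?\<gamma>" by simp
  have y: "0 \<le> ?y" using q c by simp
  have e: "real n ^ 8 * q\<^sup>2 * K\<^sup>2 / (real T * c\<^sup>2) \<le> ?X"
  proof (rule divide_right_mono)
    have "real n ^ 8 * q\<^sup>2 * K\<^sup>2 \<le> 128 * (real n ^ 8 * q\<^sup>2 + 1) * K\<^sup>2"
      by (intro mult_right_mono) auto
    moreover have "0 \<le> \<tau> * c * ln (real T)" using \<tau> c T by simp
    ultimately show "real n ^ 8 * q\<^sup>2 * K\<^sup>2 \<le> 128 * (real n ^ 8 * q\<^sup>2 + 1) * K\<^sup>2 + \<tau> * c * ln (real T)" by linarith
  qed simp
  have sqrt4: "sqrt u ^ 4 = u\<^sup>2" if "0 \<le> u" for u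
  proof -
    have "sqrt u ^ 4 = ((sqrt u)\<^sup>2)\<^sup>2" unfolding power_mult[symmetric] by simp
    then show ?thesis using that by simp
  qed
  have "sqrt ?y = root 4 (sqrt ?y ^ 4)" using y by (simp add: real_root_power_cancel)
  also have "sqrt ?y ^ 4 = ?y\<^sup>2" using y by (rule sqrt4)
  also have "?y\<^sup>2 = (2 * S * (1 + R) * R) ^ 4 * K\<^sup>2 * (real n ^ 8 * q\<^sup>2 * K\<^sup>2 / (real T * c\<^sup>2))"
  proof -
    have num: "(x\<^sup>2 * ((real n)\<^sup>2 * K * R)\<^sup>2 * q)\<^sup>2 = (x * R) ^ 4 * K\<^sup>2 * (real n ^ 8 * q\<^sup>2 * K\<^sup>2)" for x
    proof -
      have "((u::real)\<^sup>2)\<^sup>2 = u ^ 4" "(((u::real)\<^sup>2)\<^sup>2)\<^sup>2 = u ^ 8" for u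
        unfolding power_mult[symmetric] by simp_all
      then have "(x\<^sup>2 * ((real n)\<^sup>2 * K * R)\<^sup>2 * q)\<^sup>2 = x ^ 4 * (real n ^ 8 * K ^ 4 * R ^ 4) * q\<^sup>2"
        by (simp only: power_mult_distrib)
      also have "K ^ 4 = K\<^sup>2 * K\<^sup>2" unfolding power_add[symmetric] by simp
      also have "x ^ 4 * (real n ^ 8 * (K\<^sup>2 * K\<^sup>2) * R ^ 4) * q\<^sup>2 = (x * R) ^ 4 * K\<^sup>2 * (real n ^ 8 * q\<^sup>2 * K\<^sup>2)"
        unfolding power_mult_distrib by (simp only: mult_ac)
      finally show ?thesis .
    qed
    have "(c * sqrt (real T))\<^sup>2 = real T * c\<^sup>2" by (simp add: power_mult_distrib)
    then show ?thesis unfolding power_divide num by simp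
  qed
  also have "\<dots> = ?\<gamma> ^ 4 * (real n ^ 8 * q\<^sup>2 * K\<^sup>2 / (real T * c\<^sup>2))"
    using S R K by (simp add: power_mult_distrib sqrt4)
  also have "root 4 \<dots> \<le> root 4 (?\<gamma> ^ 4 * ?X)"
    using e \<gamma> by (intro real_root_le_mono mult_left_mono) auto
  also have "\<dots> = ?\<gamma> * root 4 ?X" using \<gamma> by (simp only: real_root_mult) (simp add: real_root_power_cancel del: abs_mult)
  finally show ?thesis .
qed

theorem theorem4:
  shows "\<exists>(\<gamma> :: real \<Rightarrow> real \<Rightarrow> real \<Rightarrow> real) (\<tau> :: nat \<Rightarrow> real \<Rightarrow> real \<Rightarrow> real)
           (c\<^sub>M :: nat \<Rightarrow> real \<Rightarrow> real \<Rightarrow> real).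
    (\<forall>R S K. 0 \<le> \<gamma> R S K) \<and>
    (\<forall>n A \<eta>. 0 < \<tau> n A \<eta> \<and> 0 < c\<^sub>M n A \<eta>) \<and>
    (\<forall>(N :: network) S0 R0 \<omega> \<Sigma> \<pi> V \<eta> R S K A c\<^sub>H T (phi_hat :: sample \<Rightarrow> real \<Rightarrow> real).
       contractive_network N S0 R0 \<omega> \<Sigma> \<longrightarrow>
       geometrically_ergodic N \<pi> V \<eta> \<longrightarrow>
       A = (\<integral>x. V x \<partial>\<pi>) \<longrightarrow>
       R = radius N R0 \<omega> \<longrightarrow>
       K = max_weight N \<longrightarrow>
       c\<^sub>H = coercivity_const N \<pi> R S \<longrightarrow>
       0 < c\<^sub>H \<longrightarrow>
       extend_zero R (coupling N) \<in> hyp_space R S \<longrightarrow>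
       1 \<le> T \<longrightarrow>
       case_prod phi_hat \<in> borel_measurable (sample_measure N \<pi> \<Otimes>\<^sub>M borel) \<longrightarrow>
       (AE s in sample_measure N \<pi>.
          is_arg_min (error_functional N T (trajectory N s)) (\<lambda>\<psi>. \<psi> \<in> hyp_space R S)
            (phi_hat s)) \<longrightarrow>
       integrable (sample_measure N \<pi>)
         (\<lambda>s. L2_norm N \<pi> R (\<lambda>r. phi_hat s r - coupling N r)) \<and>
       (\<integral>s. L2_norm N \<pi> R (\<lambda>r. phi_hat s r - coupling N r) \<partial>sample_measure N \<pi>)
         \<le> \<gamma> R S K *
           root 4 ((128 * c\<^sub>M (nodes N) A \<eta> * K\<^sup>2 + \<tau> (nodes N) A \<eta> * c\<^sub>H * ln (real T)) / (real T * c\<^sub>H\<^sup>2)))"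
proof -
  \<comment> \<open>The ergodicity enters through q alone. In \<open>c\<^sub>M\<close> it is joined
    by the number of nodes, and the summand 1 there gives positivity for all arguments.\<close>
  define q where "q A \<eta> = sqrt (8 * (1 + A) / (1 - \<eta>)) + 9" for A \<eta> :: real
  \<comment> \<open>The absolute values make \<gamma> non-negative for all real arguments.\<close>
  define \<gamma> where "\<gamma> R S K = 2 * \<bar>S\<bar> * (1 + \<bar>R\<bar>) * \<bar>R\<bar> * sqrt \<bar>K\<bar>" for R S K :: real
  \<comment> \<open>The factor of a non-negative term on the larger side; any positive value would
    serve.\<close>
  define \<tau> where "\<tau> n A \<eta> = (1 :: real)" for n :: nat and A \<eta> :: real
  define c\<^sub>M where "c\<^sub>M n A \<eta> = real n ^ 8 * (q A \<eta>)\<^sup>2 + 1" for n A \<eta>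
  have bound: "integrable (sample_measure N \<pi>) (\<lambda>s. L2_norm N \<pi> R (\<lambda>r. phi_hat s r - coupling N r)) \<and>
       (\<integral>s. L2_norm N \<pi> R (\<lambda>r. phi_hat s r - coupling N r) \<partial>sample_measure N \<pi>)
         \<le> \<gamma> R S K * root 4 ((128 * c\<^sub>M (nodes N) A \<eta> * K\<^sup>2 + \<tau> (nodes N) A \<eta> * c\<^sub>H * ln (real T)) / (real T * c\<^sub>H\<^sup>2))"
    if net: "contractive_network N S0 R0 \<omega> \<Sigma>" and erg: "geometrically_ergodic N \<pi> V \<eta>"
      and A: "A = (\<integral>x. V x \<partial>\<pi>)" and R: "R = radius N R0 \<omega>" and K: "K = max_weight N"
      and c: "c\<^sub>H = coercivity_const N \<pi> R S" "0 < c\<^sub>H"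
      and hyp: "extend_zero R (coupling N) \<in> hyp_space R S" and T: "1 \<le> T"
      and phi: "case_prod phi_hat \<in> borel_measurable (sample_measure N \<pi> \<Otimes>\<^sub>M borel)"
      and min: "AE s in sample_measure N \<pi>. is_arg_min (error_functional N T (trajectory N s)) (\<lambda>\<psi>. \<psi> \<in> hyp_space R S) (phi_hat s)"
    for N S0 R0 \<omega> \<Sigma> \<pi> V \<eta> R S K A c\<^sub>H T phi_hat
  proof -
    interpret stationary_network N S0 R0 \<omega> \<Sigma> \<pi> V \<eta>
      using net erg by (intro stationary_network.intro stationary_network_axioms.intro)
    note E = expected_error_bound[OF c(2)[unfolded c(1) R] hyp[unfolded R] T phi[unfolded sample_measure_eq] min[unfolded sample_measure_eq R]]
    have "(\<integral>s. L2_norm N \<pi> R (\<lambda>r. phi_hat s r - coupling N r) \<partial>sample_measure N \<pi>)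
      \<le> sqrt ((2 * S * (1 + R))\<^sup>2 * ((real (nodes N))\<^sup>2 * K * R)\<^sup>2 * q A \<eta> / (c\<^sub>H * sqrt (real T)))"
      using E(4) unfolding sample_measure_eq q_def A R K c(1) b_def by simp
    also have "\<dots> \<le> \<gamma> R S K * root 4 ((128 * c\<^sub>M (nodes N) A \<eta> * K\<^sup>2 + \<tau> (nodes N) A \<eta> * c\<^sub>H * ln (real T)) / (real T * c\<^sub>H\<^sup>2))"
      unfolding \<gamma>_def c\<^sub>M_def
    proof (rule le_gamma_root)
      show "0 \<le> q A \<eta>" using E(2) by (simp add: q_def A)
    qed (use E(1) radius_nonneg K_nonneg c(2) T in \<open>simp_all add: R K \<tau>_def\<close>)
    finally show ?thesis using E(3) unfolding sample_measure_eq R by simp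
  qed
  show ?thesis
  proof (intro exI conjI)
    show "\<forall>R S K. 0 \<le> \<gamma> R S K" by (simp add: \<gamma>_def)
    show "\<forall>n A \<eta>. 0 < \<tau> n A \<eta> \<and> 0 < c\<^sub>M n A \<eta>"
      by (simp add: \<tau>_def c\<^sub>M_def add_nonneg_pos)
  qed (intro allI impI, rule bound)
qed

end
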